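(* Let $A$ be a finite-dimensional associative algebra over $k$ with a unit element. $A$ becomes a Lie algebra $\mathfrak g$ for the Lie bracket $[a,b]=ab-ba$, $a,b\in A$, and $V=A$ becomes a $\mathfrak g$-module by left multiplication. Consider the semi-direct product $L=\mathfrak g\oplus V$ (in which $[x,v]=xv$ for $x\in\mathfrak g$, $v\in V$, and $V$ is an abelian ideal). Then the following conditions are equivalent: (1) $A$ is a Frobenius algebra; (2) $L$ is a Frobenius Lie algebra; (3) $V$ is a CP-ideal of $L$; (4) $R(V)$ is a maximal subfield of $D(L)$.
   Context: $k$ is a field of characteristic zero. For a finite-dimensional Lie algebra $L$ over $k$ and $f\in L^*$, put $L(f)=\{x\in L\mid f([x,y])=0 \text{ for all } y\in L\}$. The index of $L$ is $i(L)=\min_{f\in L^*}\dim L(f)$; $L$ is a Frobenius Lie algebra if $i(L)=0$. A CP (commutative polarization) of $L$ is a commutative Lie subalgebra $P$ which is a polarization with respect to some $f\in L^*$, i.e. $f([P,P])=0$ and $\dim P=\frac12(\dim L+\dim L(f))$; equivalently, a commutative Lie subalgebra $P$ with $\dim P=\frac12(\dim L+i(L))$. A CP-ideal of $L$ is a CP of $L$ which is an ideal. $D(L)$ is the quotient division ring of the enveloping algebra $U(L)$; $R(V)$ is the quotient field of the symmetric algebra $S(V)=U(V)$, viewed inside $D(L)$ (so $R(V)=D(V)$). A maximal subfield means a maximal commutative subfield. A finite-dimensional unital associative algebra $A$ is a Frobenius algebra if there is $f\in A^*$ such that the bilinear form $(a,b)\mapsto f(ab)$ on $A$ is nondegenerate.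 *)

theory Defs
  imports
    "HOL-Analysis.Product_Vector"
    "HOL-Algebra.QuotRing"
    "HOL-Algebra.Generated_Rings"
begin

section \<open>Finite-dimensional Lie algebras\<close>

text \<open>
  A vector space over the field \<open>'k\<close> is a type together with its scalar multiplication
  \<open>smul\<close>, as in the library locale \<^locale>\<open>vector_space\<close>.
\<close>

definition finite_dimensional :: "('k::field \<Rightarrow> 'l::ab_group_add \<Rightarrow> 'l) \<Rightarrow> bool" where
  "finite_dimensional smul \<longleftrightarrow> (\<exists>B. finite_dimensional_vector_space smul B)"

definition dual_space :: "('k::field \<Rightarrow> 'l::ab_group_add \<Rightarrow> 'l) \<Rightarrow> ('l \<Rightarrow> 'k) set" where
  "dual_space smul = {f. Vector_Spaces.linear smul (*) f}"

locale lie_algebra = vector_space smul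
  for smul :: "'k::field \<Rightarrow> 'l::ab_group_add \<Rightarrow> 'l" +
  fixes br :: "'l \<Rightarrow> 'l \<Rightarrow> 'l"
  assumes br_add_left: "br (x + y) z = br x z + br y z"
    and br_add_right: "br x (y + z) = br x y + br x z"
    and br_smul_left: "br (smul c x) y = smul c (br x y)"
    and br_smul_right: "br x (smul c y) = smul c (br x y)"
    and br_self: "br x x = 0"
    and jacobi: "br x (br y z) + br y (br z x) + br z (br x y) = 0"

definition stabilizer :: "('l \<Rightarrow> 'l \<Rightarrow> 'l) \<Rightarrow> ('l \<Rightarrow> 'k::zero) \<Rightarrow> 'l set" where
  "stabilizer br f = {x. \<forall>y. f (br x y) = 0}"

definition lie_index ::
  "('k::field \<Rightarrow> 'l::ab_group_add \<Rightarrow> 'l) \<Rightarrow> ('l \<Rightarrow> 'l \<Rightarrow> 'l) \<Rightarrow> nat" where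
  "lie_index smul br =
     (LEAST n. \<exists>f\<in>dual_space smul. n = vector_space.dim smul (stabilizer br f))"

definition frobenius_lie_algebra ::
  "('k::field \<Rightarrow> 'l::ab_group_add \<Rightarrow> 'l) \<Rightarrow> ('l \<Rightarrow> 'l \<Rightarrow> 'l) \<Rightarrow> bool" where
  "frobenius_lie_algebra smul br \<longleftrightarrow>
     lie_algebra smul br \<and> finite_dimensional smul \<and> lie_index smul br = 0"

definition lie_subalgebra ::
  "('k::field \<Rightarrow> 'l::ab_group_add \<Rightarrow> 'l) \<Rightarrow> ('l \<Rightarrow> 'l \<Rightarrow> 'l) \<Rightarrow> 'l set \<Rightarrow> bool" where
  "lie_subalgebra smul br P \<longleftrightarrow>
     module.subspace smul P \<and> (\<forall>x\<in>P. \<forall>y\<in>P. br x y \<in> P)"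

definition lie_ideal ::
  "('k::field \<Rightarrow> 'l::ab_group_add \<Rightarrow> 'l) \<Rightarrow> ('l \<Rightarrow> 'l \<Rightarrow> 'l) \<Rightarrow> 'l set \<Rightarrow> bool" where
  "lie_ideal smul br P \<longleftrightarrow>
     module.subspace smul P \<and> (\<forall>x. \<forall>y\<in>P. br x y \<in> P)"

definition polarization ::
  "('k::field \<Rightarrow> 'l::ab_group_add \<Rightarrow> 'l) \<Rightarrow> ('l \<Rightarrow> 'l \<Rightarrow> 'l) \<Rightarrow> ('l \<Rightarrow> 'k) \<Rightarrow> 'l set \<Rightarrow> bool"
  where
  "polarization smul br f P \<longleftrightarrow>
     lie_subalgebra smul br P \<and>
     (\<forall>x\<in>P. \<forall>y\<in>P. f (br x y) = 0) \<and>
     2 * vector_space.dim smul P =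
       vector_space.dim smul UNIV + vector_space.dim smul (stabilizer br f)"

definition commutative_polarization ::
  "('k::field \<Rightarrow> 'l::ab_group_add \<Rightarrow> 'l) \<Rightarrow> ('l \<Rightarrow> 'l \<Rightarrow> 'l) \<Rightarrow> 'l set \<Rightarrow> bool" where
  "commutative_polarization smul br P \<longleftrightarrow>
     (\<forall>x\<in>P. \<forall>y\<in>P. br x y = 0) \<and> (\<exists>f\<in>dual_space smul. polarization smul br f P)"

definition cp_ideal ::
  "('k::field \<Rightarrow> 'l::ab_group_add \<Rightarrow> 'l) \<Rightarrow> ('l \<Rightarrow> 'l \<Rightarrow> 'l) \<Rightarrow> 'l set \<Rightarrow> bool" where
  "cp_ideal smul br P \<longleftrightarrow> commutative_polarization smul br P \<and> lie_ideal smul br P"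


section \<open>The enveloping algebra\<close>

text \<open>
  The free associative unital \<open>'k\<close>-algebra on the set of symbols \<open>'l\<close>: finitely supported
  coefficient functions on words.
\<close>

definition free_algebra :: "('l list \<Rightarrow> 'k::field) ring" where
  "free_algebra =
     \<lparr>carrier = {p. finite {w. p w \<noteq> 0}},
      mult = (\<lambda>p q w. \<Sum>i\<le>length w. p (take i w) * q (drop i w)),
      one = (\<lambda>w. if w = [] then 1 else 0),
      zero = (\<lambda>w. 0),
      add = (\<lambda>p q w. p w + q w)\<rparr>"

definition free_const :: "'k::field \<Rightarrow> 'l list \<Rightarrow> 'k" where
  "free_const c = (\<lambda>w. if w = [] then c else 0)"

definition free_gen :: "'l \<Rightarrow> 'l list \<Rightarrow> 'k::field" where
  "free_gen x = (\<lambda>w. if w = [x] then 1 else 0)"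

text \<open>
  The first two families of relations cut the free algebra on the underlying set of \<open>L\<close> down to
  the tensor algebra of the vector space \<open>L\<close>; the third one imposes \<open>xy - yx = [x,y]\<close>.
\<close>

definition enveloping_relations ::
  "('k::field \<Rightarrow> 'l::ab_group_add \<Rightarrow> 'l) \<Rightarrow> ('l \<Rightarrow> 'l \<Rightarrow> 'l) \<Rightarrow> ('l list \<Rightarrow> 'k) set" where
  "enveloping_relations smul br =
     {free_gen (x + y) \<ominus>\<^bsub>free_algebra\<^esub> (free_gen x \<oplus>\<^bsub>free_algebra\<^esub> free_gen y) | x y. True} \<union>
     {free_gen (smul c x) \<ominus>\<^bsub>free_algebra\<^esub> (free_const c \<otimes>\<^bsub>free_algebra\<^esub> free_gen x) | c x. True} \<union>
     {(free_gen x \<otimes>\<^bsub>free_algebra\<^esub> free_gen y \<ominus>\<^bsub>free_algebra\<^esub> free_gen y \<otimes>\<^bsub>free_algebra\<^esub> free_gen x)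
        \<ominus>\<^bsub>free_algebra\<^esub> free_gen (br x y) | x y. True}"

definition enveloping_ideal ::
  "('k::field \<Rightarrow> 'l::ab_group_add \<Rightarrow> 'l) \<Rightarrow> ('l \<Rightarrow> 'l \<Rightarrow> 'l) \<Rightarrow> ('l list \<Rightarrow> 'k) set" where
  "enveloping_ideal smul br = genideal free_algebra (enveloping_relations smul br)"

definition enveloping_algebra ::
  "('k::field \<Rightarrow> 'l::ab_group_add \<Rightarrow> 'l) \<Rightarrow> ('l \<Rightarrow> 'l \<Rightarrow> 'l) \<Rightarrow> ('l list \<Rightarrow> 'k) set ring" where
  "enveloping_algebra smul br = free_algebra Quot (enveloping_ideal smul br)"

definition env_const ::
  "('k::field \<Rightarrow> 'l::ab_group_add \<Rightarrow> 'l) \<Rightarrow> ('l \<Rightarrow> 'l \<Rightarrow> 'l) \<Rightarrow> 'k \<Rightarrow> ('l list \<Rightarrow> 'k) set" where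
  "env_const smul br c = enveloping_ideal smul br +>\<^bsub>free_algebra\<^esub> free_const c"

definition env_gen ::
  "('k::field \<Rightarrow> 'l::ab_group_add \<Rightarrow> 'l) \<Rightarrow> ('l \<Rightarrow> 'l \<Rightarrow> 'l) \<Rightarrow> 'l \<Rightarrow> ('l list \<Rightarrow> 'k) set" where
  "env_gen smul br x = enveloping_ideal smul br +>\<^bsub>free_algebra\<^esub> free_gen x"

text \<open>
  The unital \<open>'k\<close>-subalgebra of \<open>U(L)\<close> generated by \<open>P\<close>. For a Lie subalgebra \<open>P\<close> this is \<open>U(P)\<close>
  viewed inside \<open>U(L)\<close>, hence \<open>S(P)\<close> if \<open>P\<close> is commutative.
\<close>

definition env_subalgebra ::
  "('k::field \<Rightarrow> 'l::ab_group_add \<Rightarrow> 'l) \<Rightarrow> ('l \<Rightarrow> 'l \<Rightarrow> 'l) \<Rightarrow> 'l set \<Rightarrow> ('l list \<Rightarrow> 'k) set set"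
  where
  "env_subalgebra smul br P =
     generate_ring (enveloping_algebra smul br)
       (range (env_const smul br) \<union> env_gen smul br ` P)"

lemma free_algebra_mult_closed:
  assumes "finite {w. p w \<noteq> 0}" "finite {w. q w \<noteq> (0::'k::field)}"
  shows "finite {w. (\<Sum>i\<le>length w. p (take i w) * q (drop i w)) \<noteq> 0}"
proof (rule finite_subset)
  show "{w. (\<Sum>i\<le>length w. p (take i w) * q (drop i w)) \<noteq> 0}
      \<subseteq> (\<lambda>(u, v). u @ v) ` ({w. p w \<noteq> 0} \<times> {w. q w \<noteq> 0})"
  proof
    fix w assume "w \<in> {w. (\<Sum>i\<le>length w. p (take i w) * q (drop i w)) \<noteq> 0}"
    then obtain i where "p (take i w) * q (drop i w) \<noteq> 0"
      by (auto elim: sum.not_neutral_contains_not_neutral)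
    then have "(take i w, drop i w) \<in> {w. p w \<noteq> 0} \<times> {w. q w \<noteq> 0}" by auto
    then show "w \<in> (\<lambda>(u, v). u @ v) ` ({w. p w \<noteq> 0} \<times> {w. q w \<noteq> 0})"
      by (rule rev_image_eqI) simp
  qed
  show "finite ((\<lambda>(u, v). u @ v) ` ({w. p w \<noteq> 0} \<times> {w. q w \<noteq> 0}))"
    using assms by blast
qed

lemma free_algebra_mult_assoc:
  fixes p q r :: "'l list \<Rightarrow> 'k::field"
  shows "(\<Sum>i\<le>length w. (\<Sum>j\<le>length (take i w). p (take j (take i w)) * q (drop j (take i w))) * r (drop i w))
       = (\<Sum>i\<le>length w. p (take i w) * (\<Sum>j\<le>length (drop i w). q (take j (drop i w)) * r (drop j (drop i w))))"
    (is "?l = ?r")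
proof -
  let ?n = "length w"
  let ?g = "\<lambda>j i. p (take j w) * q (drop j (take i w)) * r (drop i w)"
  have "?l = (\<Sum>i\<le>?n. \<Sum>j\<le>i. ?g j i)"
    by (intro sum.cong refl) (auto simp: sum_distrib_right min_def intro!: sum.cong)
  also have "\<dots> = (\<Sum>(i, j)\<in>(SIGMA i:{..?n}. {..i}). ?g j i)"
    by (simp add: sum.Sigma)
  also have "\<dots> = (\<Sum>(j, m)\<in>(SIGMA j:{..?n}. {..?n - j}). ?g j (j + m))"
    by (rule sum.reindex_bij_witness[where i = "\<lambda>(j, m). (j + m, j)" and j = "\<lambda>(i, j). (j, i - j)"])
       auto
  also have "\<dots> = (\<Sum>j\<le>?n. \<Sum>m\<le>?n - j. ?g j (j + m))"
    by (simp add: sum.Sigma)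
  also have "\<dots> = ?r"
    by (intro sum.cong refl)
       (auto simp: sum_distrib_left mult.assoc take_drop add.commute intro!: sum.cong)
  finally show ?thesis .
qed

lemma ring_free_algebra: "ring (free_algebra :: ('l list \<Rightarrow> 'k::field) ring)"
proof (rule ringI)
  show "abelian_group (free_algebra :: ('l list \<Rightarrow> 'k) ring)"
  proof (rule abelian_groupI)
    fix p q :: "'l list \<Rightarrow> 'k"
    assume "p \<in> carrier free_algebra" "q \<in> carrier free_algebra"
    then have "finite ({w. p w \<noteq> 0} \<union> {w. q w \<noteq> 0})" by (simp add: free_algebra_def)
    then show "p \<oplus>\<^bsub>free_algebra\<^esub> q \<in> carrier free_algebra"
      by (auto simp: free_algebra_def intro: rev_finite_subset[of "{w. p w \<noteq> 0} \<union> {w. q w \<noteq> 0}"])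
  next
    fix p :: "'l list \<Rightarrow> 'k" assume "p \<in> carrier free_algebra"
    then show "\<exists>q\<in>carrier free_algebra. q \<oplus>\<^bsub>free_algebra\<^esub> p = \<zero>\<^bsub>free_algebra\<^esub>"
      by (intro bexI[of _ "\<lambda>w. - p w"]) (auto simp: free_algebra_def)
  qed (auto simp: free_algebra_def add_ac)
  show "monoid (free_algebra :: ('l list \<Rightarrow> 'k) ring)"
  proof (rule monoidI)
    fix p :: "'l list \<Rightarrow> 'k"
    have *: "(\<Sum>i\<le>length w. (if take i w = [] then 1 else 0) * p (drop i w)) = p w" for w
    proof -
      have "(\<Sum>i\<le>length w. (if take i w = [] then 1 else 0) * p (drop i w))
          = (\<Sum>i\<in>{0}. p (drop i w))"
        by (rule sum.mono_neutral_cong_right) auto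
      then show ?thesis by simp
    qed
    show "\<one>\<^bsub>free_algebra\<^esub> \<otimes>\<^bsub>free_algebra\<^esub> p = p" using * by (simp add: free_algebra_def)
    have *: "(\<Sum>i\<le>length w. p (take i w) * (if drop i w = [] then 1 else 0)) = p w" for w
    proof -
      have "(\<Sum>i\<le>length w. p (take i w) * (if drop i w = [] then 1 else 0))
          = (\<Sum>i\<in>{length w}. p (take i w))"
        by (rule sum.mono_neutral_cong_right) auto
      then show ?thesis by simp
    qed
    show "p \<otimes>\<^bsub>free_algebra\<^esub> \<one>\<^bsub>free_algebra\<^esub> = p"
      using * by (simp add: free_algebra_def)
  next
    fix p q r :: "'l list \<Rightarrow> 'k"
    show "p \<otimes>\<^bsub>free_algebra\<^esub> q \<otimes>\<^bsub>free_algebra\<^esub> r = p \<otimes>\<^bsub>free_algebra\<^esub> (q \<otimes>\<^bsub>free_algebra\<^esub> r)"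
      using free_algebra_mult_assoc[where p = p and q = q and r = r] by (simp add: free_algebra_def)
  qed (auto simp: free_algebra_def free_algebra_mult_closed)
qed (auto simp: free_algebra_def algebra_simps sum.distrib)

lemma enveloping_relations_carrier:
  fixes smul :: "'k::field \<Rightarrow> 'l::ab_group_add \<Rightarrow> 'l"
  shows "enveloping_relations smul br \<subseteq> carrier free_algebra"
proof -
  interpret ring "free_algebra :: ('l list \<Rightarrow> 'k) ring" by (rule ring_free_algebra)
  have "free_gen x \<in> carrier (free_algebra :: ('l list \<Rightarrow> 'k) ring)" for x
    by (simp add: free_gen_def free_algebra_def)
  moreover have "free_const c \<in> carrier (free_algebra :: ('l list \<Rightarrow> 'k) ring)" for c
    by (auto simp: free_const_def free_algebra_def intro: finite_subset[of _ "{[]}"])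
  ultimately show ?thesis
    by (auto simp: enveloping_relations_def intro!: minus_closed a_closed m_closed)
qed

lemma ring_enveloping_algebra: "ring (enveloping_algebra smul br)"
  unfolding enveloping_algebra_def enveloping_ideal_def
  by (intro ideal.quotient_is_ring ring.genideal_ideal ring_free_algebra
      enveloping_relations_carrier)


section \<open>Quotient division rings and maximal subfields\<close>

definition division_ring :: "('d, 'm) ring_scheme \<Rightarrow> bool" where
  "division_ring D \<longleftrightarrow> ring D \<and> Units D = carrier D - {\<zero>\<^bsub>D\<^esub>}"

text \<open>
  \<open>D\<close> is a quotient division ring of \<open>U\<close> along the embedding \<open>j\<close>: every element of \<open>D\<close> is both a
  right fraction and a left fraction of elements of \<open>U\<close>. This determines \<open>(D, j)\<close> up to unique
  isomorphism over \<open>U\<close>. For the enveloping algebra of a finite-dimensional Lie algebra it exists,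
  since that is a (left and right) Ore domain.
\<close>

definition quotient_division_ring ::
  "('u, 'n) ring_scheme \<Rightarrow> ('d, 'm) ring_scheme \<Rightarrow> ('u \<Rightarrow> 'd) \<Rightarrow> bool" where
  "quotient_division_ring U D j \<longleftrightarrow>
     division_ring D \<and> j \<in> ring_hom U D \<and> inj_on j (carrier U) \<and>
     (\<forall>z\<in>carrier D.
        (\<exists>a\<in>carrier U. \<exists>s\<in>carrier U - {\<zero>\<^bsub>U\<^esub>}. z = j a \<otimes>\<^bsub>D\<^esub> inv\<^bsub>D\<^esub> (j s)) \<and>
        (\<exists>a\<in>carrier U. \<exists>s\<in>carrier U - {\<zero>\<^bsub>U\<^esub>}. z = inv\<^bsub>D\<^esub> (j s) \<otimes>\<^bsub>D\<^esub> j a))"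

text \<open>The fractions in \<open>D\<close> of a commutative subring \<open>S\<close> of \<open>U\<close>.\<close>

definition fractions ::
  "('u, 'n) ring_scheme \<Rightarrow> ('d, 'm) ring_scheme \<Rightarrow> ('u \<Rightarrow> 'd) \<Rightarrow> 'u set \<Rightarrow> 'd set" where
  "fractions U D j S = {j p \<otimes>\<^bsub>D\<^esub> inv\<^bsub>D\<^esub> (j q) | p q. p \<in> S \<and> q \<in> S \<and> q \<noteq> \<zero>\<^bsub>U\<^esub>}"

definition maximal_subfield :: "'d set \<Rightarrow> ('d, 'm) ring_scheme \<Rightarrow> bool" where
  "maximal_subfield K D \<longleftrightarrow>
     subfield K D \<and> (\<forall>K'. subfield K' D \<and> K \<subseteq> K' \<longrightarrow> K' = K)"


section \<open>Associative algebras and the semi-direct product\<close>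

text \<open>
  The type class \<^class>\<open>ring\<close> has no unit; the unit is demanded explicitly rather than via
  \<^class>\<open>ring_1\<close>, which would exclude the zero algebra.
\<close>

locale fd_unital_algebra = vector_space smul
  for smul :: "'k::field \<Rightarrow> 'a::ring \<Rightarrow> 'a" +
  assumes smul_mult_left: "smul c (x * y) = smul c x * y"
    and smul_mult_right: "smul c (x * y) = x * smul c y"
    and unit: "\<exists>e::'a. \<forall>x. e * x = x \<and> x * e = x"
    and finite_dim: "finite_dimensional smul"

definition frobenius_algebra :: "('k::field \<Rightarrow> 'a::ring \<Rightarrow> 'a) \<Rightarrow> bool" where
  "frobenius_algebra smul \<longleftrightarrow>
     (\<exists>f\<in>dual_space smul.
        (\<forall>a. (\<forall>b. f (a * b) = 0) \<longrightarrow> a = 0) \<and> (\<forall>b. (\<forall>a. f (a * b) = 0) \<longrightarrow> b = 0))"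

definition commutator :: "'a::ring \<Rightarrow> 'a \<Rightarrow> 'a" where
  "commutator a b = a * b - b * a"

text \<open>
  The bracket of the semi-direct product of a Lie algebra \<open>'g\<close> and a \<open>'g\<close>-module \<open>'v\<close> with action
  \<open>act\<close>.
\<close>

definition semidirect_bracket ::
  "('g \<Rightarrow> 'g \<Rightarrow> 'g) \<Rightarrow> ('g \<Rightarrow> 'v \<Rightarrow> 'v::ab_group_add) \<Rightarrow> 'g \<times> 'v \<Rightarrow> 'g \<times> 'v \<Rightarrow> 'g \<times> 'v" where
  "semidirect_bracket br act = (\<lambda>(x, v) (y, w). (br x y, act x w - act y v))"

definition L_smul :: "('k::field \<Rightarrow> 'a::ring \<Rightarrow> 'a) \<Rightarrow> 'k \<Rightarrow> 'a \<times> 'a \<Rightarrow> 'a \<times> 'a" where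
  "L_smul smul = module_prod.scale smul smul"

definition L_bracket :: "'a::ring \<times> 'a \<Rightarrow> 'a \<times> 'a \<Rightarrow> 'a \<times> 'a" where
  "L_bracket = semidirect_bracket commutator (*)"

definition V_ideal :: "('a::ring \<times> 'a) set" where
  "V_ideal = {0} \<times> UNIV"

definition R_V ::
  "('k::field \<Rightarrow> 'a::ring \<Rightarrow> 'a) \<Rightarrow> ('d, 'm) ring_scheme \<Rightarrow>
   ((('a \<times> 'a) list \<Rightarrow> 'k) set \<Rightarrow> 'd) \<Rightarrow> 'd set" where
  "R_V smul D j =
     fractions (enveloping_algebra (L_smul smul) L_bracket) D j
       (env_subalgebra (L_smul smul) L_bracket V_ideal)"

end

theory Submission
  imports Defs "HOL-Computational_Algebra.Polynomial"
begin

text \<open>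
  (1), (2) and (3) are compared by means of the stabilizers \<open>L(f)\<close>: for \<open>f = (g, h)\<close> the elements
  \<open>(0, v)\<close> of \<open>L(f)\<close> are those with \<open>h(Av) = 0\<close>, while \<open>dim L = 2 dim V\<close>.

  For (4), let \<open>L\<close> act on polynomial functions on \<open>V\<^sup>* \<times> A\<^sup>*\<close>: \<open>V\<close> by multiplication and \<open>x \<in> A\<close> by the
  derivation induced by left multiplication. This representation of \<open>U(L)\<close> replaces the
  Poincare-Birkhoff-Witt theorem: it shows that \<open>S(V)\<close> embeds in \<open>U(L)\<close> as the ring of polynomial
  functions on \<open>V\<^sup>*\<close>, and that \<open>1\<close> and a basis \<open>x\<^sub>1, \<dots>, x\<^sub>n\<close> of \<open>A\<close> are independent over \<open>S(V)\<close>. The matrix of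
  linear forms \<open>x\<^sub>i v\<^sub>j\<close> is nonsingular over \<open>R(V)\<close> iff some \<open>h \<in> V\<^sup>*\<close> makes it nonsingular, that is, iff \<open>A\<close> is
  Frobenius.

  If the matrix is singular, some nonzero \<open>z = \<Sum> p\<^sub>i x\<^sub>i\<close> with \<open>p\<^sub>i \<in> S(V)\<close> commutes with \<open>V\<close>, and by
  independence it is not in \<open>R(V)\<close>; the bicommutant of \<open>R(V) \<union> {z}\<close> is then a larger subfield.
  If it is nonsingular, there are \<open>d\<^sub>j \<in> \<Sum> R(V) x\<^sub>i\<close> with \<open>[d\<^sub>i, v\<^sub>j] = \<delta>\<^sub>i\<^sub>j\<close>, and the Euler operator
  \<open>z \<mapsto> \<Sum> [z, v\<^sub>j] d\<^sub>j\<close> multiplies \<open>z\<close> by its order in the \<open>x\<^sub>i\<close>, up to lower order. Hence an element of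
  \<open>R(V) U(L)\<close> commuting with \<open>V\<close> has order \<open>0\<close>, that is, lies in \<open>R(V)\<close>.
\<close>

section \<open>Polynomial functions\<close>

text \<open>Polynomials are taken as functions, which loses nothing over an infinite field.
  Arguments are total, so \<open>I\<close> only records which coordinates may occur, and polynomials
  in different sets of variables share one type.\<close>

inductive_set polyfun :: "'i set \<Rightarrow> (('i \<Rightarrow> 'k::field) \<Rightarrow> 'k) set" for I where
  polyfun_const: "(\<lambda>_. c) \<in> polyfun I"
| polyfun_var: "i \<in> I \<Longrightarrow> (\<lambda>q. q i) \<in> polyfun I"
| polyfun_add: "P \<in> polyfun I \<Longrightarrow> Q \<in> polyfun I \<Longrightarrow> (\<lambda>q. P q + Q q) \<in> polyfun I"
| polyfun_mult: "P \<in> polyfun I \<Longrightarrow> Q \<in> polyfun I \<Longrightarrow> (\<lambda>q. P q * Q q) \<in> polyfun I"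

lemma polyfun_uminus: "P \<in> polyfun I \<Longrightarrow> (\<lambda>q. - P q) \<in> polyfun I"
  using polyfun_mult[OF polyfun_const[of "-1" I]] by simp

lemma polyfun_diff:
  assumes "P \<in> polyfun I" "Q \<in> polyfun I"
  shows "(\<lambda>q. P q - Q q) \<in> polyfun I"
  using polyfun_add[OF assms(1) polyfun_uminus[OF assms(2)]] by simp

lemma polyfun_sum:
  assumes "\<And>a. a \<in> A \<Longrightarrow> P a \<in> polyfun I"
  shows "(\<lambda>q. \<Sum>a\<in>A. P a q) \<in> polyfun I"
  using assms
proof (induction A rule: infinite_finite_induct)
  case (insert x F)
  then show ?case by (simp add: polyfun_add)
qed (auto intro: polyfun_const)

lemma polyfun_mono: "I \<subseteq> J \<Longrightarrow> polyfun I \<subseteq> polyfun J"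
proof
  fix P :: "('a \<Rightarrow> 'b) \<Rightarrow> 'b" assume IJ: "I \<subseteq> J" and "P \<in> polyfun I"
  from this(2) show "P \<in> polyfun J"
    by induction (use IJ in \<open>auto intro: polyfun.intros\<close>)
qed

lemma polyfun_cong:
  assumes "P \<in> polyfun I" and "\<And>i. i \<in> I \<Longrightarrow> q i = q' i"
  shows "P q = P q'"
  using assms by (induction) auto

text \<open>Restriction to a line reduces questions about several variables to univariate
  polynomials; zero divisors and derivatives are both treated this way.\<close>

lemma polyfun_line:
  assumes "P \<in> polyfun I"
  shows "\<exists>r. \<forall>t. P (\<lambda>i. q i + t * w i) = poly r t"
  using assms
proof induction
  case (polyfun_const c)
  show ?case by (rule exI[of _ "[:c:]"]) simp
next
  case (polyfun_var i)
  show ?case by (rule exI[of _ "[:q i, w i:]"]) simp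
next
  case (polyfun_add P Q)
  then obtain r s where "\<forall>t. P (\<lambda>i. q i + t * w i) = poly r t" "\<forall>t. Q (\<lambda>i. q i + t * w i) = poly s t"
    by blast
  then show ?case by (intro exI[of _ "r + s"]) simp
next
  case (polyfun_mult P Q)
  then obtain r s where "\<forall>t. P (\<lambda>i. q i + t * w i) = poly r t" "\<forall>t. Q (\<lambda>i. q i + t * w i) = poly s t"
    by blast
  then show ?case by (intro exI[of _ "r * s"]) simp
qed

text \<open>The line \<open>?l\<close> passes through \<open>q0\<close> at parameter 0 and
  \<open>q1\<close> at parameter 1. On it the product of two univariate polynomials vanishes
  everywhere, hence is zero because the field is infinite, and the factor coming from
  \<open>P\<close> is nonzero.\<close>

lemma polyfun_no_zero_divisors:
  fixes P Q :: "('i \<Rightarrow> 'k::field_char_0) \<Rightarrow> 'k"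
  assumes P: "P \<in> polyfun I" and Q: "Q \<in> polyfun J" and PQ: "\<And>q. P q * Q q = 0"
    and nz: "P q0 \<noteq> 0"
  shows "Q q1 = 0"
proof -
  let ?l = "\<lambda>t i. q0 i + t * (q1 i - q0 i)"
  obtain r s where r: "\<And>t. P (?l t) = poly r t" and s: "\<And>t. Q (?l t) = poly s t"
    using polyfun_line[OF P, of q0 "\<lambda>i. q1 i - q0 i"] polyfun_line[OF Q, of q0 "\<lambda>i. q1 i - q0 i"]
    by blast
  have "poly (r * s) t = poly 0 t" for t using PQ[of "?l t"] by (simp add: r s)
  then have "r * s = 0" using poly_eq_poly_eq_iff by blast
  moreover have "r \<noteq> 0" using r[of 0] nz by auto
  ultimately have "s = 0" by simp
  then show ?thesis using s[of 1] by simp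
qed

section \<open>Directional derivatives of polynomial functions\<close>

definition dirderiv :: "(('i \<Rightarrow> 'k::field_char_0) \<Rightarrow> 'k) \<Rightarrow> ('i \<Rightarrow> 'k) \<Rightarrow> ('i \<Rightarrow> 'k) \<Rightarrow> 'k" where
  "dirderiv P q w = coeff (THE r. \<forall>t. P (\<lambda>i. q i + t * w i) = poly r t) 1"

text \<open>A polynomial over an infinite field is determined by its values, so the description in
  \<open>dirderiv\<close> is unique. Taking the linear coefficient along a line avoids
  limits.\<close>

lemma dirderivI:
  assumes "\<And>t. P (\<lambda>i. q i + t * w i) = poly r t"
  shows "dirderiv P q w = coeff r 1"
proof -
  have "(THE r. \<forall>t. P (\<lambda>i. q i + t * w i) = poly r t) = r"
    using assms by (intro the_equality) (auto simp: poly_eq_poly_eq_iff[symmetric] fun_eq_iff)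
  then show ?thesis by (simp add: dirderiv_def)
qed

lemma dirderiv_const [simp]: "dirderiv (\<lambda>_. c) q w = 0"
  by (subst dirderivI[of _ _ _ "[:c:]"]) auto

lemma dirderiv_var [simp]: "dirderiv (\<lambda>q. q i) q w = w i"
  by (subst dirderivI[of _ _ _ "[:q i, w i:]"]) auto

lemma dirderiv_add:
  assumes "P \<in> polyfun I" "Q \<in> polyfun I"
  shows "dirderiv (\<lambda>q. P q + Q q) q w = dirderiv P q w + dirderiv Q q w"
proof -
  obtain r s where "\<And>t. P (\<lambda>i. q i + t * w i) = poly r t" "\<And>t. Q (\<lambda>i. q i + t * w i) = poly s t"
    using polyfun_line[OF assms(1), of q w] polyfun_line[OF assms(2), of q w] by blast
  then show ?thesis
    using dirderivI[of P q w r] dirderivI[of Q q w s] dirderivI[of "\<lambda>q. P q + Q q" q w "r + s"]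
    by simp
qed

lemma dirderiv_mult:
  assumes "P \<in> polyfun I" "Q \<in> polyfun I"
  shows "dirderiv (\<lambda>q. P q * Q q) q w = dirderiv P q w * Q q + P q * dirderiv Q q w"
proof -
  obtain r s where rs: "\<And>t. P (\<lambda>i. q i + t * w i) = poly r t" "\<And>t. Q (\<lambda>i. q i + t * w i) = poly s t"
    using polyfun_line[OF assms(1), of q w] polyfun_line[OF assms(2), of q w] by blast
  then have "P q = coeff r 0" "Q q = coeff s 0"
    by (metis (no_types, lifting) add_0_right mult_zero_left poly_0_coeff_0 ext)+
  with rs show ?thesis
    using dirderivI[of P q w r] dirderivI[of Q q w s] dirderivI[of "\<lambda>q. P q * Q q" q w "r * s"]
    by (simp add: coeff_mult)
qed

lemma dirderiv_sum:
  assumes "\<And>a. a \<in> A \<Longrightarrow> P a \<in> polyfun I"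
  shows "dirderiv (\<lambda>q. \<Sum>a\<in>A. P a q) q w = (\<Sum>a\<in>A. dirderiv (P a) q w)"
  using assms
proof (induction A rule: infinite_finite_induct)
  case (insert x F)
  then show ?case by (simp add: dirderiv_add[where I = I] polyfun_sum)
qed auto

text \<open>The direction \<open>\<xi> q\<close> may vary polynomially with the point: this is the
  action of a polynomial vector field.\<close>

lemma polyfun_dirderiv:
  assumes "P \<in> polyfun I" and "\<And>i. i \<in> I \<Longrightarrow> (\<lambda>q. \<xi> q i) \<in> polyfun I"
  shows "(\<lambda>q. dirderiv P q (\<xi> q)) \<in> polyfun I"
  using assms
proof induction
  case (polyfun_add P Q)
  then show ?case by (simp add: dirderiv_add[where I = I] polyfun.intros)
next
  case (polyfun_mult P Q)
  then show ?case by (simp add: dirderiv_mult[where I = I] polyfun.intros)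
qed (auto intro: polyfun_const)

lemma dirderiv_add_direction:
  assumes "P \<in> polyfun I"
  shows "dirderiv P q (\<lambda>i. w i + w' i) = dirderiv P q w + dirderiv P q w'"
  using assms
  by induction (simp_all add: dirderiv_add[where I = I] dirderiv_mult[where I = I] algebra_simps)

lemma dirderiv_scale_direction:
  assumes "P \<in> polyfun I"
  shows "dirderiv P q (\<lambda>i. c * w i) = c * dirderiv P q w"
  using assms
  by induction (simp_all add: dirderiv_add[where I = I] dirderiv_mult[where I = I] algebra_simps)

section \<open>Conditions (1), (2) and (3)\<close>

lemma dual_space_iff:
  fixes s :: "'k::field \<Rightarrow> 'l::ab_group_add \<Rightarrow> 'l"
  assumes "vector_space s"
  shows "f \<in> dual_space s \<longleftrightarrow> (\<forall>u v. f (u + v) = f u + f v) \<and> (\<forall>c v. f (s c v) = c * f v)"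
proof -
  interpret vector_space s by fact
  interpret F: vector_space "(*) :: 'k \<Rightarrow> 'k \<Rightarrow> 'k" by unfold_locales (auto simp: algebra_simps)
  interpret vector_space_pair s "(*) :: 'k \<Rightarrow> 'k \<Rightarrow> 'k" ..
  show ?thesis by (auto simp: dual_space_def module_hom_eq_linear[symmetric] module_hom_iff module_axioms F.module_axioms)
qed

locale fd_algebra_basis = fd_unital_algebra smul + finite_dimensional_vector_space smul B
  for smul :: "'k::field \<Rightarrow> 'a::ring \<Rightarrow> 'a" and B :: "'a set"
begin

abbreviation crd :: "'a \<Rightarrow> 'a \<Rightarrow> 'k" where "crd \<equiv> representation B"

lemma in_span_B [simp]: "v \<in> span B"
  by (simp add: span_Basis)

lemma crd_add: "crd (u + v) b = crd u b + crd v b"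
  by (simp add: representation_add independent_Basis)

lemma crd_smul: "crd (smul c v) b = c * crd v b"
  by (simp add: representation_scale independent_Basis)

lemma crd_diff: "crd (u - v) b = crd u b - crd v b"
  by (simp add: representation_diff independent_Basis)

lemma crd_zero [simp]: "crd 0 b = 0"
  using crd_smul[of 0 0 b] by simp

lemma crd_basis: "b \<in> B \<Longrightarrow> crd b b' = (if b = b' then 1 else 0)"
  by (simp add: representation_basis independent_Basis)

lemma crd_sum: "crd (\<Sum>a\<in>A. f a) b = (\<Sum>a\<in>A. crd (f a) b)"
  by (induction A rule: infinite_finite_induct) (auto simp: crd_add)

lemma sum_crd: "(\<Sum>b\<in>B. smul (crd v b) b) = v"
  by (rule sum_representation_eq) (auto simp: independent_Basis finite_Basis)

lemma sum_crd_basis: "b \<in> B \<Longrightarrow> (\<Sum>b'\<in>B. crd b b' * f b') = f b"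
  by (simp add: crd_basis if_distrib[of "\<lambda>x. x * _"] finite_Basis sum.delta cong: if_cong)

lemma dual_add: "f \<in> dual_space smul \<Longrightarrow> f (u + v) = f u + f v"
  and dual_smul: "f \<in> dual_space smul \<Longrightarrow> f (smul c v) = c * f v"
  by (simp_all add: dual_space_iff[OF vector_space_axioms])

lemma dual_zero: "f \<in> dual_space smul \<Longrightarrow> f 0 = 0"
  using dual_smul[of f 0 0] by simp

lemma dual_sum: "f \<in> dual_space smul \<Longrightarrow> f (\<Sum>a\<in>A. g a) = (\<Sum>a\<in>A. f (g a))"
  by (induction A rule: infinite_finite_induct) (auto simp: dual_add dual_zero)

lemma dual_crd: "f \<in> dual_space smul \<Longrightarrow> f v = (\<Sum>b\<in>B. crd v b * f b)"
  by (subst sum_crd[of v, symmetric]) (simp add: dual_sum dual_smul)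

text \<open>In finite dimension nondegeneracy on one side implies it on the other.
  \<open>T v\<close> has the coordinates \<open>f (b * v)\<close>, so the hypothesis makes
  \<open>T\<close> injective, hence surjective, and an \<open>x\<close> with
  \<open>f (x * w) = 0\<close> for all \<open>w\<close> is orthogonal to every basis vector.\<close>

lemma frobenius_algebraI:
  assumes f: "f \<in> dual_space smul" and nd: "\<And>b. (\<And>a. f (a * b) = 0) \<Longrightarrow> b = 0"
  shows "frobenius_algebra smul"
  unfolding frobenius_algebra_def
proof (intro bexI conjI allI impI)
  fix x assume x: "\<forall>b. f (x * b) = 0"
  define T where "T v = (\<Sum>b\<in>B. smul (f (b * v)) b)" for v
  have T_add: "T (u + v) = T u + T v" and T_smul: "T (smul c v) = smul c (T v)" for u v c
    by (simp_all add: T_def distrib_left dual_add[OF f] dual_smul[OF f] smul_mult_right[symmetric]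
        scale_left_distrib sum.distrib scale_sum_right)
  have lin: "Vector_Spaces.linear smul smul T"
    by (auto intro!: Vector_Spaces.linear.intro module_hom.intro module_hom_axioms.intro
        vector_space_axioms module_axioms T_add T_smul)
  have T_diff: "T (u - v) = T u - T v" for u v
    using T_add[of "u - v" v] by simp
  have crd_T: "crd (T v) b = (if b \<in> B then f (b * v) else 0)" for v b
    by (simp add: T_def crd_sum crd_smul crd_basis finite_Basis if_distrib[of "\<lambda>x. _ * x"] cong: if_cong)
  have f_left: "f (a * v) = (\<Sum>b\<in>B. crd a b * crd (T v) b)" for a v
  proof -
    have "f (a * v) = f (\<Sum>b\<in>B. smul (crd a b) (b * v))"
      by (subst sum_crd[of a, symmetric]) (simp add: sum_distrib_right smul_mult_left)
    then show ?thesis by (simp add: dual_sum[OF f] dual_smul[OF f] crd_T)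
  qed
  have "inj T"
  proof (rule injI)
    fix u v assume "T u = T v"
    then have "T (u - v) = 0" by (simp add: T_diff)
    then have "u - v = 0" by (intro nd) (simp add: f_left)
    then show "u = v" by simp
  qed
  then have "surj T" by (rule linear_inj_imp_surj[OF lin])
  have "crd x b = 0" if b: "b \<in> B" for b
  proof -
    obtain w where "b = T w" using \<open>surj T\<close> by (metis surjD)
    then have "0 = (\<Sum>b'\<in>B. crd x b' * crd b b')" using x f_left[of x w] by simp
    then show ?thesis using sum_crd_basis[OF b, of "crd x"] by (simp add: mult.commute)
  qed
  then show "x = 0" using sum_crd[of x] by simp
qed (use assms in auto)

section \<open>The semi-direct product as a Lie algebra, and the stabilizers of its
  functionals\<close>

lemma L_smul_apply [simp]: "L_smul smul c (x, v) = (smul c x, smul c v)"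
proof -
  interpret P: finite_dimensional_vector_space_prod smul smul B B ..
  show ?thesis by (simp add: L_smul_def P.scale_def)
qed

lemma L_bracket_apply [simp]: "L_bracket (x, v) (y, w) = (x * y - y * x, x * w - y * v)"
  by (simp add: L_bracket_def semidirect_bracket_def commutator_def)

sublocale L: finite_dimensional_vector_space "L_smul smul" "B \<times> {0} \<union> {0} \<times> B"
proof -
  interpret P: finite_dimensional_vector_space_prod smul smul B B ..
  show "finite_dimensional_vector_space (L_smul smul) (B \<times> {0} \<union> {0} \<times> B)"
    using P.p.finite_dimensional_vector_space_axioms by (simp add: L_smul_def P.Basis_pair_def)
qed

lemma L_dim_Times: "subspace S \<Longrightarrow> subspace T \<Longrightarrow> L.dim (S \<times> T) = dim S + dim T"
proof -
  interpret P: finite_dimensional_vector_space_prod smul smul B B ..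
  show "subspace S \<Longrightarrow> subspace T \<Longrightarrow> L.dim (S \<times> T) = dim S + dim T"
    using P.dim_Times by (simp add: L_smul_def)
qed

lemma L_dim_UNIV: "L.dim UNIV = 2 * card B"
  using L_dim_Times[of UNIV UNIV] by simp

lemma L_dim_V: "L.dim V_ideal = card B"
  using L_dim_Times[of "{0}" UNIV] by (simp add: V_ideal_def)

lemma lie_algebra_L: "lie_algebra (L_smul smul) L_bracket"
  by unfold_locales
    (auto simp: algebra_simps smul_mult_left[symmetric] smul_mult_right[symmetric] scale_right_diff_distrib zero_prod_def)

lemma lie_ideal_V: "lie_ideal (L_smul smul) L_bracket V_ideal"
  by (auto simp: lie_ideal_def V_ideal_def L.subspace_def zero_prod_def)

lemma L_dualD:
  assumes "f \<in> dual_space (L_smul smul)"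
  shows "f (p + q) = f p + f q" "f (L_smul smul c p) = c * f p"
  using assms by (simp_all add: dual_space_iff[OF L.vector_space_axioms] del: split_paired_All)

lemma L_zero_dual: "(\<lambda>_. 0) \<in> dual_space (L_smul smul)"
  by (simp add: dual_space_iff[OF L.vector_space_axioms])

lemma frobenius_lie_iff:
  "frobenius_lie_algebra (L_smul smul) L_bracket \<longleftrightarrow>
    (\<exists>f\<in>dual_space (L_smul smul). stabilizer L_bracket f \<subseteq> {0})"
proof -
  let ?P = "\<lambda>n. \<exists>f\<in>dual_space (L_smul smul). n = L.dim (stabilizer L_bracket f)"
  \<comment> \<open>The zero functional shows that some dimension occurs, so the minimum is
    attained.\<close>
  have "?P (LEAST n. ?P n)" by (rule LeastI_ex) (use L_zero_dual in blast)
  then have "lie_index (L_smul smul) L_bracket = 0 \<longleftrightarrow> ?P 0"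
    unfolding lie_index_def using Least_eq_0[of ?P] by metis
  moreover have "?P 0 \<longleftrightarrow> (\<exists>f\<in>dual_space (L_smul smul). stabilizer L_bracket f \<subseteq> {0})"
    using L.dim_eq_0 by metis
  moreover have "finite_dimensional (L_smul smul)"
    unfolding finite_dimensional_def using L.finite_dimensional_vector_space_axioms by blast
  ultimately show ?thesis using lie_algebra_L by (simp add: frobenius_lie_algebra_def)
qed

text \<open>\<open>V_ideal\<close> is an abelian ideal whatever \<open>f\<close> is, and dim L = 2
  dim V; the dimension condition on a polarization then says exactly that the stabilizer of
  \<open>f\<close> has dimension 0.\<close>

lemma cp_ideal_V_iff:
  "cp_ideal (L_smul smul) L_bracket V_ideal \<longleftrightarrow>
    (\<exists>f\<in>dual_space (L_smul smul). stabilizer L_bracket f \<subseteq> {0})"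
proof -
  have br: "L_bracket x y = 0" if "x \<in> V_ideal" "y \<in> V_ideal" for x y :: "'a \<times> 'a"
    using that by (auto simp: V_ideal_def zero_prod_def)
  have sub: "lie_subalgebra (L_smul smul) L_bracket V_ideal"
    using lie_ideal_V by (auto simp: lie_ideal_def lie_subalgebra_def)
  have "polarization (L_smul smul) L_bracket f V_ideal \<longleftrightarrow> stabilizer L_bracket f \<subseteq> {0}"
    if f: "f \<in> dual_space (L_smul smul)" for f
  proof -
    have "f 0 = 0" using L_dualD(2)[OF f, of 0 0] by (simp add: zero_prod_def)
    then have "polarization (L_smul smul) L_bracket f V_ideal \<longleftrightarrow> L.dim (stabilizer L_bracket f) = 0"
      using sub br by (auto simp: polarization_def L_dim_UNIV L_dim_V simp del: L.dim_UNIV)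
    then show ?thesis by simp
  qed
  then show ?thesis using br lie_ideal_V by (auto simp: cp_ideal_def commutative_polarization_def)
qed

text \<open>Forward, a Frobenius form \<open>h\<close> is extended by zero on the first factor:
  brackets with \<open>(0, w)\<close> test \<open>h (x * w)\<close>, and those with
  \<open>(y, 0)\<close> test \<open>h (y * v)\<close>. Backward, \<open>f\<close> is restricted to
  \<open>V\<close>, and a vector \<open>v\<close> in the right radical gives an element
  \<open>(0, v)\<close> of the stabilizer.\<close>

lemma frobenius_algebra_iff:
  "frobenius_algebra smul \<longleftrightarrow> (\<exists>f\<in>dual_space (L_smul smul). stabilizer L_bracket f \<subseteq> {0})"
proof
  assume "frobenius_algebra smul"
  then obtain h where h: "h \<in> dual_space smul"
    and nd: "\<And>a. (\<And>b. h (a * b) = 0) \<Longrightarrow> a = 0" "\<And>b. (\<And>a. h (a * b) = 0) \<Longrightarrow> b = 0"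
    by (auto simp: frobenius_algebra_def)
  let ?f = "\<lambda>p. h (snd p)"
  have "?f \<in> dual_space (L_smul smul)"
    by (simp add: dual_space_iff[OF L.vector_space_axioms] dual_add[OF h] dual_smul[OF h])
  moreover have "stabilizer L_bracket ?f \<subseteq> {0}"
  proof
    fix p assume p: "p \<in> stabilizer L_bracket ?f"
    obtain x v where xv: "p = (x, v)" by (cases p)
    have st: "h (x * w - y * v) = 0" for y w
      using p by (auto simp: xv stabilizer_def dest: spec[of _ "(y, w)"])
    have "x = 0" by (rule nd(1)) (use st[of _ 0] in simp)
    moreover have "v = 0"
      by (rule nd(2)) (use st[of 0] \<open>x = 0\<close> dual_smul[OF h, of "-1"] in simp)
    ultimately show "p \<in> {0}" by (simp add: xv zero_prod_def)
  qed
  ultimately show "\<exists>f\<in>dual_space (L_smul smul). stabilizer L_bracket f \<subseteq> {0}" by blast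
next
  assume "\<exists>f\<in>dual_space (L_smul smul). stabilizer L_bracket f \<subseteq> {0}"
  then obtain f where f: "f \<in> dual_space (L_smul smul)" and st: "stabilizer L_bracket f \<subseteq> {0}"
    by blast
  let ?h = "\<lambda>v. f (0, v)"
  have h: "?h \<in> dual_space smul"
    unfolding dual_space_iff[OF vector_space_axioms]
  proof (intro conjI allI)
    show "f (0, u + v) = f (0, u) + f (0, v)" for u v using L_dualD(1)[OF f, of "(0, u)" "(0, v)"] by simp
    show "f (0, smul c v) = c * f (0, v)" for c v using L_dualD(2)[OF f, of c "(0, v)"] by simp
  qed
  show "frobenius_algebra smul"
  proof (rule frobenius_algebraI[OF h])
    fix v assume "\<And>a. f (0, a * v) = 0"
    then have "f (0, - (a * v)) = 0" for a
      using L_dualD(2)[OF f, of "-1" "(0, a * v)"] by simp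
    then have "(0, v) \<in> stabilizer L_bracket f" by (auto simp: stabilizer_def)
    then show "v = 0" using st by (auto simp: zero_prod_def)
  qed
qed

end

section \<open>Modules over enveloping algebras\<close>

lemma free_algebra_simps [simp]:
  "p \<in> carrier free_algebra \<longleftrightarrow> finite {w. p w \<noteq> 0}"
  "\<one>\<^bsub>free_algebra\<^esub> = free_const 1"
  "\<zero>\<^bsub>free_algebra\<^esub> = (\<lambda>w. 0)"
  by (auto simp: free_algebra_def free_const_def)

lemma free_add_apply: "(p \<oplus>\<^bsub>free_algebra\<^esub> q) w = p w + q w"
  by (simp add: free_algebra_def)

lemma free_mult_apply:
  "(p \<otimes>\<^bsub>free_algebra\<^esub> q) w = (\<Sum>i\<le>length w. p (take i w) * q (drop i w))"
  by (simp add: free_algebra_def)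

text \<open>Replaces words with a cut position by pairs of words; this is what turns the product of
  the free algebra into composition of operators.\<close>

lemma sum_splittings:
  fixes g :: "'b list \<Rightarrow> 'b list \<Rightarrow> 'c::comm_monoid_add"
  assumes "finite W"
  shows "(\<Sum>w\<in>W. \<Sum>i\<le>length w. g (take i w) (drop i w)) = (\<Sum>(u, v) | u @ v \<in> W. g u v)"
    and "finite {(u, v). u @ v \<in> W}"
proof -
  have "(\<Sum>w\<in>W. \<Sum>i\<le>length w. g (take i w) (drop i w))
      = (\<Sum>(w, i)\<in>(SIGMA w:W. {..length w}). g (take i w) (drop i w))"
    using assms by (subst sum.Sigma) auto
  also have "\<dots> = (\<Sum>(u, v) | u @ v \<in> W. g u v)"
    by (rule sum.reindex_bij_witness[where i = "\<lambda>(u, v). (u @ v, length u)"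
          and j = "\<lambda>(w, i). (take i w, drop i w)"]) auto
  finally show "(\<Sum>w\<in>W. \<Sum>i\<le>length w. g (take i w) (drop i w)) = (\<Sum>(u, v) | u @ v \<in> W. g u v)" .
  have "{(u, v). u @ v \<in> W} \<subseteq> (\<lambda>(w, i). (take i w, drop i w)) ` (SIGMA w:W. {..length w})"
  proof clarify
    fix u v assume "u @ v \<in> W"
    then show "(u, v) \<in> (\<lambda>(w, i). (take i w, drop i w)) ` (SIGMA w:W. {..length w})"
      by (intro rev_image_eqI[of "(u @ v, length u)"]) auto
  qed
  then show "finite {(u, v). u @ v \<in> W}"
    by (rule finite_subset) (use assms in auto)
qed

interpretation free: ring "free_algebra :: ('l list \<Rightarrow> 'k::field) ring"
  by (rule ring_free_algebra)

lemma free_gen_closed [simp]: "finite {w. free_gen x w \<noteq> (0::'k::field)}"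
  by (rule finite_subset[of _ "{[x]}"]) (auto simp: free_gen_def)

lemma free_const_closed [simp]: "finite {w. free_const c w \<noteq> (0::'k::field)}"
  by (rule finite_subset[of _ "{[]}"]) (auto simp: free_const_def)

lemma free_uminus:
  assumes "p \<in> carrier (free_algebra :: ('l list \<Rightarrow> 'k::field) ring)"
  shows "\<ominus>\<^bsub>free_algebra\<^esub> p = (\<lambda>w. - p w)"
  by (rule free.minus_equality) (use assms in \<open>auto simp: fun_eq_iff free_add_apply\<close>)

lemma free_diff_apply:
  assumes "p \<in> carrier (free_algebra :: ('l list \<Rightarrow> 'k::field) ring)" "q \<in> carrier free_algebra"
  shows "(p \<ominus>\<^bsub>free_algebra\<^esub> q) w = p w - q w"
  using assms by (simp add: a_minus_def free_uminus free_add_apply)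

lemma free_const_mult: "(free_const c \<otimes>\<^bsub>free_algebra\<^esub> p) w = c * p w"
proof -
  have "(\<Sum>i\<le>length w. free_const c (take i w) * p (drop i w)) = (\<Sum>i\<in>{0}. c * p (drop i w))"
    by (rule sum.mono_neutral_cong_right) (auto simp: free_const_def)
  then show ?thesis by (simp add: free_mult_apply)
qed

lemma free_mult_const: "(p \<otimes>\<^bsub>free_algebra\<^esub> free_const c) w = c * p w"
proof -
  have "(\<Sum>i\<le>length w. p (take i w) * free_const c (drop i w)) = (\<Sum>i\<in>{length w}. c * p (take i w))"
    by (rule sum.mono_neutral_cong_right) (auto simp: free_const_def)
  then show ?thesis by (simp add: free_mult_apply)
qed

lemma free_gen_mult:
  "(free_gen x \<otimes>\<^bsub>free_algebra\<^esub> p) w = (case w of [] \<Rightarrow> 0 | y # w' \<Rightarrow> if x = y then p w' else 0)"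
proof (cases w)
  case (Cons y w')
  have "(\<Sum>i\<le>length w. free_gen x (take i w) * p (drop i w))
      = (\<Sum>i\<in>{1}. (if x = y then 1 else 0) * p (drop i w))"
    using Cons
    by (intro sum.mono_neutral_cong_right) (auto simp: free_gen_def take_Suc_conv_app_nth take_Cons' split: if_splits)
  then show ?thesis using Cons by (simp add: free_mult_apply)
qed (simp add: free_gen_def free_mult_apply)

text \<open>Monomials are built letter by letter by multiplying with generators on the left, and
  every element is the finite sum of its monomials.\<close>

lemma free_algebra_generated:
  "generate_ring free_algebra (range free_const \<union> range free_gen) =
    carrier (free_algebra :: ('l list \<Rightarrow> 'k::field) ring)" (is "?G = _")
proof
  show "?G \<subseteq> carrier free_algebra"
    by (rule free.generate_ring_incl) auto
  have word: "(\<lambda>v. if v = w then c else 0) \<in> ?G" for w c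
  proof (induction w)
    case Nil
    have "free_const c \<in> ?G" by (rule generate_ring.incl) auto
    then show ?case by (simp add: free_const_def)
  next
    case (Cons x w)
    have "free_gen x \<otimes>\<^bsub>free_algebra\<^esub> (\<lambda>v. if v = w then c else 0) \<in> ?G"
      by (rule generate_ring.eng_mult[OF generate_ring.incl Cons]) auto
    also have "free_gen x \<otimes>\<^bsub>free_algebra\<^esub> (\<lambda>v. if v = w then c else 0) = (\<lambda>v. if v = x # w then c else 0)"
      by (auto simp: fun_eq_iff free_gen_mult split: list.split)
    finally show ?case .
  qed
  show "carrier free_algebra \<subseteq> ?G"
  proof
    fix p :: "'l list \<Rightarrow> 'k" assume "p \<in> carrier free_algebra"
    then have "finite {w. p w \<noteq> 0}" by simp
    moreover have "(\<lambda>w. if w \<in> S then p w else 0) \<in> ?G" if "finite S" for S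
      using that
    proof (induction S)
      case empty
      then show ?case using word[of "[]" 0] by (simp cong: if_cong)
    next
      case (insert a S)
      have "(\<lambda>w. if w \<in> insert a S then p w else 0)
          = (\<lambda>w. if w \<in> S then p w else 0) \<oplus>\<^bsub>free_algebra\<^esub> (\<lambda>w. if w = a then p a else 0)"
        using insert by (auto simp: fun_eq_iff free_add_apply)
      then show ?case using generate_ring.eng_add[OF insert.IH word[of a "p a"]] by simp
    qed
    ultimately have "(\<lambda>w. if w \<in> {w. p w \<noteq> 0} then p w else 0) \<in> ?G" by blast
    moreover have "(\<lambda>w. if w \<in> {w. p w \<noteq> 0} then p w else 0) = p" by auto
    ultimately show "p \<in> ?G" by simp
  qed
qed

section \<open>Modules of functions over the free algebra\<close>

locale function_module =
  fixes M :: "('x \<Rightarrow> 'k::field) set" and rho :: "'l \<Rightarrow> ('x \<Rightarrow> 'k) \<Rightarrow> ('x \<Rightarrow> 'k)"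
  assumes M_zero: "(\<lambda>_. 0) \<in> M"
    and M_add: "m \<in> M \<Longrightarrow> n \<in> M \<Longrightarrow> (\<lambda>q. m q + n q) \<in> M"
    and M_scale: "m \<in> M \<Longrightarrow> (\<lambda>q. c * m q) \<in> M"
    and rho_closed: "m \<in> M \<Longrightarrow> rho l m \<in> M"
    and rho_add: "m \<in> M \<Longrightarrow> n \<in> M \<Longrightarrow> rho l (\<lambda>q. m q + n q) = (\<lambda>q. rho l m q + rho l n q)"
    and rho_scale: "m \<in> M \<Longrightarrow> rho l (\<lambda>q. c * m q) = (\<lambda>q. c * rho l m q)"
begin

text \<open>Module elements are functions, so a combination of words acts by an ordinary pointwise
  sum. \<open>foldr\<close> applies the last letter first, which makes concatenation of words
  correspond to composition of operators.\<close>

definition free_act :: "('l list \<Rightarrow> 'k) \<Rightarrow> ('x \<Rightarrow> 'k) \<Rightarrow> 'x \<Rightarrow> 'k" where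
  "free_act p m = (\<lambda>q. \<Sum>w | p w \<noteq> 0. p w * foldr rho w m q)"

lemma M_sum: "(\<And>a. a \<in> A \<Longrightarrow> f a \<in> M) \<Longrightarrow> (\<lambda>q. \<Sum>a\<in>A. f a q) \<in> M"
  by (induction A rule: infinite_finite_induct) (auto simp: M_zero M_add)

lemma word_closed: "m \<in> M \<Longrightarrow> foldr rho w m \<in> M"
  by (induction w) (auto simp: rho_closed)

lemma word_add: "m \<in> M \<Longrightarrow> n \<in> M \<Longrightarrow>
    foldr rho w (\<lambda>q. m q + n q) = (\<lambda>q. foldr rho w m q + foldr rho w n q)"
  by (induction w) (auto simp: rho_add word_closed)

lemma word_scale: "m \<in> M \<Longrightarrow> foldr rho w (\<lambda>q. c * m q) = (\<lambda>q. c * foldr rho w m q)"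
  by (induction w) (auto simp: rho_scale word_closed)

lemma word_zero: "foldr rho w (\<lambda>_. 0) = (\<lambda>_. 0)"
  using word_scale[of "\<lambda>_. 0" w 0] by (simp add: M_zero)

lemma word_sum:
  assumes "\<And>a. a \<in> A \<Longrightarrow> f a \<in> M"
  shows "foldr rho w (\<lambda>q. \<Sum>a\<in>A. c a * f a q) = (\<lambda>q. \<Sum>a\<in>A. c a * foldr rho w (f a) q)"
  using assms
proof (induction A rule: infinite_finite_induct)
  case (insert x F)
  then show ?case by (simp add: word_add M_scale M_sum word_scale)
qed (auto simp: word_zero)

lemma free_act_superset:
  assumes "finite S" "{w. p w \<noteq> 0} \<subseteq> S"
  shows "free_act p m q = (\<Sum>w\<in>S. p w * foldr rho w m q)"
  unfolding free_act_def using assms by (intro sum.mono_neutral_left) auto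

lemma free_act_closed: "m \<in> M \<Longrightarrow> free_act p m \<in> M"
  unfolding free_act_def by (intro M_sum M_scale word_closed)

lemma free_act_zero_right: "free_act p (\<lambda>_. 0) = (\<lambda>_. 0)"
  by (simp add: free_act_def word_zero)

lemma free_act_const: "free_act (free_const c) m = (\<lambda>q. c * m q)"
  by (rule ext, subst free_act_superset[of "{[]}"]) (auto simp: free_const_def)

lemma free_act_gen: "free_act (free_gen x) m = rho x m"
  by (rule ext, subst free_act_superset[of "{[x]}"]) (auto simp: free_gen_def)

lemma free_act_add:
  assumes "p \<in> carrier free_algebra" "p' \<in> carrier free_algebra"
  shows "free_act (p \<oplus>\<^bsub>free_algebra\<^esub> p') m = (\<lambda>q. free_act p m q + free_act p' m q)"
proof
  fix q
  let ?S = "{w. p w \<noteq> 0} \<union> {w. p' w \<noteq> 0}"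
  have "finite ?S" "{w. (p \<oplus>\<^bsub>free_algebra\<^esub> p') w \<noteq> 0} \<subseteq> ?S"
    using assms by (auto simp: free_add_apply)
  then show "free_act (p \<oplus>\<^bsub>free_algebra\<^esub> p') m q = free_act p m q + free_act p' m q"
    by (subst (1 2 3) free_act_superset[of ?S]) (auto simp: free_add_apply algebra_simps sum.distrib)
qed

lemma free_act_uminus:
  assumes "p \<in> carrier free_algebra"
  shows "free_act (\<ominus>\<^bsub>free_algebra\<^esub> p) m = (\<lambda>q. - free_act p m q)"
  using assms by (simp add: free_uminus free_act_def sum_negf)

lemma free_act_diff:
  assumes "p \<in> carrier free_algebra" "p' \<in> carrier free_algebra"
  shows "free_act (p \<ominus>\<^bsub>free_algebra\<^esub> p') m = (\<lambda>q. free_act p m q - free_act p' m q)"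
  using assms free.a_inv_closed[OF assms(2)] by (simp add: a_minus_def free_act_add free_act_uminus)

lemma free_act_mult:
  assumes p: "p \<in> carrier free_algebra" and p': "p' \<in> carrier free_algebra" and m: "m \<in> M"
  shows "free_act (p \<otimes>\<^bsub>free_algebra\<^esub> p') m = free_act p (free_act p' m)"
proof
  fix q
  let ?S = "{w. p w \<noteq> 0}" and ?S' = "{w. p' w \<noteq> 0}"
  let ?W = "(\<lambda>(u, v). u @ v) ` (?S \<times> ?S')"
  let ?g = "\<lambda>u v. p u * p' v * foldr rho (u @ v) m q"
  have fin: "finite ?S" "finite ?S'" "finite ?W" using p p' by auto
  have "{w. (p \<otimes>\<^bsub>free_algebra\<^esub> p') w \<noteq> 0} \<subseteq> ?W"
  proof
    fix w assume "w \<in> {w. (p \<otimes>\<^bsub>free_algebra\<^esub> p') w \<noteq> 0}"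
    then obtain i where "p (take i w) * p' (drop i w) \<noteq> 0"
      by (auto simp: free_mult_apply elim: sum.not_neutral_contains_not_neutral)
    then have "(take i w, drop i w) \<in> ?S \<times> ?S'" by auto
    then show "w \<in> ?W" by (rule rev_image_eqI) simp
  qed
  then have "free_act (p \<otimes>\<^bsub>free_algebra\<^esub> p') m q
      = (\<Sum>w\<in>?W. \<Sum>i\<le>length w. ?g (take i w) (drop i w))"
    by (subst free_act_superset[OF fin(3)])
       (simp_all only: free_mult_apply sum_distrib_right append_take_drop_id)
  also have "\<dots> = (\<Sum>(u, v) | u @ v \<in> ?W. ?g u v)"
    by (rule sum_splittings(1)[OF fin(3)])
  \<comment> \<open>A word in \<open>?W\<close> may also split into a pair outside the two supports;
    such a term has a zero coefficient.\<close>
  also have "\<dots> = (\<Sum>(u, v)\<in>?S \<times> ?S'. ?g u v)"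
    by (rule sum.mono_neutral_right) (use sum_splittings(2)[OF fin(3)] in auto)
  also have "\<dots> = (\<Sum>u\<in>?S. p u * (\<Sum>v\<in>?S'. p' v * foldr rho u (foldr rho v m) q))"
    by (simp add: sum.cartesian_product[symmetric] sum_distrib_left mult.assoc)
  also have "\<dots> = free_act p (free_act p' m) q"
    unfolding free_act_def by (simp add: word_sum word_closed m)
  finally show "free_act (p \<otimes>\<^bsub>free_algebra\<^esub> p') m q = free_act p (free_act p' m) q" .
qed

text \<open>Since the annihilator is a two-sided ideal, it contains the enveloping ideal as soon as
  it contains the defining relations.\<close>

lemma ideal_annihilator:
  "ideal {p \<in> carrier free_algebra. \<forall>m\<in>M. free_act p m = (\<lambda>_. 0)} free_algebra" (is "ideal ?A _")
proof (rule idealI)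
  show "subgroup ?A (add_monoid free_algebra)"
  proof (rule free.add.subgroupI)
    show "?A \<noteq> {}"
      by (rule ex_in_conv[THEN iffD1], rule exI[of _ "\<lambda>_. 0"]) (simp add: free_act_def)
    show "\<ominus>\<^bsub>free_algebra\<^esub> a \<in> ?A" if "a \<in> ?A" for a
      using that free.a_inv_closed[of a] by (simp add: free_act_uminus)
    show "a \<oplus>\<^bsub>free_algebra\<^esub> b \<in> ?A" if "a \<in> ?A" "b \<in> ?A" for a b
      using that free.a_closed[of a b] by (simp add: free_act_add)
  qed auto
  show "x \<otimes>\<^bsub>free_algebra\<^esub> a \<in> ?A" "a \<otimes>\<^bsub>free_algebra\<^esub> x \<in> ?A"
    if "a \<in> ?A" "x \<in> carrier free_algebra" for a x
    using that free.m_closed[of a x] free.m_closed[of x a]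
    by (simp_all add: free_act_mult free_act_zero_right free_act_closed)
qed (rule ring_free_algebra)

end

section \<open>The induced action of the enveloping algebra\<close>

lemma ideal_enveloping: "ideal (enveloping_ideal smul br) free_algebra"
  unfolding enveloping_ideal_def by (rule free.genideal_ideal[OF enveloping_relations_carrier])

lemma ring_hom_enveloping:
  "(+>\<^bsub>free_algebra\<^esub>) (enveloping_ideal smul br) \<in> ring_hom free_algebra (enveloping_algebra smul br)"
  unfolding enveloping_algebra_def by (rule ideal.rcos_ring_hom[OF ideal_enveloping])

lemma carrier_enveloping:
  "carrier (enveloping_algebra smul br) = (+>\<^bsub>free_algebra\<^esub>) (enveloping_ideal smul br) ` carrier free_algebra"
  by (auto simp: enveloping_algebra_def FactRing_def A_RCOSETS_def')

locale enveloping_module = function_module M rho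
  for M :: "('x \<Rightarrow> 'k::field) set" and rho :: "'l::ab_group_add \<Rightarrow> ('x \<Rightarrow> 'k) \<Rightarrow> ('x \<Rightarrow> 'k)" +
  fixes smul :: "'k \<Rightarrow> 'l \<Rightarrow> 'l" and br :: "'l \<Rightarrow> 'l \<Rightarrow> 'l"
  assumes rho_plus: "m \<in> M \<Longrightarrow> rho (x + y) m = (\<lambda>q. rho x m q + rho y m q)"
    and rho_smul: "m \<in> M \<Longrightarrow> rho (smul c x) m = (\<lambda>q. c * rho x m q)"
    and rho_br: "m \<in> M \<Longrightarrow> rho (br x y) m = (\<lambda>q. rho x (rho y m) q - rho y (rho x m) q)"
begin

abbreviation U :: "('l list \<Rightarrow> 'k) set ring" where "U \<equiv> enveloping_algebra smul br"
abbreviation I :: "('l list \<Rightarrow> 'k) set" where "I \<equiv> enveloping_ideal smul br"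

lemma enveloping_ideal_acts_trivially:
  assumes "p \<in> I" "m \<in> M"
  shows "free_act p m = (\<lambda>_. 0)"
proof -
  let ?A = "{p \<in> carrier free_algebra. \<forall>m\<in>M. free_act p m = (\<lambda>_. 0)}"
  have "enveloping_relations smul br \<subseteq> ?A"
  proof
    fix r assume r: "r \<in> enveloping_relations smul br"
    then have rc: "r \<in> carrier free_algebra" using enveloping_relations_carrier by blast
    have c: "free_gen x \<in> carrier free_algebra" "free_const a \<in> carrier free_algebra"
      for x :: 'l and a :: 'k by simp_all
    note c' = free.a_closed[OF c(1) c(1)] free.m_closed[OF c(2) c(1)] free.m_closed[OF c(1) c(1)]
      free.minus_closed[OF free.m_closed[OF c(1) c(1)] free.m_closed[OF c(1) c(1)]]
    from r have "free_act r m = (\<lambda>_. 0)" if "m \<in> M" for m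
      using that unfolding enveloping_relations_def
      by (elim UnE CollectE exE conjE)
         (simp_all only: free_act_diff[OF c(1) c'(1)] free_act_diff[OF c(1) c'(2)]
            free_act_diff[OF c'(4) c(1)] free_act_diff[OF c'(3) c'(3)]
            free_act_add[OF c(1) c(1)] free_act_mult[OF c(2) c(1)] free_act_mult[OF c(1) c(1)]
            free_act_gen free_act_const rho_plus rho_smul rho_br diff_self)
    with rc show "r \<in> ?A" by blast
  qed
  then have "I \<subseteq> ?A"
    unfolding enveloping_ideal_def by (rule free.genideal_minimal[OF ideal_annihilator])
  then show ?thesis using assms by blast
qed

text \<open>An arbitrary representative of the coset is used; \<open>act_coset\<close> shows that
  the choice does not matter on \<open>M\<close>, because the ideal acts by zero.\<close>

definition act :: "('l list \<Rightarrow> 'k) set \<Rightarrow> ('x \<Rightarrow> 'k) \<Rightarrow> 'x \<Rightarrow> 'k" where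
  "act u = free_act (SOME p. p \<in> u)"

lemma act_coset:
  assumes p: "p \<in> carrier free_algebra" and m: "m \<in> M"
  shows "act (I +>\<^bsub>free_algebra\<^esub> p) m = free_act p m"
proof -
  interpret I: ideal I free_algebra by (rule ideal_enveloping)
  have "p \<in> I +>\<^bsub>free_algebra\<^esub> p" using p by (rule I.a_rcos_self)
  then have "(SOME p'. p' \<in> I +>\<^bsub>free_algebra\<^esub> p) \<in> I +>\<^bsub>free_algebra\<^esub> p"
    by (rule someI[of "\<lambda>p'. p' \<in> _"])
  then obtain i where i: "i \<in> I" and eq: "(SOME p'. p' \<in> I +>\<^bsub>free_algebra\<^esub> p) = i \<oplus>\<^bsub>free_algebra\<^esub> p"
    unfolding a_r_coset_def' by blast
  have "i \<in> carrier free_algebra" using i by (rule I.a_Hcarr)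
  then show ?thesis
    unfolding act_def eq by (simp add: free_act_add[OF _ p] enveloping_ideal_acts_trivially[OF i m])
qed

lemma act_closed: "m \<in> M \<Longrightarrow> act u m \<in> M"
  by (simp add: act_def free_act_closed)

lemma act_add:
  assumes "u \<in> carrier U" "v \<in> carrier U" "m \<in> M"
  shows "act (u \<oplus>\<^bsub>U\<^esub> v) m = (\<lambda>q. act u m q + act v m q)"
proof -
  obtain p p' where p: "p \<in> carrier free_algebra" "p' \<in> carrier free_algebra"
    and uv: "u = I +>\<^bsub>free_algebra\<^esub> p" "v = I +>\<^bsub>free_algebra\<^esub> p'"
    using assms by (auto simp: carrier_enveloping)
  have "u \<oplus>\<^bsub>U\<^esub> v = I +>\<^bsub>free_algebra\<^esub> (p \<oplus>\<^bsub>free_algebra\<^esub> p')"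
    using ring_hom_add[OF ring_hom_enveloping p] uv by metis
  then show ?thesis
    using p assms(3) uv by (simp only: act_coset free_act_add free.a_closed)
qed

lemma act_mult:
  assumes "u \<in> carrier U" "v \<in> carrier U" "m \<in> M"
  shows "act (u \<otimes>\<^bsub>U\<^esub> v) m = act u (act v m)"
proof -
  obtain p p' where p: "p \<in> carrier free_algebra" "p' \<in> carrier free_algebra"
    and uv: "u = I +>\<^bsub>free_algebra\<^esub> p" "v = I +>\<^bsub>free_algebra\<^esub> p'"
    using assms by (auto simp: carrier_enveloping)
  have "u \<otimes>\<^bsub>U\<^esub> v = I +>\<^bsub>free_algebra\<^esub> (p \<otimes>\<^bsub>free_algebra\<^esub> p')"
    using ring_hom_mult[OF ring_hom_enveloping p] uv by metis
  then show ?thesis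
    using p assms(3) uv by (simp only: act_coset free_act_mult free.m_closed free_act_closed)
qed

lemma act_const: "m \<in> M \<Longrightarrow> act (env_const smul br c) m = (\<lambda>q. c * m q)"
  by (simp add: env_const_def act_coset free_act_const)

lemma act_gen: "m \<in> M \<Longrightarrow> act (env_gen smul br x) m = rho x m"
  by (simp add: env_gen_def act_coset free_act_gen)

end

text \<open>Transfers generating sets from the free algebra to the enveloping algebra, and from
  there to its image in the division ring.\<close>

lemma ring_hom_generate_ring:
  assumes R: "ring R" and S: "ring S" and h: "h \<in> ring_hom R S" and H: "H \<subseteq> carrier R"
  shows "h ` generate_ring R H = generate_ring S (h ` H)"
proof
  interpret ring_hom_ring R S h
    by (rule ring_hom_ringI2[OF R S h])
  have car: "x \<in> carrier R" if "x \<in> generate_ring R H" for x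
    using R.generate_ring_in_carrier[OF H that] .
  show "h ` generate_ring R H \<subseteq> generate_ring S (h ` H)"
  proof clarify
    fix x assume "x \<in> generate_ring R H"
    then show "h x \<in> generate_ring S (h ` H)"
      by induction (use H in \<open>auto simp: car intro: generate_ring.intros\<close>)
  qed
  show "generate_ring S (h ` H) \<subseteq> h ` generate_ring R H"
  proof
    fix y assume "y \<in> generate_ring S (h ` H)"
    then show "y \<in> h ` generate_ring R H"
    proof induction
      case one
      then show ?case by (rule rev_image_eqI[OF generate_ring.one]) simp
    next
      case (incl y)
      then show ?case by (auto intro: generate_ring.incl)
    next
      case (a_inv y)
      then show ?case by (auto simp: car intro!: rev_image_eqI[OF generate_ring.a_inv])
    next
      case (eng_add y z)
      then obtain a b where "a \<in> generate_ring R H" "y = h a" "b \<in> generate_ring R H" "z = h b" by blast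
      then show ?case by (intro rev_image_eqI[OF generate_ring.eng_add[of a R H b]]) (auto simp: car)
    next
      case (eng_mult y z)
      then obtain a b where "a \<in> generate_ring R H" "y = h a" "b \<in> generate_ring R H" "z = h b" by blast
      then show ?case by (intro rev_image_eqI[OF generate_ring.eng_mult[of a R H b]]) (auto simp: car)
    qed
  qed
qed

section \<open>Generators and relations of the enveloping algebra\<close>

context
  fixes smul :: "'k::field \<Rightarrow> 'l::ab_group_add \<Rightarrow> 'l" and br :: "'l \<Rightarrow> 'l \<Rightarrow> 'l"
begin

private abbreviation (input) "U \<equiv> enveloping_algebra smul br"

lemma env_const_closed: "env_const smul br c \<in> carrier U"
  and env_gen_closed: "env_gen smul br x \<in> carrier U"
  by (auto simp: env_const_def env_gen_def carrier_enveloping)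

lemma enveloping_generated:
  "generate_ring U (range (env_const smul br) \<union> range (env_gen smul br)) = carrier U"
proof -
  have "generate_ring U ((+>\<^bsub>free_algebra\<^esub>) (enveloping_ideal smul br) ` (range free_const \<union> range free_gen))
      = carrier U"
    unfolding carrier_enveloping free_algebra_generated[symmetric]
    by (rule ring_hom_generate_ring[symmetric, OF ring_free_algebra ring_enveloping_algebra ring_hom_enveloping])
       auto
  then show ?thesis
    by (simp add: image_Un image_image env_const_def[symmetric] env_gen_def[symmetric])
qed

lemma free_const_ring_hom:
  "free_const (c + d) = free_const c \<oplus>\<^bsub>free_algebra\<^esub> (free_const d :: 'l list \<Rightarrow> 'k)"
  "free_const (c * d) = free_const c \<otimes>\<^bsub>free_algebra\<^esub> (free_const d :: 'l list \<Rightarrow> 'k)"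
  by (simp_all add: fun_eq_iff free_add_apply free_const_mult) (simp_all add: free_const_def)

lemma env_const_add: "env_const smul br (c + d) = env_const smul br c \<oplus>\<^bsub>U\<^esub> env_const smul br d"
  unfolding env_const_def free_const_ring_hom
  by (rule ring_hom_add[OF ring_hom_enveloping]) auto

lemma env_const_mult: "env_const smul br (c * d) = env_const smul br c \<otimes>\<^bsub>U\<^esub> env_const smul br d"
  unfolding env_const_def free_const_ring_hom
  by (rule ring_hom_mult[OF ring_hom_enveloping]) auto

lemma env_const_one: "env_const smul br 1 = \<one>\<^bsub>U\<^esub>"
  using ring_hom_one[OF ring_hom_enveloping, of smul br] by (simp add: env_const_def)

lemma env_const_central:
  assumes "u \<in> carrier U"
  shows "env_const smul br c \<otimes>\<^bsub>U\<^esub> u = u \<otimes>\<^bsub>U\<^esub> env_const smul br c"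
proof -
  obtain p where p: "p \<in> carrier free_algebra" and u: "u = enveloping_ideal smul br +>\<^bsub>free_algebra\<^esub> p"
    using assms by (auto simp: carrier_enveloping)
  have c: "free_const c \<in> carrier (free_algebra :: ('l list \<Rightarrow> 'k) ring)" by simp
  have "free_const c \<otimes>\<^bsub>free_algebra\<^esub> p = p \<otimes>\<^bsub>free_algebra\<^esub> free_const c"
    by (rule ext) (simp add: free_const_mult free_mult_const)
  then show ?thesis
    using ring_hom_mult[OF ring_hom_enveloping p c] ring_hom_mult[OF ring_hom_enveloping c p]
    unfolding u env_const_def by metis
qed

lemma enveloping_relation_eq:
  assumes "p \<ominus>\<^bsub>free_algebra\<^esub> q \<in> enveloping_relations smul br"
    and p: "p \<in> carrier free_algebra" and q: "q \<in> carrier free_algebra"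
  shows "enveloping_ideal smul br +>\<^bsub>free_algebra\<^esub> p = enveloping_ideal smul br +>\<^bsub>free_algebra\<^esub> q"
proof -
  have "p \<ominus>\<^bsub>free_algebra\<^esub> q \<in> enveloping_ideal smul br"
    unfolding enveloping_ideal_def
    using free.genideal_self[OF enveloping_relations_carrier] assms(1) by blast
  then show ?thesis
    using free.quotient_eq_iff_same_a_r_cos[OF ideal_enveloping p q] by blast
qed

lemma env_gen_add: "env_gen smul br (x + y) = env_gen smul br x \<oplus>\<^bsub>U\<^esub> env_gen smul br y"
proof -
  have g: "free_gen z \<in> carrier (free_algebra :: ('l list \<Rightarrow> 'k) ring)" for z by simp
  show ?thesis
    unfolding env_gen_def ring_hom_add[OF ring_hom_enveloping g g, symmetric]
    by (rule enveloping_relation_eq[OF _ g free.a_closed[OF g g]])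
       (auto simp: enveloping_relations_def)
qed

lemma env_gen_smul: "env_gen smul br (smul c x) = env_const smul br c \<otimes>\<^bsub>U\<^esub> env_gen smul br x"
proof -
  have g: "free_gen z \<in> carrier (free_algebra :: ('l list \<Rightarrow> 'k) ring)"
    "free_const c \<in> carrier (free_algebra :: ('l list \<Rightarrow> 'k) ring)" for z by simp_all
  show ?thesis
    unfolding env_gen_def env_const_def ring_hom_mult[OF ring_hom_enveloping g(2) g(1), symmetric]
    by (rule enveloping_relation_eq[OF _ g(1) free.m_closed[OF g(2) g(1)]])
       (auto simp: enveloping_relations_def)
qed

lemma env_gen_commute:
  "env_gen smul br x \<otimes>\<^bsub>U\<^esub> env_gen smul br y =
    env_gen smul br y \<otimes>\<^bsub>U\<^esub> env_gen smul br x \<oplus>\<^bsub>U\<^esub> env_gen smul br (br x y)"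
proof -
  let ?F = "free_algebra :: ('l list \<Rightarrow> 'k) ring"
  have g: "free_gen z \<in> carrier ?F" for z by simp
  note m = free.m_closed[OF g g]
  \<comment> \<open>The relation is given with two successive subtractions; regrouped as one
    difference it fits \<open>enveloping_relation_eq\<close>.\<close>
  have eq: "free_gen x \<otimes>\<^bsub>?F\<^esub> free_gen y \<ominus>\<^bsub>?F\<^esub> (free_gen y \<otimes>\<^bsub>?F\<^esub> free_gen x \<oplus>\<^bsub>?F\<^esub> free_gen (br x y))
      = free_gen x \<otimes>\<^bsub>?F\<^esub> free_gen y \<ominus>\<^bsub>?F\<^esub> free_gen y \<otimes>\<^bsub>?F\<^esub> free_gen x \<ominus>\<^bsub>?F\<^esub> free_gen (br x y)"
    by (rule ext) (simp add: free_diff_apply[OF m free.a_closed[OF m g]] free_add_apply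
        free_diff_apply[OF free.minus_closed[OF m m] g] free_diff_apply[OF m m])
  have "\<dots> \<in> enveloping_relations smul br"
    by (auto simp: enveloping_relations_def)
  then have "enveloping_ideal smul br +>\<^bsub>?F\<^esub> (free_gen x \<otimes>\<^bsub>?F\<^esub> free_gen y)
      = enveloping_ideal smul br +>\<^bsub>?F\<^esub> (free_gen y \<otimes>\<^bsub>?F\<^esub> free_gen x \<oplus>\<^bsub>?F\<^esub> free_gen (br x y))"
    by (intro enveloping_relation_eq[OF _ m free.a_closed[OF m g]]) (simp only: eq)
  then show ?thesis
    unfolding env_gen_def
    by (simp only: ring_hom_mult[OF ring_hom_enveloping g g] ring_hom_add[OF ring_hom_enveloping m g])
qed

end

section \<open>The polynomial representation of the semi-direct product\<close>

context fd_algebra_basis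
begin

text \<open>Coordinates \<open>(False, b)\<close> belong to the module \<open>V\<close>, coordinates \<open>(True, b)\<close> to a second copy of
  the regular module, on which the elements of \<open>V\<close> do not operate.\<close>

definition lin :: "bool \<Rightarrow> 'a \<Rightarrow> (bool \<times> 'a \<Rightarrow> 'k) \<Rightarrow> 'k" where
  "lin s v q = (\<Sum>b\<in>B. crd v b * q (s, b))"

lemma lin_add: "lin s (u + v) q = lin s u q + lin s v q"
  by (simp add: lin_def crd_add distrib_right sum.distrib)

lemma lin_diff: "lin s (u - v) q = lin s u q - lin s v q"
  by (simp add: lin_def crd_diff left_diff_distrib sum_subtractf)

lemma lin_smul: "lin s (smul c v) q = c * lin s v q"
  by (simp add: lin_def crd_smul sum_distrib_left mult.assoc)

lemma lin_zero [simp]: "lin s 0 q = 0"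
  by (simp add: lin_def)

lemma lin_basis: "b \<in> B \<Longrightarrow> lin s b q = q (s, b)"
  by (simp add: lin_def sum_crd_basis)

lemma lin_sum: "lin s (\<Sum>a\<in>A. f a) q = (\<Sum>a\<in>A. lin s (f a) q)"
  by (induction A rule: infinite_finite_induct) (auto simp: lin_add)

lemma lin_polyfun: "lin s v \<in> polyfun ({s} \<times> B)"
proof -
  have "(\<lambda>q. \<Sum>b\<in>B. crd v b * q (s, b)) \<in> polyfun ({s} \<times> B)"
    by (intro polyfun_sum polyfun_mult polyfun_const polyfun_var) auto
  then show ?thesis by (simp add: lin_def[abs_def])
qed

lemma lin_polyfun_UNIV: "lin s v \<in> polyfun (UNIV \<times> B)"
  using lin_polyfun polyfun_mono[of "{s} \<times> B" "UNIV \<times> B"] by blast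

lemma lin_mult: "lin s (x * v) q = (\<Sum>b\<in>B. crd v b * lin s (x * b) q)"
  by (subst sum_crd[of v, symmetric]) (simp add: sum_distrib_left lin_sum smul_mult_right[symmetric] lin_smul)

end

locale fd_algebra_char_0 = fd_algebra_basis smul B
  for smul :: "'k::field_char_0 \<Rightarrow> 'a::ring \<Rightarrow> 'a" and B
begin

text \<open>On polynomial functions this is the derivation that extends left multiplication by
  \<open>x\<close> on linear forms, in both copies of the regular module at once.\<close>

definition deriv :: "'a \<Rightarrow> ((bool \<times> 'a \<Rightarrow> 'k) \<Rightarrow> 'k) \<Rightarrow> (bool \<times> 'a \<Rightarrow> 'k) \<Rightarrow> 'k" where
  "deriv x P q = dirderiv P q (\<lambda>i. lin (fst i) (x * snd i) q)"

abbreviation M :: "((bool \<times> 'a \<Rightarrow> 'k) \<Rightarrow> 'k) set" where "M \<equiv> polyfun (UNIV \<times> B)"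

lemma deriv_const [simp]: "deriv x (\<lambda>_. c) q = 0"
  by (simp add: deriv_def)

lemma deriv_closed: "P \<in> M \<Longrightarrow> deriv x P \<in> M"
  using polyfun_dirderiv[of P "UNIV \<times> B" "\<lambda>q i. lin (fst i) (x * snd i) q"]
  by (simp add: deriv_def[abs_def] lin_polyfun_UNIV)

lemma deriv_plus: "P \<in> M \<Longrightarrow> Q \<in> M \<Longrightarrow> deriv x (\<lambda>q. P q + Q q) q = deriv x P q + deriv x Q q"
  by (simp add: deriv_def dirderiv_add)

lemma deriv_mult: "P \<in> M \<Longrightarrow> Q \<in> M \<Longrightarrow> deriv x (\<lambda>q. P q * Q q) q = deriv x P q * Q q + P q * deriv x Q q"
  by (simp add: deriv_def dirderiv_mult)

lemma deriv_scale: "P \<in> M \<Longrightarrow> deriv x (\<lambda>q. c * P q) q = c * deriv x P q"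
  using deriv_mult[of "\<lambda>_. c" P x q] by (simp add: polyfun_const)

lemma deriv_lin: "deriv x (lin s v) q = lin s (x * v) q"
proof -
  have "deriv x (lin s v) q = deriv x (\<lambda>q. \<Sum>b\<in>B. crd v b * q (s, b)) q"
    by (simp add: lin_def[abs_def])
  also have "\<dots> = (\<Sum>b\<in>B. deriv x (\<lambda>q. crd v b * q (s, b)) q)"
    unfolding deriv_def by (rule dirderiv_sum[where I = "UNIV \<times> B"]) (auto intro!: polyfun.intros)
  also have "\<dots> = (\<Sum>b\<in>B. crd v b * deriv x (\<lambda>q. q (s, b)) q)"
    by (intro sum.cong refl deriv_scale polyfun_var) auto
  also have "\<dots> = lin s (x * v) q"
    by (simp add: deriv_def lin_mult[of s x v])
  finally show ?thesis .
qed

lemma deriv_add_left: "P \<in> M \<Longrightarrow> deriv (x + y) P q = deriv x P q + deriv y P q"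
  by (simp add: deriv_def distrib_right lin_add dirderiv_add_direction)

lemma deriv_smul_left: "P \<in> M \<Longrightarrow> deriv (smul c x) P q = c * deriv x P q"
  by (simp add: deriv_def smul_mult_left[symmetric] lin_smul dirderiv_scale_direction)

lemma deriv_zero_left: "P \<in> M \<Longrightarrow> deriv 0 P q = 0"
  using deriv_smul_left[of P 0 0] by simp

text \<open>Both sides are derivations, so agreement on the coordinates suffices; there it comes
  down to the associativity of \<open>A\<close>. For products the mixed terms cancel.\<close>

lemma deriv_commutator:
  "P \<in> M \<Longrightarrow> deriv (x * y - y * x) P q = deriv x (deriv y P) q - deriv y (deriv x P) q"
proof (induction arbitrary: q rule: polyfun.induct)
  case (polyfun_const c)
  then show ?case by (simp add: deriv_const[abs_def])
next
  case (polyfun_var i)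
  have "deriv z (\<lambda>q. q i) = lin (fst i) (z * snd i)" for z
    by (rule ext) (simp add: deriv_def)
  then show ?case by (simp add: deriv_lin algebra_simps lin_diff)
next
  case (polyfun_add P Q)
  have "deriv z (\<lambda>q. P q + Q q) = (\<lambda>q. deriv z P q + deriv z Q q)" for z
    by (rule ext) (simp add: deriv_plus polyfun_add.hyps)
  then show ?case by (simp add: deriv_plus deriv_closed polyfun_add)
next
  case (polyfun_mult P Q)
  have "deriv z (\<lambda>q. P q * Q q) = (\<lambda>q. deriv z P q * Q q + P q * deriv z Q q)" for z
    by (rule ext) (simp add: deriv_mult polyfun_mult.hyps)
  then show ?case
    by (simp add: deriv_plus deriv_mult deriv_closed polyfun_mult polyfun.intros algebra_simps)
qed

text \<open>Multiplication uses the \<open>False\<close> coordinates only. The \<open>True\<close>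
  coordinates are moved by the derivations alone, and this later separates the \<open>X x\<close>
  from \<open>S\<close>.\<close>

definition rho :: "'a \<times> 'a \<Rightarrow> ((bool \<times> 'a \<Rightarrow> 'k) \<Rightarrow> 'k) \<Rightarrow> (bool \<times> 'a \<Rightarrow> 'k) \<Rightarrow> 'k" where
  "rho p P = (\<lambda>q. deriv (fst p) P q + lin False (snd p) q * P q)"

context
  fixes P assumes P: "P \<in> M"
begin

lemma rho_closed: "rho l P \<in> M"
  using P by (simp add: rho_def polyfun.intros deriv_closed lin_polyfun_UNIV)

lemma rho_scale: "rho l (\<lambda>q. c * P q) = (\<lambda>q. c * rho l P q)"
  using P by (simp add: rho_def deriv_scale algebra_simps)

lemma rho_add: "Q \<in> M \<Longrightarrow> rho l (\<lambda>q. P q + Q q) = (\<lambda>q. rho l P q + rho l Q q)"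
  using P by (simp add: rho_def deriv_plus algebra_simps)

lemma rho_smul_left: "rho (L_smul smul c p) P = (\<lambda>q. c * rho p P q)"
  using P by (cases p) (simp add: rho_def deriv_smul_left lin_smul algebra_simps)

lemma rho_add_left: "rho (p + p') P = (\<lambda>q. rho p P q + rho p' P q)"
  using P by (cases p; cases p') (simp add: rho_def deriv_add_left lin_add algebra_simps)

lemma rho_rho:
  "rho a (rho b P) q = deriv (fst a) (deriv (fst b) P) q + lin False (fst a * snd b) q * P q
    + lin False (snd b) q * deriv (fst a) P q + lin False (snd a) q * rho b P q"
proof -
  have "deriv (fst a) (\<lambda>q. deriv (fst b) P q + lin False (snd b) q * P q) q
      = deriv (fst a) (deriv (fst b) P) q + deriv (fst a) (\<lambda>q. lin False (snd b) q * P q) q"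
    by (intro deriv_plus deriv_closed P polyfun_mult lin_polyfun_UNIV)
  also have "deriv (fst a) (\<lambda>q. lin False (snd b) q * P q) q
      = lin False (fst a * snd b) q * P q + lin False (snd b) q * deriv (fst a) P q"
    using deriv_mult[OF lin_polyfun_UNIV P] by (simp add: deriv_lin)
  finally show ?thesis by (simp add: rho_def algebra_simps)
qed

text \<open>The derivations contribute the commutator of \<open>A\<close>, multiplications commute,
  and the Leibniz rule turns a mixed commutator into multiplication by the linear form of
  \<open>x * v\<close>.\<close>

lemma rho_bracket: "rho (L_bracket p p') P = (\<lambda>q. rho p (rho p' P) q - rho p' (rho p P) q)"
  unfolding rho_rho using P
  by (cases p; cases p') (simp add: rho_def deriv_commutator lin_diff algebra_simps)

end

sublocale R: enveloping_module M rho "L_smul smul" L_bracket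
  by unfold_locales
    (fact polyfun_const polyfun_add polyfun_mult[OF polyfun_const] rho_closed rho_add rho_scale
      rho_add_left rho_smul_left rho_bracket)+

end

section \<open>The symmetric algebra of \<open>V\<close> in the quotient division ring\<close>

locale enveloping_quotient = fd_algebra_char_0 smul B
  for smul :: "'k::field_char_0 \<Rightarrow> 'a::ring \<Rightarrow> 'a" and B +
  fixes D :: "'d ring" (structure) and j :: "(('a \<times> 'a) list \<Rightarrow> 'k) set \<Rightarrow> 'd"
  assumes quotient: "quotient_division_ring (enveloping_algebra (L_smul smul) L_bracket) D j"
begin

abbreviation U :: "(('a \<times> 'a) list \<Rightarrow> 'k) set ring" where
  "U \<equiv> enveloping_algebra (L_smul smul) L_bracket"

sublocale D: ring D
  using quotient by (simp add: quotient_division_ring_def division_ring_def)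

sublocale J: ring_hom_ring U D j
  using quotient ring_enveloping_algebra D.ring_axioms
  by (intro ring_hom_ringI2) (auto simp: quotient_division_ring_def)

lemma j_inj: "inj_on j (carrier U)"
  using quotient by (simp add: quotient_division_ring_def)

lemma Units_D: "Units D = carrier D - {\<zero>}"
  using quotient by (simp add: quotient_division_ring_def division_ring_def)

lemma one_neq_zero: "\<one> \<noteq> \<zero>"
proof -
  have "\<one> \<in> Units D" by simp
  then show ?thesis unfolding Units_D by simp
qed

lemma inv_nz [simp]:
  assumes "a \<in> carrier D" "a \<noteq> \<zero>"
  shows "inv a \<in> carrier D" "inv a \<noteq> \<zero>" "inv a \<otimes> a = \<one>" "a \<otimes> inv a = \<one>"
proof -
  have a: "a \<in> Units D" using assms by (simp add: Units_D)
  then show "inv a \<in> carrier D" "inv a \<otimes> a = \<one>" "a \<otimes> inv a = \<one>" by auto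
  show "inv a \<noteq> \<zero>" using D.Units_inv_Units[OF a] by (simp add: Units_D)
qed

lemma no_zero_divisors:
  assumes "a \<in> carrier D" "b \<in> carrier D" "a \<otimes> b = \<zero>" "a \<noteq> \<zero>"
  shows "b = \<zero>"
  using assms by (metis D.l_one D.m_assoc D.r_null inv_nz(1,3))

definition cst :: "'k \<Rightarrow> 'd" where "cst c = j (env_const (L_smul smul) L_bracket c)"
definition X :: "'a \<Rightarrow> 'd" where "X x = j (env_gen (L_smul smul) L_bracket (x, 0))"
definition Y :: "'a \<Rightarrow> 'd" where "Y v = j (env_gen (L_smul smul) L_bracket (0, v))"
text \<open>\<open>UD\<close> is U(L), \<open>S\<close> is S(V) and \<open>K\<close> is R(V), all
  inside \<open>D\<close>.\<close>

definition UD :: "'d set" where "UD = j ` carrier U"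
definition S :: "'d set" where "S = generate_ring D (range cst \<union> range Y)"
definition K :: "'d set" where "K = {p \<otimes> inv q | p q. p \<in> S \<and> q \<in> S \<and> q \<noteq> \<zero>}"

lemma UD_subring: "subring UD D"
  unfolding UD_def by (rule J.img_is_subring[OF J.R.carrier_is_subring])

lemma cst_UD: "cst c \<in> UD" and X_UD: "X x \<in> UD" and Y_UD: "Y v \<in> UD"
  by (simp_all add: cst_def X_def Y_def UD_def env_const_closed env_gen_closed)

lemma UD_closed [simp]: "z \<in> UD \<Longrightarrow> z \<in> carrier D"
  using subringE(1)[OF UD_subring] by blast

lemma cst_closed [simp]: "cst c \<in> carrier D" and X_closed [simp]: "X x \<in> carrier D"
  and Y_closed [simp]: "Y v \<in> carrier D"
  using cst_UD X_UD Y_UD by auto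

lemma cst_add: "cst (c + d) = cst c \<oplus> cst d"
  by (simp add: cst_def env_const_add env_const_closed)

lemma cst_mult: "cst (c * d) = cst c \<otimes> cst d"
  by (simp add: cst_def env_const_mult env_const_closed)

lemma cst_one: "cst 1 = \<one>"
  by (simp add: cst_def env_const_one)

lemma cst_zero: "cst 0 = \<zero>"
  using cst_add[of 0 0] by (metis D.add.l_cancel_one cst_closed add_0)

lemma cst_minus_one: "cst (- 1) = \<ominus> \<one>"
  using cst_add[of "-1" 1] by (simp add: cst_zero cst_one D.minus_equality)

lemma uminus_eq: "z \<in> carrier D \<Longrightarrow> \<ominus> z = cst (- 1) \<otimes> z"
  by (simp add: cst_minus_one D.l_minus)

lemma cst_comm_UD: "z \<in> UD \<Longrightarrow> cst c \<otimes> z = z \<otimes> cst c"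
  using env_const_central[of _ "L_smul smul" L_bracket c]
  by (auto simp: UD_def cst_def env_const_closed simp flip: J.hom_mult)

lemma env_gen_pair: "j (env_gen (L_smul smul) L_bracket (x, v)) = X x \<oplus> Y v"
  using env_gen_add[of "L_smul smul" L_bracket "(x, 0)" "(0, v)"]
  by (simp add: X_def Y_def env_gen_closed)

lemma X_add: "X (x + y) = X x \<oplus> X y" and Y_add: "Y (v + w) = Y v \<oplus> Y w"
  using env_gen_add[of "L_smul smul" L_bracket "(x, 0)" "(y, 0)"]
    env_gen_add[of "L_smul smul" L_bracket "(0, v)" "(0, w)"]
  by (simp_all add: X_def Y_def env_gen_closed)

lemma X_smul: "X (smul c x) = cst c \<otimes> X x" and Y_smul: "Y (smul c v) = cst c \<otimes> Y v"
  using env_gen_smul[of "L_smul smul" L_bracket c "(x, 0)"]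
    env_gen_smul[of "L_smul smul" L_bracket c "(0, v)"]
  by (simp_all add: X_def Y_def cst_def env_gen_closed env_const_closed)

lemma X_zero: "X 0 = \<zero>" and Y_zero: "Y 0 = \<zero>"
  using X_smul[of 0 0] Y_smul[of 0 0] by (simp_all add: cst_zero)

lemma X_X: "X x \<otimes> X y = X y \<otimes> X x \<oplus> X (x * y - y * x)"
  using arg_cong[OF env_gen_commute[of "L_smul smul" L_bracket "(x, 0)" "(y, 0)"], of j]
  by (simp add: X_def env_gen_closed)

lemma X_Y: "X x \<otimes> Y v = Y v \<otimes> X x \<oplus> Y (x * v)"
  using arg_cong[OF env_gen_commute[of "L_smul smul" L_bracket "(x, 0)" "(0, v)"], of j]
  by (simp add: X_def Y_def env_gen_closed)

lemma Y_Y: "Y v \<otimes> Y w = Y w \<otimes> Y v"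
  using arg_cong[OF env_gen_commute[of "L_smul smul" L_bracket "(0, v)" "(0, w)"], of j]
    Y_zero by (simp add: Y_def env_gen_closed)

lemma UD_generated: "UD = generate_ring D (range cst \<union> range X \<union> range Y)"
proof
  have "UD = generate_ring D (j ` (range (env_const (L_smul smul) L_bracket) \<union> range (env_gen (L_smul smul) L_bracket)))"
    unfolding UD_def enveloping_generated[symmetric]
    by (rule ring_hom_generate_ring[OF J.R.ring_axioms D.ring_axioms J.homh])
       (auto simp: env_const_closed env_gen_closed)
  also have "\<dots> \<subseteq> generate_ring D (range cst \<union> range X \<union> range Y)"
  proof (rule D.generate_ring_min_subring1)
    show "subring (generate_ring D (range cst \<union> range X \<union> range Y)) D"
      by (rule D.generate_ring_is_subring) auto
    show "j ` (range (env_const (L_smul smul) L_bracket) \<union> range (env_gen (L_smul smul) L_bracket))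
        \<subseteq> generate_ring D (range cst \<union> range X \<union> range Y)"
    proof clarify
      fix u assume "u \<in> range (env_const (L_smul smul) L_bracket) \<union> range (env_gen (L_smul smul) L_bracket)"
      moreover have "z \<in> generate_ring D (range cst \<union> range X \<union> range Y)" if "z \<in> range cst \<union> range X \<union> range Y" for z
        using that by (rule generate_ring.incl)
      ultimately show "j u \<in> generate_ring D (range cst \<union> range X \<union> range Y)"
        by (auto simp: env_gen_pair cst_def[symmetric] intro!: generate_ring.eng_add)
    qed
  qed (auto simp: env_const_closed env_gen_closed)
  finally show "UD \<subseteq> generate_ring D (range cst \<union> range X \<union> range Y)" .
  show "generate_ring D (range cst \<union> range X \<union> range Y) \<subseteq> UD"
    by (rule D.generate_ring_min_subring1[OF _ UD_subring]) (auto simp: cst_UD X_UD Y_UD)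
qed

lemma S_eq: "S = j ` env_subalgebra (L_smul smul) L_bracket V_ideal"
proof -
  have "env_gen (L_smul smul) L_bracket ` V_ideal = range (\<lambda>v. env_gen (L_smul smul) L_bracket (0, v))"
    by (auto simp: V_ideal_def)
  then have "range cst \<union> range Y =
      j ` (range (env_const (L_smul smul) L_bracket) \<union> env_gen (L_smul smul) L_bracket ` V_ideal)"
    by (auto simp: cst_def Y_def image_image)
  then show ?thesis
    unfolding S_def env_subalgebra_def
    by (simp only:) (rule ring_hom_generate_ring[symmetric, OF J.R.ring_axioms D.ring_axioms J.homh],
      auto simp: env_const_closed env_gen_closed)
qed

lemma S_subring: "subring S D"
  unfolding S_def by (rule D.generate_ring_is_subring) auto

lemmas S_closed [simp] = subringE(1)[OF S_subring, THEN subsetD]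
  and S_zero [simp] = subringE(2)[OF S_subring]
  and S_one [simp] = subringE(3)[OF S_subring]
  and S_uminus [simp] = subringE(5)[OF S_subring]
  and S_mult [simp] = subringE(6)[OF S_subring]
  and S_add [simp] = subringE(7)[OF S_subring]

lemma cst_S [simp]: "cst c \<in> S" and Y_S [simp]: "Y v \<in> S"
  by (auto simp: S_def intro: generate_ring.incl)

lemma S_UD: "z \<in> S \<Longrightarrow> z \<in> UD"
proof -
  have "S \<subseteq> UD"
    unfolding S_def by (rule D.generate_ring_min_subring1[OF _ UD_subring]) (auto simp: cst_UD Y_UD)
  then show "z \<in> S \<Longrightarrow> z \<in> UD" by blast
qed

text \<open>\<open>fractions\<close> excludes denominators that vanish in \<open>U\<close>,
  \<open>K\<close> those that vanish in \<open>D\<close>; injectivity of \<open>j\<close> identifies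
  the two conditions.\<close>

lemma K_eq: "K = R_V smul D j"
proof -
  let ?S = "env_subalgebra (L_smul smul) L_bracket V_ideal"
  have "?S \<subseteq> carrier U"
    unfolding env_subalgebra_def
    by (rule J.R.generate_ring_incl) (auto simp: env_const_closed env_gen_closed)
  then have "j q = \<zero> \<longleftrightarrow> q = \<zero>\<^bsub>U\<^esub>" if "q \<in> ?S" for q
    using that inj_onD[OF j_inj, of q "\<zero>\<^bsub>U\<^esub>"] by (auto simp: subset_iff)
  then show ?thesis unfolding K_def R_V_def fractions_def S_eq by blast
qed

lemma left_fraction:
  assumes "z \<in> carrier D"
  obtains a s where "a \<in> UD" "s \<in> UD" "s \<noteq> \<zero>" "s \<otimes> z = a"
proof -
  obtain u t where u: "u \<in> carrier U" and t: "t \<in> carrier U" "t \<noteq> \<zero>\<^bsub>U\<^esub>" and z: "z = inv (j t) \<otimes> j u"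
    using assms quotient unfolding quotient_division_ring_def by blast
  have "j t \<noteq> \<zero>" using inj_onD[OF j_inj, of t "\<zero>\<^bsub>U\<^esub>"] t by auto
  then have "j t \<otimes> z = j u" using u t by (simp add: z D.m_assoc[symmetric])
  then show thesis using that[of "j u" "j t"] u t \<open>j t \<noteq> \<zero>\<close> by (auto simp: UD_def)
qed

text \<open>The action of U(L) transported along \<open>j\<close>; it is meaningful on
  \<open>UD\<close> only.\<close>

definition act :: "'d \<Rightarrow> ((bool \<times> 'a \<Rightarrow> 'k) \<Rightarrow> 'k) \<Rightarrow> (bool \<times> 'a \<Rightarrow> 'k) \<Rightarrow> 'k" where
  "act z = R.act (inv_into (carrier U) j z)"

lemma act_j: "u \<in> carrier U \<Longrightarrow> act (j u) = R.act u"
  by (simp add: act_def j_inj)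

lemma act_closed: "P \<in> M \<Longrightarrow> act z P \<in> M"
  by (simp add: act_def R.act_closed)

lemma act_add:
  assumes "a \<in> UD" "b \<in> UD" "P \<in> M"
  shows "act (a \<oplus> b) P = (\<lambda>q. act a P q + act b P q)"
proof -
  obtain u v where "u \<in> carrier U" "v \<in> carrier U" "a = j u" "b = j v"
    using assms by (auto simp: UD_def)
  then show ?thesis
    using R.act_add[of u v P] assms(3) act_j[of "u \<oplus>\<^bsub>U\<^esub> v"] by (simp add: act_j)
qed

lemma act_mult:
  assumes "a \<in> UD" "b \<in> UD" "P \<in> M"
  shows "act (a \<otimes> b) P = act a (act b P)"
proof -
  obtain u v where "u \<in> carrier U" "v \<in> carrier U" "a = j u" "b = j v"
    using assms by (auto simp: UD_def)
  then show ?thesis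
    using R.act_mult[of u v P] assms(3) act_j[of "u \<otimes>\<^bsub>U\<^esub> v"] by (simp add: act_j)
qed

lemma act_cst: "P \<in> M \<Longrightarrow> act (cst c) P = (\<lambda>q. c * P q)"
  by (simp add: cst_def act_j env_const_closed R.act_const)

lemma act_X: "P \<in> M \<Longrightarrow> act (X x) P = deriv x P"
  by (simp add: X_def act_j env_gen_closed R.act_gen rho_def)

lemma act_Y: "P \<in> M \<Longrightarrow> act (Y v) P = (\<lambda>q. lin False v q * P q)"
  by (simp add: Y_def act_j env_gen_closed R.act_gen rho_def deriv_zero_left)

end

section \<open>Centralizers and bicommutants\<close>

context ring
begin

definition centralizer :: "'a set \<Rightarrow> 'a set" where
  "centralizer T = {z \<in> carrier R. \<forall>t\<in>T. z \<otimes> t = t \<otimes> z}"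

lemma centralizerD: "z \<in> centralizer T \<Longrightarrow> t \<in> T \<Longrightarrow> z \<otimes> t = t \<otimes> z"
  by (simp add: centralizer_def)

lemma centralizer_subring:
  assumes "T \<subseteq> carrier R"
  shows "subring (centralizer T) R"
proof (rule subringI)
  fix a b assume ab: "a \<in> centralizer T" "b \<in> centralizer T"
  have T: "t \<in> carrier R" if "t \<in> T" for t using assms that by blast
  from ab have ac: "a \<in> carrier R" and bc: "b \<in> carrier R" by (auto simp: centralizer_def)
  show "\<ominus> a \<in> centralizer T"
    using ab T by (auto simp: centralizer_def l_minus r_minus)
  show "a \<oplus> b \<in> centralizer T"
    using ab T by (auto simp: centralizer_def l_distr r_distr)
  have "(a \<otimes> b) \<otimes> t = t \<otimes> (a \<otimes> b)" if "t \<in> T" for t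
  proof -
    have "(a \<otimes> b) \<otimes> t = a \<otimes> (t \<otimes> b)"
      using ac bc T[OF that] centralizerD[OF ab(2) that] by (simp add: m_assoc)
    also have "\<dots> = (t \<otimes> a) \<otimes> b"
      using ac bc T[OF that] centralizerD[OF ab(1) that] by (simp add: m_assoc[symmetric])
    finally show ?thesis using ac bc T[OF that] by (simp add: m_assoc)
  qed
  then show "a \<otimes> b \<in> centralizer T"
    using ac bc by (simp add: centralizer_def)
qed (use assms in \<open>auto simp: centralizer_def subset_iff\<close>)

lemma centralizer_inv:
  assumes "z \<in> centralizer T" "z \<in> Units R" "T \<subseteq> carrier R"
  shows "inv z \<in> centralizer T"
proof -
  have "inv z \<otimes> t = t \<otimes> inv z" if "t \<in> T" for t
  proof -
    have t: "t \<in> carrier R" and z: "z \<in> carrier R" using assms that by auto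
    have "inv z \<otimes> t = inv z \<otimes> (t \<otimes> z) \<otimes> inv z"
      using assms(2) t z by (simp add: m_assoc)
    also have "\<dots> = inv z \<otimes> (z \<otimes> t) \<otimes> inv z"
      using centralizerD[OF assms(1) that] by simp
    also have "\<dots> = t \<otimes> inv z"
      using assms(2) t z by (simp add: m_assoc[symmetric])
    finally show ?thesis .
  qed
  then show ?thesis using assms(2) by (simp add: centralizer_def)
qed

text \<open>Commutativity of \<open>T\<close> places the bicommutant inside the centralizer of
  \<open>T\<close>, with which every element of the bicommutant commutes.\<close>

lemma bicommutant_commute:
  assumes "T \<subseteq> centralizer T" "a \<in> centralizer (centralizer T)" "b \<in> centralizer (centralizer T)"
  shows "a \<otimes> b = b \<otimes> a"
proof -
  have "b \<in> centralizer T" using assms(1,3) by (auto simp: centralizer_def)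
  then show ?thesis using centralizerD[OF assms(2)] by blast
qed

lemma generate_ring_commute:
  assumes "H \<subseteq> centralizer H" "a \<in> generate_ring R H" "b \<in> generate_ring R H"
  shows "a \<otimes> b = b \<otimes> a"
proof -
  have H: "H \<subseteq> carrier R" using assms(1) by (auto simp: centralizer_def)
  have "generate_ring R H \<subseteq> centralizer (centralizer H)"
    by (rule generate_ring_min_subring1[OF H centralizer_subring])
       (use H in \<open>auto simp: centralizer_def\<close>)
  then show ?thesis using bicommutant_commute[OF assms(1)] assms(2,3) by blast
qed

end

section \<open>The symmetric algebra of \<open>V\<close> as a ring of polynomial functions\<close>

context enveloping_quotient
begin

lemma Y_sum_mem: "finite F \<Longrightarrow> subring T D \<Longrightarrow> (\<And>b. b \<in> F \<Longrightarrow> Y (f b) \<in> T) \<Longrightarrow> Y (\<Sum>b\<in>F. f b) \<in> T"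
  by (induction F rule: finite_induct) (auto simp: Y_zero Y_add subringE(2,7))

text \<open>Restricting the generators to a set of basis vectors allows induction on the number of
  variables; \<open>SB B\<close> is all of \<open>S\<close>.\<close>

definition SB :: "'a set \<Rightarrow> 'd set" where "SB B' = generate_ring D (range cst \<union> Y ` B')"

lemma gens_commute: "range cst \<union> Y ` B' \<subseteq> D.centralizer (range cst \<union> Y ` B')"
proof -
  have "g \<otimes> h = h \<otimes> g" if "g \<in> range cst \<union> Y ` B'" "h \<in> range cst \<union> Y ` B'" for g h
    using that Y_Y cst_comm_UD[OF cst_UD] cst_comm_UD[OF Y_UD] by (elim UnE rangeE imageE) metis+
  then show ?thesis by (auto simp: D.centralizer_def)
qed

lemma SB_commute: "a \<in> SB B' \<Longrightarrow> b \<in> SB B' \<Longrightarrow> a \<otimes> b = b \<otimes> a"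
  using D.generate_ring_commute[OF gens_commute] by (simp add: SB_def)

lemma SB_subring: "subring (SB B') D"
  unfolding SB_def by (rule D.generate_ring_is_subring) auto

lemma SB_UNIV: "SB UNIV = S"
  by (simp add: SB_def S_def)

lemma S_commute: "a \<in> S \<Longrightarrow> b \<in> S \<Longrightarrow> a \<otimes> b = b \<otimes> a"
  using SB_commute[of a UNIV b] by (simp add: SB_UNIV)

lemma SB_mono: "B1 \<subseteq> B2 \<Longrightarrow> SB B1 \<subseteq> SB B2"
  unfolding SB_def by (rule D.mono_generate_ring) auto

lemma SB_basis: "SB B = S"
proof
  show "SB B \<subseteq> S" using SB_mono[of B UNIV] by (simp add: SB_UNIV)
  have "Y v \<in> SB B" for v
    using Y_sum_mem[OF finite_Basis SB_subring, where f = "\<lambda>b. smul (crd v b) b"]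
    by (simp add: sum_crd Y_smul SB_def generate_ring.incl generate_ring.eng_mult)
  then show "S \<subseteq> SB B"
    unfolding S_def
    by (intro D.generate_ring_min_subring1[OF _ SB_subring]) (auto simp: SB_def intro: generate_ring.incl)
qed

lemma M_one: "(\<lambda>_. 1) \<in> M"
  by (rule polyfun_const)

text \<open>For \<open>s\<close> in \<open>S\<close> this is the polynomial function corresponding
  to \<open>s\<close>, recovered from its action on the constant 1.\<close>

definition sigma :: "'d \<Rightarrow> (bool \<times> 'a \<Rightarrow> 'k) \<Rightarrow> 'k" where
  "sigma s = act s (\<lambda>_. 1)"

text \<open>Both claims go through the induction together: acting by multiplication is what makes
  \<open>sigma\<close> multiplicative, which in turn keeps its values polynomial in the coordinates
  of \<open>B'\<close>.\<close>

lemma SB_act: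
  assumes "s \<in> SB B'" "B' \<subseteq> B"
  shows "sigma s \<in> polyfun ({False} \<times> B') \<and> (\<forall>P\<in>M. act s P = (\<lambda>q. sigma s q * P q))"
  using assms(1) unfolding SB_def
proof induction
  case one
  show ?case using act_cst[of _ 1] M_one by (simp add: cst_one sigma_def polyfun_const)
next
  case (incl h)
  then show ?case
  proof
    assume "h \<in> range cst"
    then show ?thesis using M_one by (auto simp: sigma_def act_cst polyfun_const)
  next
    assume "h \<in> Y ` B'"
    then obtain b where b: "b \<in> B'" "b \<in> B" "h = Y b" using assms(2) by auto
    then have "lin False b = (\<lambda>q. q (False, b))"
      by (intro ext lin_basis)
    then have "lin False b \<in> polyfun ({False} \<times> B')"
      using b by (simp add: polyfun_var)
    then show ?thesis using b M_one by (simp add: sigma_def act_Y)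
  qed
next
  case (a_inv h)
  have "h \<in> UD" using a_inv.hyps SB_mono[of B' UNIV] S_UD by (auto simp: SB_UNIV SB_def[symmetric])
  then have eq: "act (\<ominus> h) P = (\<lambda>q. - act h P q)" if "P \<in> M" for P
    using that act_closed[OF that, of h]
    by (simp add: uminus_eq act_mult cst_UD act_cst)
  moreover have "sigma (\<ominus> h) = (\<lambda>q. - sigma h q)"
    using eq[OF M_one] by (simp add: sigma_def)
  ultimately show ?case using a_inv by (simp add: polyfun_uminus)
next
  case (eng_add h h')
  have "h \<in> UD" "h' \<in> UD"
    using eng_add.hyps SB_mono[of B' UNIV] S_UD by (auto simp: SB_UNIV SB_def[symmetric])
  moreover from this have "sigma (h \<oplus> h') = (\<lambda>q. sigma h q + sigma h' q)"
    by (simp add: sigma_def act_add M_one)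
  ultimately show ?case using eng_add.IH
    by (simp add: act_add polyfun_add distrib_right)
next
  case (eng_mult h h')
  have "h \<in> UD" "h' \<in> UD"
    using eng_mult.hyps SB_mono[of B' UNIV] S_UD by (auto simp: SB_UNIV SB_def[symmetric])
  then have mult: "act (h \<otimes> h') P = (\<lambda>q. sigma h q * act h' P q)" if "P \<in> M" for P
    using eng_mult.IH(1) act_closed[OF that] that by (simp add: act_mult)
  then have "sigma (h \<otimes> h') = (\<lambda>q. sigma h q * sigma h' q)"
    using M_one by (simp add: sigma_def[of "h \<otimes> h'"] sigma_def[of h'])
  then show ?case using eng_mult.IH mult by (simp add: polyfun_mult mult.assoc)
qed

lemma act_S: "s \<in> S \<Longrightarrow> P \<in> M \<Longrightarrow> act s P = (\<lambda>q. sigma s q * P q)"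
  using SB_act[of s B] by (simp add: SB_basis)

lemma sigma_add: "s \<in> UD \<Longrightarrow> t \<in> UD \<Longrightarrow> sigma (s \<oplus> t) q = sigma s q + sigma t q"
  by (simp add: sigma_def act_add M_one)

lemma sigma_mult: "s \<in> S \<Longrightarrow> t \<in> UD \<Longrightarrow> sigma (s \<otimes> t) q = sigma s q * sigma t q"
  using act_S[of s "act t (\<lambda>_. 1)"] unfolding sigma_def[of "s \<otimes> t"]
  by (simp add: act_mult S_UD M_one act_closed) (simp add: sigma_def)

lemma sigma_cst: "sigma (cst c) q = c"
  by (simp add: sigma_def act_cst M_one)

lemma sigma_zero: "sigma \<zero> q = 0"
  using sigma_cst[of 0] by (simp add: cst_zero)

lemma sigma_Y: "sigma (Y v) q = lin False v q"
  by (simp add: sigma_def act_Y M_one)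

lemma sigma_cong:
  assumes "s \<in> SB B'" "B' \<subseteq> B" "\<And>b. b \<in> B' \<Longrightarrow> q (False, b) = q' (False, b)"
  shows "sigma s q = sigma s q'"
  using SB_act[OF assms(1,2)] assms(3)
  by (intro polyfun_cong[of "sigma s" "{False} \<times> B'"]) auto

text \<open>A polynomial in \<open>Y b\<close> with its coefficients listed from the lowest degree
  upwards; trailing zeros are allowed.\<close>

primrec horner :: "'a \<Rightarrow> 'd list \<Rightarrow> 'd" where
  "horner b [] = \<zero>"
| "horner b (a # as) = a \<oplus> Y b \<otimes> horner b as"

text \<open>The values of \<open>horner b\<close> on lists from \<open>SB B'\<close> form a subring
  containing the generators. Sums add lists entrywise; products reduce to multiplication by a
  coefficient (\<open>scale\<close>) and by \<open>Y b\<close> (\<open>shift\<close>).\<close>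

lemma SB_insert_horner:
  assumes "s \<in> SB (insert b B')"
  shows "\<exists>as. set as \<subseteq> SB B' \<and> s = horner b as"
proof -
  let ?T = "{horner b as | as. set as \<subseteq> SB B'}"
  note SBc = subringE[OF SB_subring[of B']]
  have car: "horner b as \<in> carrier D" if "set as \<subseteq> SB B'" for as
    using that by (induction as) (use SBc(1) in auto)
  have add: "s \<oplus> t \<in> ?T" if "s \<in> ?T" "t \<in> ?T" for s t
  proof -
    have "\<exists>cs. set cs \<subseteq> SB B' \<and> horner b as \<oplus> horner b bs = horner b cs"
      if "set as \<subseteq> SB B'" "set bs \<subseteq> SB B'" for as bs
      using that
    proof (induction as arbitrary: bs)
      case Nil
      then show ?case using car[of bs] by auto
    next
      case (Cons a as)
      show ?case
      proof (cases bs)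
        case Nil
        then show ?thesis using Cons.prems car[of "a # as"] by (intro exI[of _ "a # as"]) simp
      next
        case bs: (Cons b' bs')
        then obtain cs where cs: "set cs \<subseteq> SB B'" "horner b as \<oplus> horner b bs' = horner b cs"
          using Cons.IH[of bs'] Cons.prems by auto
        have c: "a \<in> carrier D" "b' \<in> carrier D" "horner b as \<in> carrier D" "horner b bs' \<in> carrier D" "Y b \<in> carrier D"
          using Cons.prems bs SBc(1) car by auto
        have "horner b (a # as) \<oplus> horner b bs = (a \<oplus> b') \<oplus> Y b \<otimes> (horner b as \<oplus> horner b bs')"
          unfolding bs horner.simps using c by algebra
        then show ?thesis
          using cs Cons.prems bs SBc(7)[of a b'] by (intro exI[of _ "(a \<oplus> b') # cs"]) auto
      qed
    qed
    then show ?thesis using that by blast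
  qed
  have scale: "horner b (map (\<lambda>x. a \<otimes> x) as) = a \<otimes> horner b as" if a: "a \<in> SB B'" and "set as \<subseteq> SB B'" for a as
    using that(2)
  proof (induction as)
    case Nil
    then show ?case using a SBc(1) by auto
  next
    case (Cons x as)
    have c: "a \<in> carrier D" "x \<in> carrier D" "horner b as \<in> carrier D" "Y b \<in> carrier D"
      using Cons.prems SBc(1) car a by auto
    have "a \<in> S" using a SB_mono[of B' UNIV] by (auto simp: SB_UNIV)
    then have "a \<otimes> (Y b \<otimes> horner b as) = Y b \<otimes> (a \<otimes> horner b as)"
      using c S_commute[of a "Y b"] by (simp add: D.m_assoc[symmetric])
    then show ?case using Cons c by (simp add: D.r_distr)
  qed
  have scaleT: "a \<otimes> t \<in> ?T" if a: "a \<in> SB B'" and t: "t \<in> ?T" for a t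
  proof -
    obtain as where "set as \<subseteq> SB B'" "t = horner b as" using t by blast
    then show ?thesis using scale[OF a, of as] SBc(6)[OF a]
      by (intro CollectI exI[of _ "map (\<lambda>x. a \<otimes> x) as"]) auto
  qed
  have shift: "Y b \<otimes> t \<in> ?T" if t: "t \<in> ?T" for t
  proof -
    obtain as where "set as \<subseteq> SB B'" "t = horner b as" using t by blast
    then show ?thesis using SBc(2) car[of as] by (intro CollectI exI[of _ "\<zero> # as"]) auto
  qed
  have zero: "\<zero> \<in> ?T" by (intro CollectI exI[of _ "[]"]) simp
  have mult: "s \<otimes> t \<in> ?T" if s: "s \<in> ?T" and t: "t \<in> ?T" for s t
  proof -
    have tc: "t \<in> carrier D" using t car by blast
    have "horner b as \<otimes> t \<in> ?T" if "set as \<subseteq> SB B'" for as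
      using that
    proof (induction as)
      case Nil
      then show ?case using zero tc by simp
    next
      case (Cons a as)
      have c: "a \<in> carrier D" "horner b as \<in> carrier D"
        using Cons.prems SBc(1) car by auto
      have "horner b (a # as) \<otimes> t = a \<otimes> t \<oplus> Y b \<otimes> (horner b as \<otimes> t)"
        using c tc by (simp add: D.l_distr D.m_assoc)
      also have "\<dots> \<in> ?T"
      proof (rule add)
        show "a \<otimes> t \<in> ?T" using Cons.prems by (intro scaleT t) simp
        show "Y b \<otimes> (horner b as \<otimes> t) \<in> ?T" by (rule shift, rule Cons.IH) (use Cons.prems in simp)
      qed
      finally show ?case .
    qed
    then show ?thesis using s by blast
  qed
  have const: "a \<in> ?T" if "a \<in> SB B'" for a
    using that SBc(1) by (intro CollectI exI[of _ "[a]"]) auto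
  have "SB (insert b B') \<subseteq> ?T"
    unfolding SB_def[of "insert b B'"]
  proof (rule D.generate_ring_min_subring1)
    show "subring ?T D"
    proof (rule D.subringI)
      show "\<one> \<in> ?T" using const SBc(3) by blast
      show "\<ominus> h \<in> ?T" if "h \<in> ?T" for h
      proof -
        have "cst (-1) \<in> SB B'" by (auto simp: SB_def intro: generate_ring.incl)
        then show ?thesis using scaleT[OF _ that] that car uminus_eq by auto
      qed
    qed (use car add mult in auto)
    have "Y b \<in> ?T" using shift[of \<one>] const SBc(3) by simp
    moreover have "range cst \<union> Y ` B' \<subseteq> SB B'"
      by (auto simp: SB_def intro: generate_ring.incl)
    ultimately show "range cst \<union> Y ` insert b B' \<subseteq> ?T"
      using const by blast
  qed auto
  then show ?thesis using assms by blast
qed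

text \<open>A polynomial in \<open>Y b\<close> whose coefficients do not involve \<open>Y b\<close> is killed by \<^const>\<open>sigma\<close> only
  if all coefficients are, since the coordinate \<open>(False, b)\<close> takes infinitely many values.\<close>

lemma sigma_inj_SB:
  assumes "finite B'" "B' \<subseteq> B" "s \<in> SB B'" "\<And>q. sigma s q = 0"
  shows "s = \<zero>"
  using assms
proof (induction B' arbitrary: s rule: finite_induct)
  case empty
  have "SB {} \<subseteq> range cst"
    unfolding SB_def
  proof (rule D.generate_ring_min_subring1)
    show "subring (range cst) D"
    proof (rule D.subringI)
      show "\<ominus> h \<in> range cst" if "h \<in> range cst" for h
        using that by (auto simp: uminus_eq simp flip: cst_mult)
    qed (auto simp flip: cst_add cst_mult cst_one)
  qed auto
  then obtain c where "s = cst c" using empty by blast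
  then show ?case using empty.prems(3) by (simp add: sigma_cst cst_zero)
next
  case (insert b B')
  obtain as where as: "set as \<subseteq> SB B'" and s: "s = horner b as"
    using SB_insert_horner insert.prems by blast
  have SBS: "SB B' \<subseteq> S" using SB_mono[of B' UNIV] by (simp add: SB_UNIV)
  have hS: "horner b xs \<in> S" if "set xs \<subseteq> SB B'" for xs
    using that SBS by (induction xs) auto
  have b: "b \<in> B" using insert.prems by simp
  have sig: "sigma (horner b xs) q = poly (Poly (map (\<lambda>a. sigma a q) xs)) (q (False, b))"
    if "set xs \<subseteq> SB B'" for xs q
    using that
  proof (induction xs)
    case (Cons a xs)
    then have "a \<in> UD" "Y b \<otimes> horner b xs \<in> UD" "horner b xs \<in> UD"
      using SBS hS S_UD by auto
    then show ?case using Cons by (simp add: sigma_add sigma_mult sigma_Y lin_basis b)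
  qed (simp add: sigma_zero)
  have "a = \<zero>" if "a \<in> set as" for a
  proof (rule insert.IH)
    show "a \<in> SB B'" "B' \<subseteq> B" using that as insert.prems by auto
    show "sigma a q = 0" for q
    proof -
      have "poly (Poly (map (\<lambda>a. sigma a q) as)) t = poly 0 t" for t
      proof -
        \<comment> \<open>Only the coordinate \<open>(False, b)\<close> changes, so the coefficients
          keep their values while the variable runs through the whole field.\<close>
        let ?q = "q((False, b) := t)"
        have "map (\<lambda>a. sigma a q) as = map (\<lambda>a. sigma a ?q) as"
          using as insert.hyps insert.prems by (auto intro!: sigma_cong[where B' = B'])
        moreover have "sigma s ?q = 0" by (rule insert.prems(3))
        moreover have "?q (False, b) = t" by simp
        ultimately show ?thesis
          using sig[OF as, of ?q] unfolding s poly_0 by (simp only:)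
      qed
      then have "Poly (map (\<lambda>a. sigma a q) as) = 0"
        using poly_eq_poly_eq_iff by blast
      \<comment> \<open>\<open>Poly\<close> drops trailing zeros, so its vanishing means that all
        entries of the list are zero.\<close>
      then obtain n where "map (\<lambda>a. sigma a q) as = replicate n 0" by (auto simp: Poly_eq_0)
      moreover have "sigma a q \<in> set (map (\<lambda>a. sigma a q) as)" using that by auto
      ultimately show ?thesis by (metis in_set_replicate)
    qed
  qed
  then have "set as \<subseteq> {\<zero>}" by blast
  then have "horner b as = \<zero>" by (induction as) auto
  then show ?case by (simp add: s)
qed

lemma sigma_inj: "s \<in> S \<Longrightarrow> (\<And>q. sigma s q = 0) \<Longrightarrow> s = \<zero>"
  using sigma_inj_SB[OF finite_Basis, of s] by (simp add: SB_basis)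

lemma UD_finsum: "finite A \<Longrightarrow> (\<And>a. a \<in> A \<Longrightarrow> f a \<in> UD) \<Longrightarrow> (\<Oplus>a\<in>A. f a) \<in> UD"
proof (induction A rule: finite_induct)
  case (insert x F)
  then have "f \<in> F \<rightarrow> carrier D" "f x \<in> carrier D" by auto
  then show ?case using insert by (simp add: subringE(7)[OF UD_subring])
qed (simp add: subringE(2)[OF UD_subring])

lemma act_finsum:
  assumes "finite A" "\<And>a. a \<in> A \<Longrightarrow> f a \<in> UD" "P \<in> M"
  shows "act (\<Oplus>a\<in>A. f a) P q = (\<Sum>a\<in>A. act (f a) P q)"
  using assms
proof (induction A rule: finite_induct)
  case empty
  then show ?case using act_cst[of P 0] by (simp add: cst_zero)
next
  case (insert x F)
  then have "f \<in> F \<rightarrow> carrier D" "f x \<in> carrier D" by auto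
  then show ?case using insert by (simp add: act_add UD_finsum)
qed

lemma sigma_finsum:
  "finite A \<Longrightarrow> (\<And>a. a \<in> A \<Longrightarrow> f a \<in> UD) \<Longrightarrow> sigma (\<Oplus>a\<in>A. f a) q = (\<Sum>a\<in>A. sigma (f a) q)"
  by (simp add: sigma_def act_finsum M_one)

text \<open>Compare the actions of both sides on the constant \<open>1\<close> and on the unit of the second copy of
  the regular module.\<close>

lemma X_independent:
  assumes p: "\<And>b. b \<in> B \<Longrightarrow> p b \<in> S" and r: "(\<Oplus>b\<in>B. p b \<otimes> X b) \<in> S" and b: "b \<in> B"
  shows "p b = \<zero>"
proof (rule sigma_inj[OF p[OF b]])
  fix q :: "bool \<times> 'a \<Rightarrow> 'k"
  let ?z = "\<Oplus>b\<in>B. p b \<otimes> X b"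
  obtain e :: 'a where e: "\<And>x. x * e = x" using unit by blast
  have UD: "p b \<otimes> X b \<in> UD" if "b \<in> B" for b
    using p[OF that] by (intro subringE(6)[OF UD_subring] S_UD X_UD)
  have act: "act ?z P q = (\<Sum>b\<in>B. sigma (p b) q * deriv b P q)" if P: "P \<in> M" for P q
  proof -
    have "act (p b \<otimes> X b) P q = sigma (p b) q * deriv b P q" if "b \<in> B" for b
      using p[OF that] P by (simp add: act_mult S_UD X_UD act_X act_S deriv_closed)
    then show ?thesis by (simp add: act_finsum[OF finite_Basis UD P])
  qed
  \<comment> \<open>Derivations kill the constant 1. As \<open>?z\<close> lies in \<open>S\<close>,
    it acts by multiplication with this value, hence by zero.\<close>
  have "sigma ?z q = 0" for q
    using act[OF M_one] by (simp add: sigma_def)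
  then have z: "act ?z P q = 0" if "P \<in> M" for P q
    using act_S[OF r that] by simp
  \<comment> \<open>The \<open>True\<close> coordinates single out \<open>b\<close>: for
    \<open>b'\<close> in \<open>B\<close>, \<open>lin True (b' * e)\<close> is 1 here if
    \<open>b' = b\<close> and 0 otherwise. The \<open>False\<close> coordinates, on which
    \<open>sigma (p b)\<close> depends, are unchanged.\<close>
  define q' where "q' = (\<lambda>(s, a). if s then if a = b then 1 else 0 else q (s, a))"
  have "(\<Sum>b'\<in>B. sigma (p b') q' * lin True (b' * e) q') = 0"
    using z[OF lin_polyfun_UNIV, of True e q'] act[OF lin_polyfun_UNIV, of True e q'] by (simp add: deriv_lin)
  then have "(\<Sum>b'\<in>B. if b' = b then sigma (p b') q' else 0) = 0"
    by (simp add: e lin_basis q'_def if_distrib[of "\<lambda>x. _ * x"] cong: if_cong)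
  then have "sigma (p b) q' = 0" using b finite_Basis by simp
  moreover have "sigma (p b) q' = sigma (p b) q"
    by (rule sigma_cong[where B' = B]) (use p[OF b] in \<open>auto simp: SB_basis q'_def\<close>)
  ultimately show "sigma (p b) q = 0" by simp
qed

end

section \<open>Generic independence of the derivations\<close>

lemma polyfun_common_nonzero:
  fixes Q :: "'a \<Rightarrow> ('i \<Rightarrow> 'k::field_char_0) \<Rightarrow> 'k"
  assumes "finite A" "\<And>a. a \<in> A \<Longrightarrow> Q a \<in> polyfun I" "\<And>a. a \<in> A \<Longrightarrow> \<exists>q. Q a q \<noteq> 0"
  shows "(\<lambda>q. \<Prod>a\<in>A. Q a q) \<in> polyfun I \<and> (\<exists>q. (\<Prod>a\<in>A. Q a q) \<noteq> 0)"
  using assms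
proof (induction A rule: finite_induct)
  case empty
  then show ?case by (simp add: polyfun_const)
next
  case (insert a A)
  then have P: "(\<lambda>q. \<Prod>a\<in>A. Q a q) \<in> polyfun I" and Q: "Q a \<in> polyfun I" by auto
  obtain q0 where q0: "(\<Prod>a\<in>A. Q a q0) \<noteq> 0" using insert.IH insert.prems by blast
  obtain q1 where q1: "Q a q1 \<noteq> 0" using insert.prems(2) by blast
  have "\<exists>q. Q a q * (\<Prod>a\<in>A. Q a q) \<noteq> 0"
    using polyfun_no_zero_divisors[OF Q P _ q1, of q0] q0 by blast
  then show ?case using insert.hyps polyfun_mult[OF Q P] by simp
qed

text \<open>Gaussian elimination without division, with unknowns indexed by \<open>N\<close> and
  equations by \<open>J\<close>. A nonzero pivot in equation \<open>j\<close> eliminates the unknown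
  \<open>r\<close>, and the induction hypothesis solves the remaining system.\<close>

lemma polyfun_underdetermined_system:
  fixes A :: "'b \<Rightarrow> 'c \<Rightarrow> ('i \<Rightarrow> 'k::field_char_0) \<Rightarrow> 'k"
  assumes "finite J" "finite N" "card J < card N"
    and "\<And>b j. b \<in> N \<Longrightarrow> j \<in> J \<Longrightarrow> A b j \<in> polyfun I"
  shows "\<exists>P. (\<forall>b\<in>N. P b \<in> polyfun I) \<and> (\<exists>b\<in>N. \<exists>q. P b q \<noteq> 0) \<and>
    (\<forall>j\<in>J. \<forall>q. (\<Sum>b\<in>N. P b q * A b j q) = 0)"
  using assms
proof (induction J arbitrary: N A rule: finite_induct)
  case empty
  then have "N \<noteq> {}" by auto
  then show ?case by (intro exI[of _ "\<lambda>_ _. 1"]) (auto simp: polyfun_const)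
next
  case (insert j J)
  show ?case
  proof (cases "\<forall>b\<in>N. \<forall>q. A b j q = 0")
    case True
    have "card J < card N" using insert by simp
    then obtain P where P: "\<forall>b\<in>N. P b \<in> polyfun I" "\<exists>b\<in>N. \<exists>q. P b q \<noteq> 0"
      "\<forall>j\<in>J. \<forall>q. (\<Sum>b\<in>N. P b q * A b j q) = 0"
      using insert.IH[of N A] insert.prems by auto
    then show ?thesis using True by (intro exI[of _ P]) simp
  next
    case False
    then obtain r q0 where r: "r \<in> N" and q0: "A r j q0 \<noteq> 0" by blast
    let ?N = "N - {r}"
    \<comment> \<open>Cross-multiplication with the pivot removes the unknown \<open>r\<close> from
      equation \<open>i\<close>.\<close>
    define A' where "A' b i = (\<lambda>q. A r j q * A b i q - A b j q * A r i q)" for b i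
    have "card J < card ?N" using insert r by simp
    moreover have "A' b i \<in> polyfun I" if "b \<in> ?N" "i \<in> J" for b i
      unfolding A'_def using insert.prems(3) r that by (intro polyfun_diff polyfun_mult) auto
    ultimately obtain P where P: "\<forall>b\<in>?N. P b \<in> polyfun I" "\<exists>b\<in>?N. \<exists>q. P b q \<noteq> 0"
      "\<forall>i\<in>J. \<forall>q. (\<Sum>b\<in>?N. P b q * A' b i q) = 0"
      using insert.IH[of ?N A'] insert.prems(1) by auto
    \<comment> \<open>Back substitution: the other unknowns are multiplied by the pivot, so that the
      value at \<open>r\<close> requires no denominator.\<close>
    define P' where "P' b = (if b = r then (\<lambda>q. - (\<Sum>b\<in>?N. P b q * A b j q)) else (\<lambda>q. A r j q * P b q))" for b
    have "P' b \<in> polyfun I" if "b \<in> N" for b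
      unfolding P'_def using P(1) insert.prems(3) r that
      by (auto intro!: polyfun_uminus polyfun_sum polyfun_mult)
    moreover have "\<exists>b\<in>N. \<exists>q. P' b q \<noteq> 0"
    proof -
      obtain b q1 where b: "b \<in> N" "b \<noteq> r" and q1: "P b q1 \<noteq> 0" using P(2) by blast
      have "\<exists>q. A r j q * P b q \<noteq> 0"
        using polyfun_no_zero_divisors[of "A r j" I "P b" I q0 q1] insert.prems(3) r P(1) b q0 q1 by auto
      then show ?thesis using b by (auto simp: P'_def)
    qed
    moreover have "(\<Sum>b\<in>N. P' b q * A b i q) = 0" if "i \<in> insert j J" for i q
    proof -
      have "(\<Sum>b\<in>N. P' b q * A b i q) = P' r q * A r i q + (\<Sum>b\<in>?N. P' b q * A b i q)"
        using insert.prems(1) r by (simp add: sum.remove)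
      also have "(\<Sum>b\<in>?N. P' b q * A b i q) = (\<Sum>b\<in>?N. A r j q * P b q * A b i q)"
        by (rule sum.cong) (auto simp: P'_def)
      also have "P' r q * A r i q = - (\<Sum>b\<in>?N. P b q * A b j q * A r i q)"
        by (simp add: P'_def sum_distrib_right)
      also have "\<dots> + (\<Sum>b\<in>?N. A r j q * P b q * A b i q) = (\<Sum>b\<in>?N. P b q * A' b i q)"
        by (simp add: A'_def sum_subtractf[symmetric] algebra_simps)
      also have "\<dots> = 0"
        using that P(3) by (auto simp: A'_def mult.commute)
      finally show ?thesis .
    qed
    ultimately show ?thesis by blast
  qed
qed

section \<open>Frobenius forms and the generic action on linear forms\<close>

context fd_algebra_char_0
begin

abbreviation SV :: "((bool \<times> 'a \<Rightarrow> 'k) \<Rightarrow> 'k) set" where "SV \<equiv> polyfun ({False} \<times> B)"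

text \<open>No nonzero combination of the derivations of \<open>S(V)\<close> given by a basis of \<open>A\<close> vanishes.\<close>

definition generic_action_faithful :: bool where
  "generic_action_faithful \<longleftrightarrow> (\<forall>P. (\<forall>b\<in>B. P b \<in> SV) \<longrightarrow>
     (\<forall>v\<in>B. \<forall>q. (\<Sum>b\<in>B. P b q * lin False (b * v) q) = 0) \<longrightarrow> (\<forall>b\<in>B. \<forall>q. P b q = 0))"

lemma generic_action_faithfulD:
  assumes generic_action_faithful and "\<And>b. b \<in> B \<Longrightarrow> P b \<in> SV"
    and "\<And>v q. v \<in> B \<Longrightarrow> (\<Sum>b\<in>B. P b q * lin False (b * v) q) = 0" and "b \<in> B"
  shows "P b q = 0"
  using assms unfolding generic_action_faithful_def by blast

lemma lin_mult_left: "lin s (x * v) q = (\<Sum>a\<in>B. crd x a * lin s (a * v) q)"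
  by (subst sum_crd[of x, symmetric]) (simp add: sum_distrib_right lin_sum smul_mult_left[symmetric] lin_smul)

lemma lin_line: "lin s v (\<lambda>i. q i + t * w i) = lin s v q + t * lin s v w"
  by (simp add: lin_def algebra_simps sum.distrib sum_distrib_left)

text \<open>A Frobenius form is a point at which the matrix of linear forms \<open>b * v\<close> is
  nonsingular. On a line through it, the coefficients of lowest degree of the \<open>P b\<close>
  would satisfy the relation at that point, so induction on the degree kills all
  coefficients.\<close>

lemma frobenius_imp_faithful:
  assumes "frobenius_algebra smul"
  shows generic_action_faithful
  unfolding generic_action_faithful_def
proof (intro allI impI)
  fix P assume P: "\<forall>b\<in>B. P b \<in> SV" and rel: "\<forall>v\<in>B. \<forall>q. (\<Sum>b\<in>B. P b q * lin False (b * v) q) = 0"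
  obtain h where h: "h \<in> dual_space smul" and nd: "\<And>a. (\<And>b. h (a * b) = 0) \<Longrightarrow> a = 0"
    using assms by (auto simp: frobenius_algebra_def)
  \<comment> \<open>The point at which the linear form of each \<open>v\<close> takes the value
    \<open>h v\<close>.\<close>
  define q0 where "q0 = (\<lambda>i :: bool \<times> 'a. h (snd i))"
  have lin_q0: "lin s v q0 = h v" for s v
    by (simp add: lin_def q0_def dual_crd[OF h, of v])
  have nd': "c b = 0" if c: "\<And>v. v \<in> B \<Longrightarrow> (\<Sum>b\<in>B. c b * h (b * v)) = 0" and b: "b \<in> B" for c b
  proof -
    let ?a = "\<Sum>b\<in>B. smul (c b) b"
    have a: "h (?a * v) = (\<Sum>b\<in>B. c b * h (b * v))" for v
      by (simp add: sum_distrib_right smul_mult_left[symmetric] dual_sum[OF h] dual_smul[OF h])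
    have "h (?a * v) = 0" for v
      using lin_mult[of False ?a v q0] by (simp add: lin_q0 a c)
    then have "?a = 0" by (rule nd)
    then have "crd ?a b = 0" by simp
    then show ?thesis
      using b finite_Basis
      by (simp add: crd_sum crd_smul crd_basis if_distrib[of "\<lambda>x. _ * x"] cong: if_cong)
  qed
  show "\<forall>b\<in>B. \<forall>q. P b q = 0"
  proof (intro ballI allI)
    fix b q assume b: "b \<in> B"
    define w where "w i = q i - q0 i" for i
    have "\<forall>b\<in>B. \<exists>r. \<forall>t. P b (\<lambda>i. q0 i + t * w i) = poly r t"
      using P polyfun_line by blast
    then obtain r where r: "\<And>b t. b \<in> B \<Longrightarrow> P b (\<lambda>i. q0 i + t * w i) = poly (r b) t"
      by metis
    have *: "(\<Sum>b\<in>B. r b * [:h (b * v), lin False (b * v) w:]) = 0" if v: "v \<in> B" for v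
    proof -
      have "poly (\<Sum>b\<in>B. r b * [:h (b * v), lin False (b * v) w:]) t = poly 0 t" for t
        using rel[rule_format, OF v, of "\<lambda>i. q0 i + t * w i"]
        by (simp add: lin_line lin_q0 r poly_sum algebra_simps)
      then show ?thesis using poly_eq_poly_eq_iff by blast
    qed
    have co: "(\<Sum>b\<in>B. coeff (r b * [:h (b * v), lin False (b * v) w:]) n) = 0" if "v \<in> B" for v n
    proof -
      have "coeff (\<Sum>b\<in>B. r b * [:h (b * v), lin False (b * v) w:]) n = 0"
        using * [OF that] by simp
      then show ?thesis by (simp only: coeff_sum)
    qed
    have "\<forall>b\<in>B. coeff (r b) n = 0" for n
    proof (induction n rule: less_induct)
      case (less n)
      have z: "(\<Sum>b\<in>B. coeff (r b) n * h (b * v)) = 0" if v: "v \<in> B" for v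
      proof -
        \<comment> \<open>The term \<open>lin False (b * v) w\<close> contributes only through
          degree \<open>n - 1\<close>, where the coefficient already vanishes; for
          \<open>n = 0\<close> there is no such term.\<close>
        have "coeff (r b) n * h (b * v) = coeff (r b * [:h (b * v), lin False (b * v) w:]) n"
          if "b \<in> B" for b
          using less that
          by (cases n) (simp_all add: mult.commute[of "r b"] coeff_pCons mult_pCons_left algebra_simps)
        then have "(\<Sum>b\<in>B. coeff (r b) n * h (b * v))
            = (\<Sum>b\<in>B. coeff (r b * [:h (b * v), lin False (b * v) w:]) n)"
          by (rule sum.cong[OF refl])
        then show ?thesis using co[OF v, of n] by simp
      qed
      show ?case by (intro ballI nd'[of "\<lambda>b. coeff (r b) n"] z)
    qed
    then have "r b = 0" using b by (simp add: poly_eq_iff)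
    then show "P b q = 0" using r[OF b, of 1] by (simp add: w_def)
  qed
qed

text \<open>\<open>P\<close> plays the role of the adjugate of the matrix of linear forms
  \<open>b * v\<close>, and \<open>Q\<close> that of its determinant: the products of the two
  matrices in either order are \<open>Q\<close> times the identity.\<close>

lemma faithful_imp_dual_system:
  assumes faithful: generic_action_faithful
  obtains P Q where "\<And>l b. l \<in> B \<Longrightarrow> b \<in> B \<Longrightarrow> P l b \<in> SV" "Q \<in> SV" "\<exists>q. Q q \<noteq> 0"
    "\<And>l v q. l \<in> B \<Longrightarrow> v \<in> B \<Longrightarrow> (\<Sum>b\<in>B. P l b q * lin False (b * v) q) = (if l = v then Q q else 0)"
    "\<And>x b q. b \<in> B \<Longrightarrow> (\<Sum>l\<in>B. lin False (x * l) q * P l b q) = crd x b * Q q"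
proof -
  \<comment> \<open>Row \<open>l\<close> of the matrix: vanishing at all \<open>v\<close> other than
    \<open>l\<close> imposes one equation fewer than there are unknowns.\<close>
  have "\<exists>P. (\<forall>b\<in>B. P b \<in> SV) \<and> (\<exists>b\<in>B. \<exists>q. P b q \<noteq> 0) \<and>
      (\<forall>v\<in>B - {l}. \<forall>q. (\<Sum>b\<in>B. P b q * lin False (b * v) q) = 0)" if "l \<in> B" for l
    using finite_Basis that lin_polyfun card_gt_0_iff[of B]
    by (intro polyfun_underdetermined_system) (auto simp: card_Diff_singleton)
  then have "\<forall>l\<in>B. \<exists>P. (\<forall>b\<in>B. P b \<in> SV) \<and> (\<exists>b\<in>B. \<exists>q. P b q \<noteq> 0) \<and>
      (\<forall>v\<in>B - {l}. \<forall>q. (\<Sum>b\<in>B. P b q * lin False (b * v) q) = 0)" by blast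
  from bchoice[OF this] obtain P0
    where "\<forall>l\<in>B. (\<forall>b\<in>B. P0 l b \<in> SV) \<and> (\<exists>b\<in>B. \<exists>q. P0 l b q \<noteq> 0) \<and>
      (\<forall>v\<in>B - {l}. \<forall>q. (\<Sum>b\<in>B. P0 l b q * lin False (b * v) q) = 0)" by blast
  then have P0: "\<And>l b. l \<in> B \<Longrightarrow> b \<in> B \<Longrightarrow> P0 l b \<in> SV"
      "\<And>l. l \<in> B \<Longrightarrow> \<exists>b\<in>B. \<exists>q. P0 l b q \<noteq> 0"
      "\<And>l v q. l \<in> B \<Longrightarrow> v \<in> B \<Longrightarrow> v \<noteq> l \<Longrightarrow> (\<Sum>b\<in>B. P0 l b q * lin False (b * v) q) = 0"
    by auto
  \<comment> \<open>The remaining diagonal entry of the product; if it vanished, faithfulness would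
    kill the whole row.\<close>
  define Q0 where "Q0 l q = (\<Sum>b\<in>B. P0 l b q * lin False (b * l) q)" for l q
  have Q0: "Q0 l \<in> SV" if "l \<in> B" for l
    unfolding Q0_def[abs_def] using P0(1) that by (intro polyfun_sum polyfun_mult lin_polyfun) auto
  have Q0_nz: "\<exists>q. Q0 l q \<noteq> 0" if l: "l \<in> B" for l
  proof (rule ccontr)
    assume "\<not> ?thesis"
    then have rel: "(\<Sum>b\<in>B. P0 l b q * lin False (b * v) q) = 0" if "v \<in> B" for v q
      using P0(3)[OF l that] by (cases "v = l") (auto simp: Q0_def)
    have "P0 l b q = 0" if "b \<in> B" for b q
      by (rule generic_action_faithfulD[OF faithful P0(1)[OF l] rel that])
    then show False using P0(2)[OF l] by blast
  qed
  define Q where "Q q = (\<Prod>l\<in>B. Q0 l q)" for q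
  \<comment> \<open>Scaling row \<open>l\<close> by the diagonal entries of the other rows gives
    every row the same diagonal entry \<open>Q\<close>.\<close>
  define P where "P l b q = (\<Prod>m\<in>B - {l}. Q0 m q) * P0 l b q" for l b q
  have Q: "Q \<in> SV" "\<exists>q. Q q \<noteq> 0"
    using polyfun_common_nonzero[OF finite_Basis Q0 Q0_nz] by (simp_all add: Q_def[abs_def])
  have P: "P l b \<in> SV" if "l \<in> B" "b \<in> B" for l b
    unfolding P_def[abs_def] using P0(1) that polyfun_common_nonzero[of "B - {l}", OF _ Q0 Q0_nz] finite_Basis
    by (intro polyfun_mult) auto
  have left: "(\<Sum>b\<in>B. P l b q * lin False (b * v) q) = (if l = v then Q q else 0)"
    if l: "l \<in> B" and v: "v \<in> B" for l v q
  proof -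
    have "(\<Sum>b\<in>B. P l b q * lin False (b * v) q)
        = (\<Prod>m\<in>B - {l}. Q0 m q) * (\<Sum>b\<in>B. P0 l b q * lin False (b * v) q)"
      by (simp add: P_def sum_distrib_left mult.assoc)
    also have "\<dots> = (if l = v then Q q else 0)"
      using P0(3)[OF l v] l finite_Basis
      by (auto simp: Q_def Q0_def[symmetric] prod.remove mult.commute)
    finally show ?thesis .
  qed
  have right: "(\<Sum>l\<in>B. lin False (x * l) q * P l b q) = crd x b * Q q" if b: "b \<in> B" for x b q
  proof -
    \<comment> \<open>The error in the product taken in the other order. Multiplied by the matrix it
      vanishes because of \<open>left\<close>, so faithfulness makes it zero.\<close>
    define R where "R b q = (\<Sum>l\<in>B. lin False (x * l) q * P l b q) - crd x b * Q q" for b q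
    have R: "R b \<in> SV" if "b \<in> B" for b
      unfolding R_def[abs_def] using that
      by (intro polyfun_diff polyfun_sum polyfun_mult lin_polyfun polyfun_const P Q)
    have rel: "(\<Sum>b\<in>B. R b q * lin False (b * v) q) = 0" if v: "v \<in> B" for v q
    proof -
      have "(\<Sum>b\<in>B. (\<Sum>l\<in>B. lin False (x * l) q * P l b q) * lin False (b * v) q)
          = (\<Sum>l\<in>B. lin False (x * l) q * (\<Sum>b\<in>B. P l b q * lin False (b * v) q))"
        by (simp add: sum_distrib_left sum_distrib_right mult.assoc) (rule sum.swap)
      also have "\<dots> = lin False (x * v) q * Q q"
        using v finite_Basis by (simp add: left if_distrib[of "\<lambda>x. _ * x"] cong: if_cong)
      also have "\<dots> = (\<Sum>b\<in>B. crd x b * Q q * lin False (b * v) q)"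
        by (simp add: lin_mult_left[of _ x v] sum_distrib_right sum_distrib_left mult_ac)
      finally show ?thesis by (simp add: R_def left_diff_distrib sum_subtractf)
    qed
    have "R b q = 0" by (rule generic_action_faithfulD[OF faithful R rel b])
    then show ?thesis by (simp add: R_def)
  qed
  show thesis by (rule that[OF P Q left right])
qed

text \<open>At a point \<open>q\<close> with \<open>Q q\<close> nonzero, the evaluated matrix is
  invertible and recovers the coordinates of \<open>v\<close> from the values
  \<open>lin False (a * v) q\<close>. Evaluation at \<open>q\<close> is therefore a Frobenius
  form.\<close>

lemma faithful_imp_frobenius:
  assumes generic_action_faithful
  shows "frobenius_algebra smul"
proof -
  obtain P Q where Q: "\<exists>q. Q q \<noteq> 0"
    and left: "\<And>l v q. l \<in> B \<Longrightarrow> v \<in> B \<Longrightarrow>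
      (\<Sum>b\<in>B. P l b q * lin False (b * v) q) = (if l = v then Q q else 0)"
    by (rule faithful_imp_dual_system[OF assms]) blast
  from Q obtain q where q: "Q q \<noteq> 0" by blast
  show ?thesis
  proof (rule frobenius_algebraI)
    show "(\<lambda>v. lin False v q) \<in> dual_space smul"
      by (simp add: dual_space_iff[OF vector_space_axioms] lin_add lin_smul)
    fix v assume v: "\<And>a. lin False (a * v) q = 0"
    have "crd v l = 0" if l: "l \<in> B" for l
    proof -
      have "0 = lin False ((\<Sum>b\<in>B. smul (P l b q) b) * v) q" using v by simp
      also have "\<dots> = (\<Sum>b\<in>B. P l b q * (\<Sum>v'\<in>B. crd v v' * lin False (b * v') q))"
        by (simp add: sum_distrib_right smul_mult_left[symmetric] lin_sum lin_smul lin_mult[of _ _ v])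
      also have "\<dots> = (\<Sum>v'\<in>B. crd v v' * (\<Sum>b\<in>B. P l b q * lin False (b * v') q))"
        by (simp add: sum_distrib_left mult.left_commute) (rule sum.swap)
      also have "\<dots> = crd v l * Q q"
        using l finite_Basis by (simp add: left if_distrib[of "\<lambda>x. _ * x"] cong: if_cong)
      finally show ?thesis using q by simp
    qed
    then show "v = 0" using sum_crd[of v] by simp
  qed
qed

end

section \<open>The field of fractions and its centralizer\<close>

context ring
begin

definition com :: "'a \<Rightarrow> 'a \<Rightarrow> 'a" where "com a b = a \<otimes> b \<ominus> b \<otimes> a"

lemma com_closed [simp]: "a \<in> carrier R \<Longrightarrow> b \<in> carrier R \<Longrightarrow> com a b \<in> carrier R"
  by (simp add: com_def)

lemma com_eq_zero_iff: "a \<in> carrier R \<Longrightarrow> b \<in> carrier R \<Longrightarrow> com a b = \<zero> \<longleftrightarrow> a \<otimes> b = b \<otimes> a"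
  by (simp add: com_def)

lemma com_eqI: "a \<in> carrier R \<Longrightarrow> b \<in> carrier R \<Longrightarrow> c \<in> carrier R \<Longrightarrow>
    a \<otimes> b = b \<otimes> a \<oplus> c \<Longrightarrow> com a b = c"
  unfolding com_def by (simp add: minus_eq a_ac r_neg)

lemma com_add_left: "a \<in> carrier R \<Longrightarrow> b \<in> carrier R \<Longrightarrow> c \<in> carrier R \<Longrightarrow>
    com (a \<oplus> b) c = com a c \<oplus> com b c"
  unfolding com_def by algebra

lemma com_mult_left: "a \<in> carrier R \<Longrightarrow> b \<in> carrier R \<Longrightarrow> c \<in> carrier R \<Longrightarrow>
    com (a \<otimes> b) c = a \<otimes> com b c \<oplus> com a c \<otimes> b"
  unfolding com_def by algebra

lemma com_mult_right: "a \<in> carrier R \<Longrightarrow> b \<in> carrier R \<Longrightarrow> c \<in> carrier R \<Longrightarrow>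
    com a (b \<otimes> c) = com a b \<otimes> c \<oplus> b \<otimes> com a c"
  unfolding com_def by algebra

lemma com_add_right: "a \<in> carrier R \<Longrightarrow> b \<in> carrier R \<Longrightarrow> c \<in> carrier R \<Longrightarrow>
    com a (b \<oplus> c) = com a b \<oplus> com a c"
  unfolding com_def by algebra

lemma com_uminus_right: "a \<in> carrier R \<Longrightarrow> b \<in> carrier R \<Longrightarrow> com a (\<ominus> b) = \<ominus> com a b"
  unfolding com_def by algebra

lemma com_swap: "a \<in> carrier R \<Longrightarrow> b \<in> carrier R \<Longrightarrow> com a b = \<ominus> com b a"
  unfolding com_def by algebra

lemma mult_eq_com: "a \<in> carrier R \<Longrightarrow> b \<in> carrier R \<Longrightarrow> a \<otimes> b = b \<otimes> a \<oplus> com a b"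
  unfolding com_def by algebra

lemma add_mult_diff_regroup: "a \<in> carrier R \<Longrightarrow> e \<in> carrier R \<Longrightarrow> c \<in> carrier R \<Longrightarrow> x \<in> carrier R \<Longrightarrow>
    r \<in> carrier R \<Longrightarrow> (a \<oplus> e \<otimes> x \<oplus> r) \<ominus> (a \<oplus> c \<otimes> x) = (e \<ominus> c) \<otimes> x \<oplus> r"
  by algebra

lemma add_diff_mult_regroup: "e \<in> carrier R \<Longrightarrow> e' \<in> carrier R \<Longrightarrow> c \<in> carrier R \<Longrightarrow> z \<in> carrier R \<Longrightarrow>
    w \<in> carrier R \<Longrightarrow> (e \<oplus> e') \<ominus> c \<otimes> (z \<oplus> w) = (e \<ominus> c \<otimes> z) \<oplus> (e' \<ominus> c \<otimes> w)"
  by algebra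

lemma finsum_swap:
  assumes "finite A" "finite C" "\<And>a c. a \<in> A \<Longrightarrow> c \<in> C \<Longrightarrow> f a c \<in> carrier R"
  shows "(\<Oplus>a\<in>A. \<Oplus>c\<in>C. f a c) = (\<Oplus>c\<in>C. \<Oplus>a\<in>A. f a c)"
  using assms
proof (induction A rule: finite_induct)
  case (insert x F)
  then have "(\<Oplus>a\<in>insert x F. \<Oplus>c\<in>C. f a c) = (\<Oplus>c\<in>C. f x c) \<oplus> (\<Oplus>a\<in>F. \<Oplus>c\<in>C. f a c)"
    by (intro finsum_insert) (auto intro!: finsum_closed)
  also have "(\<Oplus>a\<in>F. \<Oplus>c\<in>C. f a c) = (\<Oplus>c\<in>C. \<Oplus>a\<in>F. f a c)"
    using insert by auto
  also have "(\<Oplus>c\<in>C. f x c) \<oplus> (\<Oplus>c\<in>C. \<Oplus>a\<in>F. f a c) = (\<Oplus>c\<in>C. f x c \<oplus> (\<Oplus>a\<in>F. f a c))"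
    using insert.prems by (intro finsum_addf[symmetric]) (auto intro!: finsum_closed)
  also have "\<dots> = (\<Oplus>c\<in>C. \<Oplus>a\<in>insert x F. f a c)"
    using insert by (intro finsum_cong refl) (auto simp: simp_implies_def intro!: finsum_insert[symmetric])
  finally show ?case .
qed simp

end

section \<open>The subfield \<open>K\<close> and a criterion for its maximality\<close>

context enveloping_quotient
begin

text \<open>Constants are central in \<open>UD\<close>, every element of \<open>D\<close> is a left
  fraction of elements of \<open>UD\<close>, and a centralizer is closed under inverses.\<close>

lemma cst_comm:
  assumes "z \<in> carrier D"
  shows "cst c \<otimes> z = z \<otimes> cst c"
proof -
  have sub: "subring (D.centralizer {cst c}) D" by (rule D.centralizer_subring) simp
  have UD: "u \<in> D.centralizer {cst c}" if "u \<in> UD" for u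
    using that cst_comm_UD[OF that, of c] by (simp add: D.centralizer_def)
  obtain a s where s: "a \<in> UD" "s \<in> UD" "s \<noteq> \<zero>" "s \<otimes> z = a"
    using left_fraction[OF assms] .
  have "z = inv s \<otimes> (s \<otimes> z)" using assms s(2,3) by (simp add: D.m_assoc[symmetric])
  then have z: "z = inv s \<otimes> a" using s(4) by simp
  have "inv s \<in> D.centralizer {cst c}"
    using s by (intro D.centralizer_inv UD) (auto simp: Units_D)
  then have "z \<in> D.centralizer {cst c}"
    unfolding z using subringE(6)[OF sub] UD s by blast
  then show ?thesis by (simp add: D.centralizer_def)
qed

text \<open>With denominators cleared, closure of \<open>K\<close> under the ring operations becomes
  a computation in the commutative ring \<open>S\<close>.\<close>

lemma K_iff: "z \<in> K \<longleftrightarrow> z \<in> carrier D \<and> (\<exists>q\<in>S. q \<noteq> \<zero> \<and> z \<otimes> q \<in> S)"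
proof
  assume "z \<in> K"
  then obtain p q where "p \<in> S" "q \<in> S" "q \<noteq> \<zero>" "z = p \<otimes> inv q" by (auto simp: K_def)
  then show "z \<in> carrier D \<and> (\<exists>q\<in>S. q \<noteq> \<zero> \<and> z \<otimes> q \<in> S)"
    by (auto simp: D.m_assoc intro!: bexI[of _ q])
next
  assume "z \<in> carrier D \<and> (\<exists>q\<in>S. q \<noteq> \<zero> \<and> z \<otimes> q \<in> S)"
  then obtain q where q: "z \<in> carrier D" "q \<in> S" "q \<noteq> \<zero>" "z \<otimes> q \<in> S" by blast
  then have "z = (z \<otimes> q) \<otimes> inv q" by (simp add: D.m_assoc)
  then show "z \<in> K" using q by (auto simp: K_def)
qed

lemma K_closed [simp]: "z \<in> K \<Longrightarrow> z \<in> carrier D"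
  by (simp add: K_iff)

lemma S_K: "s \<in> S \<Longrightarrow> s \<in> K"
  unfolding K_iff using one_neq_zero by (auto intro!: bexI[of _ \<one>])

lemma S_mult_nz: "a \<in> S \<Longrightarrow> b \<in> S \<Longrightarrow> a \<noteq> \<zero> \<Longrightarrow> b \<noteq> \<zero> \<Longrightarrow> a \<otimes> b \<noteq> \<zero>"
  using no_zero_divisors[of a b] by auto

lemma K_subring: "subring K D"
proof (rule D.subringI)
  show "K \<subseteq> carrier D" by auto
  show "\<one> \<in> K" by (simp add: S_K)
  fix a b assume ab: "a \<in> K" "b \<in> K"
  then obtain p q where p: "a \<in> carrier D" "p \<in> S" "p \<noteq> \<zero>" "a \<otimes> p \<in> S"
    and q: "b \<in> carrier D" "q \<in> S" "q \<noteq> \<zero>" "b \<otimes> q \<in> S" by (auto simp: K_iff)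
  have "(\<ominus> a) \<otimes> p \<in> S" using p by (simp add: D.l_minus)
  then show "\<ominus> a \<in> K" using p unfolding K_iff by auto
  have "(a \<oplus> b) \<otimes> (p \<otimes> q) = (a \<otimes> p) \<otimes> q \<oplus> (b \<otimes> q) \<otimes> p"
    using p q S_commute[of p q] by (simp add: D.l_distr D.m_assoc)
  also have "\<dots> \<in> S" using p q by simp
  finally show "a \<oplus> b \<in> K" using p q unfolding K_iff by (auto intro!: bexI[of _ "p \<otimes> q"] simp: S_mult_nz)
  have "(a \<otimes> b) \<otimes> (q \<otimes> p) = a \<otimes> ((b \<otimes> q) \<otimes> p)"
    using p q by (simp add: D.m_assoc)
  also have "\<dots> = (a \<otimes> p) \<otimes> (b \<otimes> q)"
    using p q S_commute[of "b \<otimes> q" p] by (simp add: D.m_assoc)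
  also have "\<dots> \<in> S" using p q by simp
  finally show "a \<otimes> b \<in> K" using p q unfolding K_iff by (auto intro!: bexI[of _ "q \<otimes> p"] simp: S_mult_nz)
qed

lemmas K_mult = subringE(6)[OF K_subring]
  and K_add = subringE(7)[OF K_subring]
  and K_uminus = subringE(5)[OF K_subring]

lemma K_diff: "a \<in> K \<Longrightarrow> b \<in> K \<Longrightarrow> a \<ominus> b \<in> K"
  by (simp add: a_minus_def K_add K_uminus)

lemma K_inv:
  assumes "a \<in> K" "a \<noteq> \<zero>"
  shows "inv a \<in> K"
proof -
  obtain p where p: "a \<in> carrier D" "p \<in> S" "p \<noteq> \<zero>" "a \<otimes> p \<in> S" using assms by (auto simp: K_iff)
  have "inv a \<otimes> (a \<otimes> p) = p" using p assms by (simp add: D.m_assoc[symmetric])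
  moreover have "a \<otimes> p \<noteq> \<zero>" using no_zero_divisors[of a p] p assms by auto
  ultimately show ?thesis unfolding K_iff using p assms by auto
qed

text \<open>The elements commuting with \<open>z\<close> form a ring closed under inverses. It
  contains the constants and \<open>V\<close>, hence \<open>S\<close> and all its fractions.\<close>

lemma centralizer_K:
  assumes z: "z \<in> carrier D" "\<And>v. z \<otimes> Y v = Y v \<otimes> z"
  shows "z \<in> D.centralizer K"
proof -
  have sub: "subring (D.centralizer {z}) D" using z by (intro D.centralizer_subring) simp
  have "S \<subseteq> D.centralizer {z}"
    unfolding S_def
    by (rule D.generate_ring_min_subring1[OF _ sub])
       (use z cst_comm[OF z(1)] in \<open>auto simp: D.centralizer_def\<close>)
  then have "k \<in> D.centralizer {z}" if "k \<in> K" for k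
  proof -
    from that obtain p q where pq: "p \<in> S" "q \<in> S" "q \<noteq> \<zero>" "k = p \<otimes> inv q" by (auto simp: K_def)
    with \<open>S \<subseteq> _\<close> have "p \<in> D.centralizer {z}" "inv q \<in> D.centralizer {z}"
      using z by (auto intro!: D.centralizer_inv simp: Units_D)
    then show ?thesis using subringE(6)[OF sub] pq by simp
  qed
  then show ?thesis using z by (auto simp: D.centralizer_def)
qed

text \<open>\<open>centralizer_K\<close> is applied twice: first to elements of \<open>S\<close>,
  which therefore commute with \<open>K\<close>, then to an arbitrary element of
  \<open>K\<close>.\<close>

lemma K_commute:
  assumes "a \<in> K" "b \<in> K"
  shows "a \<otimes> b = b \<otimes> a"
proof -
  have "a \<in> D.centralizer K" if "a \<in> S" for a
    using that by (intro centralizer_K S_commute) auto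
  then have "Y v \<otimes> a = a \<otimes> Y v" for v
    using assms D.centralizerD[of "Y v" K a] by simp
  then have "a \<in> D.centralizer K" using assms by (intro centralizer_K) auto
  then show ?thesis using assms D.centralizerD by blast
qed

lemma subfield_D:
  assumes "subring T D" "\<And>a b. a \<in> T \<Longrightarrow> b \<in> T \<Longrightarrow> a \<otimes> b = b \<otimes> a"
    and "\<And>a. a \<in> T \<Longrightarrow> a \<noteq> \<zero> \<Longrightarrow> inv a \<in> T"
  shows "subfield T D"
proof (rule D.subfieldI)
  show "subcring T D" by (rule D.subcringI) (use assms in auto)
  have car: "a \<in> carrier D" if "a \<in> T" for a using subringE(1)[OF assms(1)] that by blast
  show "Units (D\<lparr>carrier := T\<rparr>) = T - {\<zero>}"
  proof
    show "Units (D\<lparr>carrier := T\<rparr>) \<subseteq> T - {\<zero>}"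
      using one_neq_zero car by (auto simp: Units_def)
    show "T - {\<zero>} \<subseteq> Units (D\<lparr>carrier := T\<rparr>)"
      using assms(3) car by (auto simp: Units_def intro!: bexI[of _ "inv _"])
  qed
qed

lemma subfield_K: "subfield K D"
  by (rule subfield_D[OF K_subring K_commute K_inv])

text \<open>Provides the subfield that enlarges \<open>K\<close> by a commuting element, without any
  description of its fractions.\<close>

lemma subfield_bicommutant:
  assumes "T \<subseteq> carrier D" "T \<subseteq> D.centralizer T"
  shows "subfield (D.centralizer (D.centralizer T)) D"
proof (rule subfield_D)
  have c: "D.centralizer T \<subseteq> carrier D" by (auto simp: D.centralizer_def)
  show "subring (D.centralizer (D.centralizer T)) D" by (rule D.centralizer_subring[OF c])
  show "a \<otimes> b = b \<otimes> a"
    if "a \<in> D.centralizer (D.centralizer T)" "b \<in> D.centralizer (D.centralizer T)" for a b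
    by (rule D.bicommutant_commute[OF assms(2) that])
  show "inv a \<in> D.centralizer (D.centralizer T)"
    if "a \<in> D.centralizer (D.centralizer T)" "a \<noteq> \<zero>" for a
    using that by (intro D.centralizer_inv c) (auto simp: Units_D D.centralizer_def)
qed

text \<open>The condition says that \<open>K\<close> contains its centralizer. A commuting
  \<open>z\<close> outside \<open>K\<close> would give a larger subfield, the bicommutant of
  \<open>insert z K\<close>; conversely every subfield above \<open>K\<close> commutes with
  \<open>V\<close>.\<close>

lemma maximal_subfield_iff:
  "maximal_subfield K D \<longleftrightarrow> (\<forall>z\<in>carrier D. (\<forall>v. z \<otimes> Y v = Y v \<otimes> z) \<longrightarrow> z \<in> K)"
proof
  assume max: "maximal_subfield K D"
  show "\<forall>z\<in>carrier D. (\<forall>v. z \<otimes> Y v = Y v \<otimes> z) \<longrightarrow> z \<in> K"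
  proof (intro ballI impI)
    fix z assume z: "z \<in> carrier D" "\<forall>v. z \<otimes> Y v = Y v \<otimes> z"
    let ?T = "insert z K"
    have "z \<in> D.centralizer K" using z by (intro centralizer_K) auto
    then have comm: "?T \<subseteq> D.centralizer ?T" and car: "?T \<subseteq> carrier D"
      using z K_commute by (auto simp: D.centralizer_def)
    have "?T \<subseteq> D.centralizer (D.centralizer ?T)"
      using car by (auto simp: D.centralizer_def)
    moreover have "subfield (D.centralizer (D.centralizer ?T)) D"
      by (rule subfield_bicommutant[OF car comm])
    ultimately have "D.centralizer (D.centralizer ?T) = K" "z \<in> D.centralizer (D.centralizer ?T)"
      using max unfolding maximal_subfield_def by blast+
    then show "z \<in> K" by simp
  qed
next
  assume *: "\<forall>z\<in>carrier D. (\<forall>v. z \<otimes> Y v = Y v \<otimes> z) \<longrightarrow> z \<in> K"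
  have "K' = K" if K': "subfield K' D" "K \<subseteq> K'" for K'
  proof
    show "K' \<subseteq> K"
    proof
      fix z assume z: "z \<in> K'"
      have "z \<otimes> Y v = Y v \<otimes> z" for v
        by (rule subfieldE(4)[OF K'(1) z]) (rule subsetD[OF K'(2) S_K[OF Y_S]])
      moreover have "z \<in> carrier D" using subfieldE(3)[OF K'(1)] z by blast
      ultimately show "z \<in> K" using * by blast
    qed
  qed (rule K')
  then show "maximal_subfield K D" using subfield_K by (simp add: maximal_subfield_def)
qed

text \<open>Together with \<open>sigma_inj\<close> this identifies \<open>S\<close> with the
  polynomial functions in the \<open>False\<close> coordinates.\<close>

lemma sigma_surj:
  assumes "P \<in> SV"
  shows "\<exists>s\<in>S. sigma s = P"
  using assms
proof induction
  case (polyfun_const c)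
  then show ?case by (intro bexI[of _ "cst c"]) (auto simp: sigma_cst)
next
  case (polyfun_var i)
  then show ?case by (intro bexI[of _ "Y (snd i)"]) (auto simp: sigma_Y lin_basis)
next
  case (polyfun_add P Q)
  then obtain s t where "s \<in> S" "sigma s = P" "t \<in> S" "sigma t = Q" by blast
  then show ?case by (intro bexI[of _ "s \<oplus> t"]) (auto simp: sigma_add S_UD)
next
  case (polyfun_mult P Q)
  then obtain s t where "s \<in> S" "sigma s = P" "t \<in> S" "sigma t = Q" by blast
  then show ?case by (intro bexI[of _ "s \<otimes> t"]) (auto simp: sigma_mult S_UD)
qed

lemma S_finsum:
  assumes "finite A" "\<And>a. a \<in> A \<Longrightarrow> f a \<in> S"
  shows "(\<Oplus>a\<in>A. f a) \<in> S"
  using assms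
proof (induction A rule: finite_induct)
  case (insert x F)
  then have "f \<in> F \<rightarrow> carrier D" "f x \<in> carrier D" by auto
  then show ?case using insert by simp
qed simp

text \<open>A relation with coefficients \<open>P b\<close> produces an element \<open>?z\<close> of
  order one that commutes with \<open>V\<close>. By maximality it is a fraction from
  \<open>S\<close>, and after clearing its denominator \<open>X_independent\<close> makes all
  coefficients vanish.\<close>

lemma maximal_imp_faithful:
  assumes "maximal_subfield K D"
  shows generic_action_faithful
  unfolding generic_action_faithful_def
proof (intro allI impI)
  fix P assume P: "\<forall>b\<in>B. P b \<in> SV" and rel: "\<forall>v\<in>B. \<forall>q. (\<Sum>b\<in>B. P b q * lin False (b * v) q) = 0"
  have "\<forall>b\<in>B. \<exists>s. s \<in> S \<and> sigma s = P b" using P sigma_surj by blast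
  from bchoice[OF this] obtain p where p: "\<And>b. b \<in> B \<Longrightarrow> p b \<in> S" "\<And>b. b \<in> B \<Longrightarrow> sigma (p b) = P b"
    by blast
  let ?z = "\<Oplus>b\<in>B. p b \<otimes> X b"
  have pX: "(\<lambda>b. p b \<otimes> X b) \<in> B \<rightarrow> carrier D" using p by auto
  have z: "?z \<in> carrier D" by (rule D.finsum_closed[OF pX])
  have "?z \<otimes> Y v = Y v \<otimes> ?z" for v
  proof -
    have "?z \<otimes> Y v = (\<Oplus>b\<in>B. p b \<otimes> X b \<otimes> Y v)"
      by (rule D.finsum_ldistr) (use finite_Basis pX in auto)
    also have "\<dots> = (\<Oplus>b\<in>B. Y v \<otimes> (p b \<otimes> X b) \<oplus> p b \<otimes> Y (b * v))"
    proof (rule D.finsum_cong')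
      show "p b \<otimes> X b \<otimes> Y v = Y v \<otimes> (p b \<otimes> X b) \<oplus> p b \<otimes> Y (b * v)" if "b \<in> B" for b
        using p(1)[OF that] S_commute[of "p b" "Y v"]
        by (simp add: D.m_assoc X_Y D.r_distr) (simp add: D.m_assoc[symmetric])
    qed (use p in auto)
    also have "\<dots> = (\<Oplus>b\<in>B. Y v \<otimes> (p b \<otimes> X b)) \<oplus> (\<Oplus>b\<in>B. p b \<otimes> Y (b * v))"
      by (rule D.finsum_addf) (use p in auto)
    also have "(\<Oplus>b\<in>B. Y v \<otimes> (p b \<otimes> X b)) = Y v \<otimes> ?z"
      by (rule D.finsum_rdistr[symmetric]) (use finite_Basis pX in auto)
    \<comment> \<open>This is the commutator of \<open>?z\<close> with \<open>Y v\<close>; its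
      polynomial function is the given relation, with \<open>v\<close> expanded in the
      basis.\<close>
    also have "(\<Oplus>b\<in>B. p b \<otimes> Y (b * v)) = \<zero>"
    proof (rule sigma_inj)
      show "(\<Oplus>b\<in>B. p b \<otimes> Y (b * v)) \<in> S" by (rule S_finsum[OF finite_Basis]) (use p in auto)
      fix q
      have "sigma (\<Oplus>b\<in>B. p b \<otimes> Y (b * v)) q = (\<Sum>b\<in>B. sigma (p b \<otimes> Y (b * v)) q)"
        by (rule sigma_finsum[OF finite_Basis]) (use p in \<open>auto intro!: S_UD\<close>)
      also have "\<dots> = (\<Sum>b\<in>B. P b q * (\<Sum>c\<in>B. crd v c * lin False (b * c) q))"
        using p by (intro sum.cong refl) (simp add: sigma_mult Y_UD sigma_Y lin_mult[of _ _ v])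
      also have "\<dots> = (\<Sum>c\<in>B. crd v c * (\<Sum>b\<in>B. P b q * lin False (b * c) q))"
        by (simp add: sum_distrib_left mult.left_commute) (rule sum.swap)
      finally show "sigma (\<Oplus>b\<in>B. p b \<otimes> Y (b * v)) q = 0" using rel by simp
    qed
    finally show ?thesis using z by simp
  qed
  then have "?z \<in> K" using assms z by (simp add: maximal_subfield_iff)
  then obtain q where q: "q \<in> S" "q \<noteq> \<zero>" "?z \<otimes> q \<in> S" by (auto simp: K_iff)
  \<comment> \<open>The denominator has to stand on the left, where it multiplies the
    coefficients.\<close>
  have "?z \<otimes> q = q \<otimes> ?z" using K_commute[OF \<open>?z \<in> K\<close> S_K[OF q(1)]] .
  also have "\<dots> = (\<Oplus>b\<in>B. q \<otimes> (p b \<otimes> X b))"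
    by (rule D.finsum_rdistr) (use finite_Basis pX q in auto)
  also have "\<dots> = (\<Oplus>b\<in>B. (q \<otimes> p b) \<otimes> X b)"
    by (rule D.finsum_cong') (use p q in \<open>auto simp: D.m_assoc\<close>)
  finally have S: "(\<Oplus>b\<in>B. (q \<otimes> p b) \<otimes> X b) \<in> S" using q by simp
  show "\<forall>b\<in>B. \<forall>q. P b q = 0"
  proof
    fix b assume b: "b \<in> B"
    have "q \<otimes> p b = \<zero>"
      by (rule X_independent[OF _ S b]) (use p q in auto)
    then have "p b = \<zero>" using no_zero_divisors[of q "p b"] p(1)[OF b] q by simp
    then show "\<forall>q. P b q = 0" using p(2)[OF b] sigma_zero by simp
  qed
qed

lemma com_X_X: "D.com (X x) (X y) = X (x * y - y * x)"
  by (rule D.com_eqI) (simp_all add: X_X[of x y])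

lemma com_X_Y: "D.com (X x) (Y v) = Y (x * v)"
  by (rule D.com_eqI) (simp_all add: X_Y)

section \<open>The order filtration\<close>

lemma com_X_S:
  assumes "s \<in> S"
  shows "D.com (X x) s \<in> S"
  using assms unfolding S_def
proof induction
  case (incl h)
  then show ?case
  proof
    assume "h \<in> range cst"
    then have "D.com (X x) h = \<zero>" using cst_comm by (auto simp: D.com_eq_zero_iff)
    then show ?thesis using S_zero by (simp add: S_def)
  next
    assume "h \<in> range Y"
    then obtain v where h: "h = Y v" by blast
    then show ?thesis by (simp add: com_X_Y generate_ring.incl)
  qed
next
  case one
  have "D.com (X x) \<one> = \<zero>" by (simp add: D.com_eq_zero_iff)
  then show ?case using S_zero by (simp add: S_def)
next
  case (a_inv h)
  then have "h \<in> carrier D" using S_closed by (simp add: S_def)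
  then show ?case using a_inv by (simp add: D.com_uminus_right generate_ring.a_inv)
next
  case (eng_add h h')
  then have "h \<in> carrier D" "h' \<in> carrier D" using S_closed by (simp_all add: S_def)
  then show ?case using eng_add by (simp add: D.com_add_right generate_ring.eng_add)
next
  case (eng_mult h h')
  then have "h \<in> carrier D" "h' \<in> carrier D" using S_closed by (simp_all add: S_def)
  then show ?case using eng_mult
    by (simp add: D.com_mult_right generate_ring.eng_add generate_ring.eng_mult)
qed

text \<open>The quotient rule: the derivation property for \<open>k \<otimes> q\<close> expresses
  the commutator with \<open>k\<close> through \<open>k\<close> and commutators with elements of
  \<open>S\<close>.\<close>

lemma com_X_K:
  assumes "k \<in> K"
  shows "D.com (X x) k \<in> K"
proof -
  obtain q where q: "q \<in> S" "q \<noteq> \<zero>" "k \<otimes> q \<in> S" using assms by (auto simp: K_iff)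
  have kc: "k \<in> carrier D" using assms by simp
  have "D.com (X x) (k \<otimes> q) = D.com (X x) k \<otimes> q \<oplus> k \<otimes> D.com (X x) q"
    using q kc by (simp add: D.com_mult_right)
  then have "D.com (X x) k \<otimes> q = D.com (X x) (k \<otimes> q) \<ominus> k \<otimes> D.com (X x) q"
    using q kc by (simp add: D.minus_eq D.a_assoc D.r_neg)
  also have "\<dots> \<in> K"
    using q assms com_X_S S_K by (intro K_diff K_mult) auto
  finally have "(D.com (X x) k \<otimes> q) \<otimes> inv q \<in> K"
    by (rule K_mult[OF _ K_inv[OF S_K[OF q(1)] q(2)]])
  then show ?thesis using q kc by (simp add: D.m_assoc)
qed

text \<open>The filtration by the order in the \<open>X x\<close> of the left \<open>K\<close>-span of \<open>U(L)\<close>.\<close>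

inductive filt :: "nat \<Rightarrow> 'd \<Rightarrow> bool" where
  filt_K: "z \<in> K \<Longrightarrow> filt m z"
| filt_X: "filt m z \<Longrightarrow> filt (Suc m) (z \<otimes> X x)"
| filt_add: "filt m z \<Longrightarrow> filt m w \<Longrightarrow> filt m (z \<oplus> w)"

lemma filt_closed [simp]: "filt m z \<Longrightarrow> z \<in> carrier D"
  by (induction rule: filt.induct) auto

lemma filt_zero [simp]: "filt m \<zero>"
  by (intro filt_K S_K S_zero)

lemma filt_Suc: "filt m z \<Longrightarrow> filt (Suc m) z"
  by (induction rule: filt.induct) (auto intro: filt.intros)

lemma filt_mono: "filt m z \<Longrightarrow> m \<le> n \<Longrightarrow> filt n z"
  by (induction n) (auto simp: le_Suc_eq filt_Suc)

lemma filt_0: "filt 0 z \<longleftrightarrow> z \<in> K"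
proof
  show "z \<in> K" if "filt 0 z"
    using that by (induction "0::nat" z rule: filt.induct) (auto simp: K_add)
qed (rule filt_K)

lemma filt_K_left: "filt m z \<Longrightarrow> k \<in> K \<Longrightarrow> filt m (k \<otimes> z)"
proof (induction rule: filt.induct)
  case (filt_K z m)
  then show ?case by (intro filt.filt_K K_mult)
next
  case (filt_X m z x)
  then have "k \<otimes> (z \<otimes> X x) = (k \<otimes> z) \<otimes> X x" by (simp add: D.m_assoc)
  then show ?case using filt.filt_X[OF filt_X.IH[OF filt_X.prems]] by simp
next
  case (filt_add m z w)
  then have "k \<otimes> (z \<oplus> w) = k \<otimes> z \<oplus> k \<otimes> w" by (simp add: D.r_distr)
  then show ?case using filt_add by (simp add: filt.filt_add)
qed

lemma filt_uminus: "filt m z \<Longrightarrow> filt m (\<ominus> z)"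
  using filt_K_left[OF _ S_K[OF cst_S]] by (simp add: uminus_eq)

text \<open>Moving \<open>k\<close> to the left past \<open>X x\<close> costs a commutator lying in
  \<open>K\<close>, that is, a term of smaller order.\<close>

lemma filt_K_right: "filt m z \<Longrightarrow> k \<in> K \<Longrightarrow> filt m (z \<otimes> k)"
proof (induction arbitrary: k rule: filt.induct)
  case (filt_K z m)
  then show ?case by (intro filt.filt_K K_mult)
next
  case (filt_X m z x)
  then have c: "z \<in> carrier D" "k \<in> carrier D" by simp_all
  have "(z \<otimes> X x) \<otimes> k = (z \<otimes> k) \<otimes> X x \<oplus> z \<otimes> D.com (X x) k"
    using c D.mult_eq_com[of "X x" k] by (simp add: D.m_assoc D.r_distr)
  moreover have "filt (Suc m) ((z \<otimes> k) \<otimes> X x)"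
    by (rule filt.filt_X[OF filt_X.IH[OF filt_X.prems]])
  moreover have "filt (Suc m) (z \<otimes> D.com (X x) k)"
    by (rule filt_Suc[OF filt_X.IH[OF com_X_K[OF filt_X.prems]]])
  ultimately show ?case by (simp add: filt.filt_add)
next
  case (filt_add m z w)
  then have "(z \<oplus> w) \<otimes> k = z \<otimes> k \<oplus> w \<otimes> k" by (simp add: D.l_distr)
  then show ?case using filt_add by (simp add: filt.filt_add)
qed

lemma filt_mult:
  assumes z: "filt m z"
  shows "filt n w \<Longrightarrow> filt (m + n) (z \<otimes> w)"
proof (induction rule: filt.induct)
  case (filt_K w n)
  then show ?case using filt_mono[OF filt_K_right[OF z], of w "m + n"] by simp
next
  case (filt_X n w x)
  then have "z \<otimes> (w \<otimes> X x) = (z \<otimes> w) \<otimes> X x" using z by (simp add: D.m_assoc)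
  then show ?case using filt.filt_X[OF filt_X.IH] by simp
next
  case (filt_add n w w')
  then have "z \<otimes> (w \<oplus> w') = z \<otimes> w \<oplus> z \<otimes> w'" using z by (simp add: D.r_distr)
  then show ?case using filt_add by (simp add: filt.filt_add)
qed

lemma filt_X_1: "filt 1 (X x)"
  using filt_X[OF filt_K[OF S_K[OF S_one]], of 0 x] by simp

text \<open>Commutators of the \<open>X x\<close> are again of this form and commutators with
  \<open>K\<close> stay in \<open>K\<close>, so the order does not grow.\<close>

lemma filt_com_X: "filt m z \<Longrightarrow> filt m (D.com z (X x))"
proof (induction rule: filt.induct)
  case (filt_K z m)
  then have "D.com z (X x) = \<ominus> D.com (X x) z" by (intro D.com_swap) auto
  then show ?case using com_X_K[OF filt_K] by (simp add: filt.filt_K K_uminus)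
next
  case (filt_X m z y)
  then have "D.com (z \<otimes> X y) (X x) = z \<otimes> X (y * x - x * y) \<oplus> D.com z (X x) \<otimes> X y"
    by (simp add: D.com_mult_left com_X_X)
  then show ?case using filt_X by (simp add: filt.filt_add filt.filt_X)
next
  case (filt_add m z w)
  then show ?case by (simp add: D.com_add_left filt.filt_add)
qed

text \<open>The commutator replaces one factor \<open>X x\<close> by an element of \<open>S\<close>
  and thus lowers the order. Since \<open>0 - 1 = 0\<close> for natural numbers, order 0 has its own
  conjunct.\<close>

lemma filt_com_Y:
  "filt m z \<Longrightarrow> filt (m - 1) (D.com z (Y v)) \<and> (m = 0 \<longrightarrow> D.com z (Y v) = \<zero>)"
proof (induction rule: filt.induct)
  case (filt_K z m)
  then have "D.com z (Y v) = \<zero>" using K_commute[OF filt_K S_K[OF Y_S]] by (simp add: D.com_eq_zero_iff)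
  then show ?case by simp
next
  case (filt_X m z x)
  then have zc: "z \<in> carrier D" by simp
  have "D.com (z \<otimes> X x) (Y v) = z \<otimes> Y (x * v) \<oplus> D.com z (Y v) \<otimes> X x"
    using zc by (simp add: D.com_mult_left com_X_Y)
  moreover have "filt m (z \<otimes> Y (x * v))" by (rule filt_K_right[OF filt_X.hyps S_K[OF Y_S]])
  moreover have "filt m (D.com z (Y v) \<otimes> X x)"
    using filt_X.IH by (cases m) (auto intro: filt.filt_X)
  ultimately show ?case by (simp add: filt.filt_add)
next
  case (filt_add m z w)
  then show ?case by (simp add: D.com_add_left filt.filt_add)
qed

lemma filt_finsum:
  assumes "finite A" "\<And>a. a \<in> A \<Longrightarrow> filt m (f a)"
  shows "filt m (\<Oplus>a\<in>A. f a)"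
  using assms
proof (induction A rule: finite_induct)
  case (insert x F)
  have "f a \<in> carrier D" if "a \<in> insert x F" for a
    using insert.prems[OF that] by (rule filt_closed)
  then have "f \<in> F \<rightarrow> carrier D" "f x \<in> carrier D" by auto
  then show ?case using insert by (simp add: filt_add)
qed simp

lemma UD_filt:
  assumes "z \<in> UD"
  shows "\<exists>m. filt m z"
  using assms unfolding UD_generated
proof induction
  case one
  show ?case using filt_K S_K S_one by blast
next
  case (incl h)
  then show ?case using filt_K S_K cst_S Y_S filt_X_1 by blast
next
  case (a_inv h)
  then show ?case using filt_uminus by blast
next
  case (eng_add h h')
  then obtain m n where "filt m h" "filt n h'" by blast
  then have "filt (max m n) h" "filt (max m n) h'" by (auto intro: filt_mono)
  then show ?case using filt_add by blast
next
  case (eng_mult h h')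
  then show ?case using filt_mult by blast
qed

text \<open>The \<open>d l\<close> act on \<open>K\<close> as the partial derivatives dual to the basis of \<open>V\<close>, so
  \<open>euler z\<close> counts the order of \<open>z\<close> up to terms of smaller order.\<close>

context
  fixes d :: "'a \<Rightarrow> 'd"
  assumes d_filt: "\<And>l. l \<in> B \<Longrightarrow> filt 1 (d l)"
    and d_X: "\<And>x. (\<Oplus>l\<in>B. Y (x * l) \<otimes> d l) = X x"
begin

lemma d_closed [simp]: "l \<in> B \<Longrightarrow> d l \<in> carrier D"
  using d_filt filt_closed by blast

definition euler :: "'d \<Rightarrow> 'd" where
  "euler z = (\<Oplus>l\<in>B. D.com z (Y l) \<otimes> d l)"

lemma euler_closed: "z \<in> carrier D \<Longrightarrow> euler z \<in> carrier D"
  unfolding euler_def by (intro D.finsum_closed) auto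

lemma euler_add:
  assumes "z \<in> carrier D" "w \<in> carrier D"
  shows "euler (z \<oplus> w) = euler z \<oplus> euler w"
proof -
  have "euler (z \<oplus> w) = (\<Oplus>l\<in>B. D.com z (Y l) \<otimes> d l \<oplus> D.com w (Y l) \<otimes> d l)"
    unfolding euler_def using assms
    by (intro D.finsum_cong') (auto simp: D.com_add_left D.l_distr)
  also have "\<dots> = euler z \<oplus> euler w"
    unfolding euler_def using assms by (intro D.finsum_addf) auto
  finally show ?thesis .
qed

lemma euler_zero:
  assumes "z \<in> carrier D" "\<And>v. D.com z (Y v) = \<zero>"
  shows "euler z = \<zero>"
proof -
  have "euler z = (\<Oplus>l\<in>B. \<zero>)"
    unfolding euler_def using assms by (intro D.finsum_cong') auto
  then show ?thesis by simp
qed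

text \<open>By \<open>d_X\<close> the commutators of \<open>X x\<close> with the \<open>Y l\<close>
  reassemble \<open>z \<otimes> X x\<close>: one more factor raises the eigenvalue by one. The last
  sum comes from moving \<open>X x\<close> past \<open>d l\<close>.\<close>

lemma euler_mult_X:
  assumes z: "z \<in> carrier D"
  shows "euler (z \<otimes> X x) = z \<otimes> X x \<oplus> euler z \<otimes> X x \<oplus> (\<Oplus>l\<in>B. D.com z (Y l) \<otimes> D.com (X x) (d l))"
proof -
  have "euler (z \<otimes> X x) = (\<Oplus>l\<in>B. z \<otimes> (Y (x * l) \<otimes> d l) \<oplus>
      (D.com z (Y l) \<otimes> d l \<otimes> X x \<oplus> D.com z (Y l) \<otimes> D.com (X x) (d l)))"
    unfolding euler_def
  proof (rule D.finsum_cong')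
    fix l assume l: "l \<in> B"
    have "D.com (z \<otimes> X x) (Y l) \<otimes> d l = z \<otimes> (Y (x * l) \<otimes> d l) \<oplus> D.com z (Y l) \<otimes> (X x \<otimes> d l)"
      using z l by (simp add: D.com_mult_left com_X_Y D.l_distr D.m_assoc)
    also have "X x \<otimes> d l = d l \<otimes> X x \<oplus> D.com (X x) (d l)"
      using l by (intro D.mult_eq_com) auto
    finally show "D.com (z \<otimes> X x) (Y l) \<otimes> d l = z \<otimes> (Y (x * l) \<otimes> d l) \<oplus>
        (D.com z (Y l) \<otimes> d l \<otimes> X x \<oplus> D.com z (Y l) \<otimes> D.com (X x) (d l))"
      using z l by (simp add: D.r_distr D.m_assoc)
  qed (use z in auto)
  also have "\<dots> = (\<Oplus>l\<in>B. z \<otimes> (Y (x * l) \<otimes> d l)) \<oplus>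
      ((\<Oplus>l\<in>B. D.com z (Y l) \<otimes> d l \<otimes> X x) \<oplus> (\<Oplus>l\<in>B. D.com z (Y l) \<otimes> D.com (X x) (d l)))"
    using z by (subst D.finsum_addf; (subst D.finsum_addf)?) auto
  also have "(\<Oplus>l\<in>B. z \<otimes> (Y (x * l) \<otimes> d l)) = z \<otimes> X x"
    unfolding d_X[of x, symmetric] using z finite_Basis by (intro D.finsum_rdistr[symmetric]) auto
  also have "(\<Oplus>l\<in>B. D.com z (Y l) \<otimes> d l \<otimes> X x) = euler z \<otimes> X x"
    unfolding euler_def using z finite_Basis by (intro D.finsum_ldistr[symmetric]) auto
  finally show ?thesis
    using z euler_closed[OF z] by (subst D.a_assoc) (auto intro!: D.finsum_closed)
qed

text \<open>On the part of order \<open>m\<close> modulo smaller order, \<open>euler\<close> is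
  multiplication by \<open>m\<close>. The second conjunct again covers order 0, where the truncated
  subtraction says too little.\<close>

lemma filt_euler:
  "filt m z \<Longrightarrow> filt (m - 1) (euler z \<ominus> cst (of_nat m) \<otimes> z) \<and> (m = 0 \<longrightarrow> euler z = \<zero>)"
proof (induction rule: filt.induct)
  case (filt_K z m)
  have zc: "z \<in> carrier D" using filt_K by simp
  have "euler z = \<zero>"
    using K_commute[OF filt_K S_K[OF Y_S]] zc by (intro euler_zero) (simp_all add: D.com_eq_zero_iff)
  moreover have "\<zero> \<ominus> cst (of_nat m) \<otimes> z \<in> K"
    using filt_K S_K[OF cst_S] S_K[OF S_zero] by (intro K_diff K_mult)
  ultimately show ?case by (auto intro: filt.filt_K)
next
  case (filt_X m z x)
  have zc: "z \<in> carrier D" using filt_X.hyps by simp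
  note ec = euler_closed[OF zc]
  let ?r = "\<Oplus>l\<in>B. D.com z (Y l) \<otimes> D.com (X x) (d l)"
  \<comment> \<open>The first factor has lost one order and the second has order one, so the
    remainder stays one order below that of \<open>z \<otimes> X x\<close>.\<close>
  have "filt m (D.com z (Y l) \<otimes> D.com (X x) (d l))" if l: "l \<in> B" for l
  proof (cases m)
    case 0
    then have "D.com z (Y l) = \<zero>" using filt_com_Y[OF filt_X.hyps] by blast
    then show ?thesis using l by simp
  next
    case (Suc n)
    then have "filt n (D.com z (Y l))" using filt_com_Y[OF filt_X.hyps, of l] by simp
    moreover have "filt 1 (D.com (X x) (d l))"
      using filt_uminus[OF filt_com_X[OF d_filt[OF l], of x]] l D.com_swap[of "X x" "d l"] by simp
    ultimately show ?thesis using filt_mult[of n _ 1] Suc by simp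
  qed
  then have r: "filt m ?r" by (rule filt_finsum[OF finite_Basis])
  have e: "filt m ((euler z \<ominus> cst (of_nat m) \<otimes> z) \<otimes> X x)"
  proof (cases m)
    case 0
    then show ?thesis using filt_X.IH zc by (simp add: cst_zero D.minus_eq)
  next
    case (Suc n)
    then show ?thesis using filt_X.IH by (auto intro: filt.filt_X)
  qed
  have c: "cst (of_nat (Suc m)) \<otimes> (z \<otimes> X x) = z \<otimes> X x \<oplus> cst (of_nat m) \<otimes> z \<otimes> X x"
    using zc by (simp add: cst_add cst_one D.l_distr D.m_assoc)
  have "euler (z \<otimes> X x) \<ominus> cst (of_nat (Suc m)) \<otimes> (z \<otimes> X x)
      = (euler z \<ominus> cst (of_nat m) \<otimes> z) \<otimes> X x \<oplus> ?r"
    unfolding euler_mult_X[OF zc] c using zc ec filt_closed[OF r] by (intro D.add_mult_diff_regroup) auto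
  then show ?case using filt_add[OF e r] by simp
next
  case (filt_add m z w)
  have c: "z \<in> carrier D" "w \<in> carrier D" using filt_add by simp_all
  note ec = euler_closed[OF c(1)] euler_closed[OF c(2)]
  have "euler (z \<oplus> w) \<ominus> cst (of_nat m) \<otimes> (z \<oplus> w)
      = (euler z \<ominus> cst (of_nat m) \<otimes> z) \<oplus> (euler w \<ominus> cst (of_nat m) \<otimes> w)"
    unfolding euler_add[OF c] using c ec by (intro D.add_diff_mult_regroup) auto
  then show ?case using filt_add c by (simp add: euler_add filt.filt_add)
qed

text \<open>Here \<open>euler z\<close> vanishes, so a positive order times \<open>z\<close> has
  smaller order. Dividing by that integer, possible in characteristic zero, brings \<open>z\<close>
  down to order 0.\<close>

lemma filt_centralizer:
  assumes "filt m z" "\<And>v. D.com z (Y v) = \<zero>"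
  shows "z \<in> K"
  using assms(1)
proof (induction m)
  case 0
  then show ?case by (simp add: filt_0)
next
  case (Suc m)
  have zc: "z \<in> carrier D" using Suc.prems by simp
  have "euler z = \<zero>" by (rule euler_zero[OF zc assms(2)])
  then have "filt m (\<zero> \<ominus> cst (of_nat (Suc m)) \<otimes> z)"
    using filt_euler[OF Suc.prems] by (simp only: diff_Suc_1)
  then have "filt m (cst (- 1 / of_nat (Suc m)) \<otimes> (\<zero> \<ominus> cst (of_nat (Suc m)) \<otimes> z))"
    by (rule filt_K_left) (simp add: S_K)
  also have "cst (- 1 / of_nat (Suc m)) \<otimes> (\<zero> \<ominus> cst (of_nat (Suc m)) \<otimes> z) = z"
  proof -
    have "\<zero> \<ominus> cst (of_nat (Suc m)) \<otimes> z = cst (- of_nat (Suc m)) \<otimes> z"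
      using zc cst_mult[of "-1" "of_nat (Suc m)"]
      by (simp only: D.minus_eq D.l_zero D.a_inv_closed D.m_closed cst_closed uminus_eq D.m_assoc[symmetric])
         (simp only: mult_minus1)
    moreover have "cst (- 1 / of_nat (Suc m)) \<otimes> cst (- of_nat (Suc m)) = \<one>"
      unfolding cst_mult[symmetric] by (simp add: cst_one del: of_nat_Suc)
    ultimately show ?thesis using zc by (simp add: D.m_assoc[symmetric])
  qed
  finally show ?case by (rule Suc.IH)
qed

text \<open>For a fraction \<open>z = inv s \<otimes> a\<close> that commutes with \<open>V\<close> the pair \<open>(s, a)\<close> may be replaced by
  \<open>([s, v], [a, v])\<close>, which lowers the order of \<open>s\<close> until \<open>s\<close> itself commutes with \<open>V\<close>.\<close>

lemma centralizer_V:
  assumes z: "z \<in> carrier D" "\<And>v. D.com z (Y v) = \<zero>"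
    and s: "filt m s" "s \<noteq> \<zero>" "filt n (s \<otimes> z)"
  shows "z \<in> K"
  using s
proof (induction m arbitrary: s n)
  case 0
  then have s: "s \<in> K" by (simp add: filt_0)
  have "filt n (inv s \<otimes> (s \<otimes> z))"
    by (rule filt_K_left[OF 0(3) K_inv[OF s 0(2)]])
  also have "inv s \<otimes> (s \<otimes> z) = z" using s 0(2) z by (simp add: D.m_assoc[symmetric])
  finally show ?case using filt_centralizer z by blast
next
  case (Suc m)
  have sc: "s \<in> carrier D" using Suc.prems by simp
  show ?case
  proof (cases "\<forall>v. D.com s (Y v) = \<zero>")
    case True
    \<comment> \<open>Now \<open>s\<close> commutes with \<open>V\<close> and so lies in
      \<open>K\<close>; the induction hypothesis applies to the same \<open>s\<close>.\<close>
    then have "filt 0 s" using filt_centralizer[OF Suc.prems(1)] filt_K by blast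
    then show ?thesis using Suc.IH[OF filt_mono[of 0 s m]] Suc.prems by simp
  next
    case False
    then obtain v where v: "D.com s (Y v) \<noteq> \<zero>" by blast
    have "D.com s (Y v) \<otimes> z = D.com (s \<otimes> z) (Y v)"
      using sc z by (simp add: D.com_mult_left)
    moreover have "filt (n - 1) (D.com (s \<otimes> z) (Y v))" using filt_com_Y[OF Suc.prems(3)] by blast
    moreover have "filt m (D.com s (Y v))" using filt_com_Y[OF Suc.prems(1), of v] by simp
    ultimately show ?thesis using Suc.IH[OF _ v] by simp
  qed
qed

lemma maximal_subfield_K: "maximal_subfield K D"
  unfolding maximal_subfield_iff
proof (intro ballI impI)
  fix z assume z: "z \<in> carrier D" "\<forall>v. z \<otimes> Y v = Y v \<otimes> z"
  obtain a s where "a \<in> UD" "s \<in> UD" "s \<noteq> \<zero>" "s \<otimes> z = a" using left_fraction[OF z(1)] .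
  moreover from this obtain m n where "filt m s" "filt n (s \<otimes> z)" using UD_filt by blast
  ultimately show "z \<in> K" using z by (intro centralizer_V[of z]) (auto simp: D.com_eq_zero_iff)
qed

end

section \<open>From the dual system to maximality of \<open>K\<close>\<close>

lemma X_sum: "finite A \<Longrightarrow> X (\<Sum>a\<in>A. f a) = (\<Oplus>a\<in>A. X (f a))"
  by (induction A rule: finite_induct) (simp_all add: X_zero X_add)

lemma faithful_imp_maximal:
  assumes generic_action_faithful
  shows "maximal_subfield K D"
proof -
  obtain P Q where PQ: "\<And>l b. l \<in> B \<Longrightarrow> b \<in> B \<Longrightarrow> P l b \<in> SV" "Q \<in> SV" "\<exists>q. Q q \<noteq> 0"
    and dual: "\<And>x b q. b \<in> B \<Longrightarrow> (\<Sum>l\<in>B. lin False (x * l) q * P l b q) = crd x b * Q q"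
    by (rule faithful_imp_dual_system[OF assms]) blast
  have "\<forall>l\<in>B. \<forall>b\<in>B. \<exists>s. s \<in> S \<and> sigma s = P l b" using PQ(1) sigma_surj by blast
  then obtain p where p: "\<And>l b. l \<in> B \<Longrightarrow> b \<in> B \<Longrightarrow> p l b \<in> S"
    "\<And>l b. l \<in> B \<Longrightarrow> b \<in> B \<Longrightarrow> sigma (p l b) = P l b" by metis
  obtain k where k: "k \<in> S" "sigma k = Q" using sigma_surj[OF PQ(2)] by blast
  have k0: "k \<noteq> \<zero>" using PQ(3) k sigma_zero by auto
  \<comment> \<open>Row \<open>l\<close> of the inverse matrix over \<open>K\<close>, applied to the
    \<open>X b\<close>; the second identity of the dual system will give the condition
    \<open>d_X\<close>.\<close>
  define d where "d l = inv k \<otimes> (\<Oplus>b\<in>B. p l b \<otimes> X b)" for l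
  show ?thesis
  proof (rule maximal_subfield_K[of d])
    show "filt 1 (d l)" if l: "l \<in> B" for l
      unfolding d_def
    proof (rule filt_K_left, rule filt_finsum[OF finite_Basis])
      show "filt 1 (p l b \<otimes> X b)" if "b \<in> B" for b
        by (rule filt_K_left[OF filt_X_1 S_K[OF p(1)[OF l that]]])
      show "inv k \<in> K" by (rule K_inv[OF S_K[OF k(1)] k0])
    qed
    fix x
    \<comment> \<open>The identity \<open>dual\<close> read in \<open>S\<close>, where
      \<open>sigma\<close> is injective.\<close>
    have rel: "(\<Oplus>l\<in>B. Y (x * l) \<otimes> p l b) = k \<otimes> cst (crd x b)" if b: "b \<in> B" for b
    proof -
      let ?s = "\<Oplus>l\<in>B. Y (x * l) \<otimes> p l b"
      have s: "?s \<in> S" by (rule S_finsum[OF finite_Basis]) (use p b in auto)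
      have "sigma (?s \<ominus> k \<otimes> cst (crd x b)) q = 0" for q
      proof -
        have "sigma ?s q = (\<Sum>l\<in>B. sigma (Y (x * l) \<otimes> p l b) q)"
          by (rule sigma_finsum[OF finite_Basis]) (use p b in \<open>auto intro!: S_UD\<close>)
        also have "\<dots> = crd x b * Q q"
          using dual[OF b] p b by (simp add: sigma_mult S_UD sigma_Y)
        finally have "sigma ?s q = crd x b * Q q" .
        moreover have "sigma (\<ominus> (k \<otimes> cst (crd x b))) q = - (crd x b * Q q)"
          using k by (simp add: uminus_eq sigma_mult S_UD sigma_cst)
        ultimately show ?thesis using k s by (simp add: D.minus_eq sigma_add S_UD)
      qed
      then have "?s \<ominus> k \<otimes> cst (crd x b) = \<zero>"
        using s k by (intro sigma_inj) (simp_all add: D.minus_eq)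
      then show ?thesis using s k by simp
    qed
    \<comment> \<open>Exchanging the two sums makes \<open>rel\<close> applicable; \<open>k\<close>
      then cancels and the coordinates of \<open>x\<close> reassemble \<open>X x\<close>.\<close>
    have "(\<Oplus>l\<in>B. Y (x * l) \<otimes> d l) = (\<Oplus>l\<in>B. inv k \<otimes> (\<Oplus>b\<in>B. Y (x * l) \<otimes> p l b \<otimes> X b))"
    proof (rule D.finsum_cong')
      fix l assume l: "l \<in> B"
      have pX: "(\<lambda>b. p l b \<otimes> X b) \<in> B \<rightarrow> carrier D" using p l by auto
      have "Y (x * l) \<otimes> d l = inv k \<otimes> (Y (x * l) \<otimes> (\<Oplus>b\<in>B. p l b \<otimes> X b))"
        using K_commute[OF S_K[OF Y_S] K_inv[OF S_K[OF k(1)] k0]] k k0 D.finsum_closed[OF pX]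
        by (simp add: d_def D.m_assoc[symmetric])
      also have "Y (x * l) \<otimes> (\<Oplus>b\<in>B. p l b \<otimes> X b) = (\<Oplus>b\<in>B. Y (x * l) \<otimes> (p l b \<otimes> X b))"
        by (rule D.finsum_rdistr[OF finite_Basis _ pX]) simp
      also have "\<dots> = (\<Oplus>b\<in>B. Y (x * l) \<otimes> p l b \<otimes> X b)"
        by (rule D.finsum_cong') (use p l in \<open>auto simp: D.m_assoc\<close>)
      finally show "Y (x * l) \<otimes> d l = inv k \<otimes> (\<Oplus>b\<in>B. Y (x * l) \<otimes> p l b \<otimes> X b)" .
    qed (use p k k0 in \<open>auto intro!: D.finsum_closed\<close>)
    also have "\<dots> = inv k \<otimes> (\<Oplus>l\<in>B. \<Oplus>b\<in>B. Y (x * l) \<otimes> p l b \<otimes> X b)"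
      by (rule D.finsum_rdistr[symmetric, OF finite_Basis]) (use p k k0 in \<open>auto intro!: D.finsum_closed\<close>)
    also have "(\<Oplus>l\<in>B. \<Oplus>b\<in>B. Y (x * l) \<otimes> p l b \<otimes> X b) = (\<Oplus>b\<in>B. \<Oplus>l\<in>B. Y (x * l) \<otimes> p l b \<otimes> X b)"
      by (rule D.finsum_swap[OF finite_Basis finite_Basis]) (use p in auto)
    also have "\<dots> = (\<Oplus>b\<in>B. k \<otimes> X (smul (crd x b) b))"
    proof (rule D.finsum_cong')
      fix b assume b: "b \<in> B"
      have "(\<Oplus>l\<in>B. Y (x * l) \<otimes> p l b \<otimes> X b) = (\<Oplus>l\<in>B. Y (x * l) \<otimes> p l b) \<otimes> X b"
        by (rule D.finsum_ldistr[symmetric, OF finite_Basis]) (use p b in auto)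
      then show "(\<Oplus>l\<in>B. Y (x * l) \<otimes> p l b \<otimes> X b) = k \<otimes> X (smul (crd x b) b)"
        using k by (simp add: rel[OF b] X_smul D.m_assoc)
    qed (use k in auto)
    also have "\<dots> = k \<otimes> (\<Oplus>b\<in>B. X (smul (crd x b) b))"
      by (rule D.finsum_rdistr[symmetric, OF finite_Basis]) (use k in auto)
    also have "(\<Oplus>b\<in>B. X (smul (crd x b) b)) = X x"
      by (simp add: X_sum[OF finite_Basis, symmetric] sum_crd)
    also have "inv k \<otimes> (k \<otimes> X x) = X x"
      using k k0 by (simp add: D.m_assoc[symmetric])
    finally show "(\<Oplus>l\<in>B. Y (x * l) \<otimes> d l) = X x" .
  qed
qed

lemma maximal_subfield_iff_frobenius:
  "maximal_subfield (R_V smul D j) D \<longleftrightarrow> frobenius_algebra smul"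
  using faithful_imp_maximal maximal_imp_faithful faithful_imp_frobenius frobenius_imp_faithful
  unfolding K_eq by blast

end

section \<open>Equivalence of the four conditions\<close>

theorem proposition5p6:
  fixes smul :: "'k::field_char_0 \<Rightarrow> 'a::ring \<Rightarrow> 'a"
  assumes "fd_unital_algebra smul"
  shows "(frobenius_algebra smul \<longleftrightarrow> frobenius_lie_algebra (L_smul smul) L_bracket) \<and>
         (frobenius_lie_algebra (L_smul smul) L_bracket \<longleftrightarrow>
            cp_ideal (L_smul smul) L_bracket V_ideal) \<and>
         (\<forall>(D :: 'd ring) j.
            quotient_division_ring (enveloping_algebra (L_smul smul) L_bracket) D j \<longrightarrow>
            (cp_ideal (L_smul smul) L_bracket V_ideal \<longleftrightarrow>
               maximal_subfield (R_V smul D j) D))"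
proof -
  obtain B where "finite_dimensional_vector_space smul B"
    using fd_unital_algebra.finite_dim[OF assms] by (auto simp: finite_dimensional_def)
  then interpret fd_algebra_char_0 smul B
    using assms by (simp add: fd_algebra_char_0_def fd_algebra_basis_def)
  have "cp_ideal (L_smul smul) L_bracket V_ideal \<longleftrightarrow> maximal_subfield (R_V smul D j) D"
    if "quotient_division_ring (enveloping_algebra (L_smul smul) L_bracket) D j" for D :: "'d ring" and j
  proof -
    interpret enveloping_quotient smul B D j
      by unfold_locales (rule that)
    \<comment> \<open>Conditions (3) and (4) are compared through (1).\<close>
    show ?thesis
      using maximal_subfield_iff_frobenius cp_ideal_V_iff frobenius_algebra_iff by simp
  qed
  then show ?thesis
    using frobenius_algebra_iff frobenius_lie_iff cp_ideal_V_iff by simp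
qed
end
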